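(* Let $C$ be an algebraically closed subfield of $\mathbb{C}$, let $n$ be a prime number, and let $G\subset\mathrm{GL}_n(C)$ be an irreducible, imprimitive algebraic group such that $G/G^0$ is finite and cyclic. Then, up to conjugation, one of the following holds: (1) $G=\bigcup_{\ell=0}^{n-1}\mathcal{M}_\ell$; in this case $G^0\cong(C^* )^n$, $G/G^0\cong\mathbb{Z}/n\mathbb{Z}$ and $\det(G)=C^*$; (2) there is a positive integer $s$ such that $G\cap\mathcal{M}_0=\{\mathrm{Diag}(\alpha_1,\dots,\alpha_n): (\alpha_1\cdots\alpha_n)^s=1\}$, and there is a matrix $\mathscr{M}=E_n(\alpha_1,\dots,\alpha_n)$ with $\alpha_1\cdots\alpha_n=e^{2\mathbf{i}\pi k/(ns)}$ for some integer $k$ with $\gcd(k,s)=1$, whose class generates $G/G^0$. In this case $G^0=\{\mathrm{Diag}(\alpha_1,\dots,\alpha_n):\alpha_1\cdots\alpha_n=1\}\cong(C^* )^{n-1}$, $G/G^0\cong\mathbb{Z}/ns\mathbb{Z}$, and (a) if $n=2$ then $\det(G)\cong\mathbb{Z}/(2s/\gcd(k+s,2))\mathbb{Z}$; (b) if $n>2$ then $\det(G)\cong\mathbb{Z}/(ns/\gcd(k,n))\mathbb{Z}$.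
   Context: $G^0$ is the identity component of $G$. $G$ is irreducible if no nontrivial proper subspace of $C^n$ is $G$-invariant; imprimitive if there is a nontrivial decomposition $C^n=V_1\oplus\dots\oplus V_k$ ($k\ge 2$) with every element of $G$ permuting the $V_i$. $E=E_n$ is the $n\times n$ matrix with entries $1$ at positions $(i,i+1)$ for $1\le i\le n-1$ and at $(n,1)$, and $0$ elsewhere. For $(\alpha_1,\dots,\alpha_n)\in(C^* )^n$, $E_n(\alpha_1,\dots,\alpha_n):=\mathrm{Diag}(\alpha_1,\dots,\alpha_n)E_n$ (entries $\alpha_i$ at $(i,i+1)$ for $i<n$ and $\alpha_n$ at $(n,1)$). $\mathcal{M}_\ell$ is the set of invertible matrices of the form $\mathrm{Diag}(\alpha_1,\dots,\alpha_n)E^\ell$. Finite groups $\mathbb{Z}/m\mathbb{Z}$ inside $C^*$ mean the group of $m$-th roots of unity. *)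

theory Defs
  imports
    "Jordan_Normal_Form.VS_Connect"
    "HOL-Algebra.Elementary_Groups"
    "HOL-Algebra.Subrings"
    "HOL-Analysis.Abstract_Topology_2"
begin

definition algebraically_closed_subfield :: "complex set \<Rightarrow> bool" where
  "algebraically_closed_subfield K \<longleftrightarrow>
     subfield K class_ring \<and>
     (\<forall>p. range (Polynomial.coeff p) \<subseteq> K \<and> Polynomial.degree p > 0 \<longrightarrow> (\<exists>z\<in>K. poly p z = 0))"

definition GL :: "complex set \<Rightarrow> nat \<Rightarrow> complex mat monoid" where
  "GL K n = \<lparr>carrier = {A \<in> carrier_mat n n. (\<forall>i<n. \<forall>j<n. A $$ (i, j) \<in> K) \<and> det A \<noteq> 0},
             mult = (*), one = 1\<^sub>m n\<rparr>"


subsection \<open>Linear algebraic groups\<close>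

text \<open>The coordinate ring \<open>K[x\<^sub>i\<^sub>j, 1/det]\<close> of \<open>GL\<^sub>n\<close>, as a set of functions on matrices; only
  their values on the carrier of \<open>GL K n\<close> matter.\<close>

inductive_set regular_functions :: "complex set \<Rightarrow> nat \<Rightarrow> (complex mat \<Rightarrow> complex) set"
  for K n where
    const: "c \<in> K \<Longrightarrow> (\<lambda>_. c) \<in> regular_functions K n"
  | entry: "i < n \<Longrightarrow> j < n \<Longrightarrow> (\<lambda>A. A $$ (i, j)) \<in> regular_functions K n"
  | inverse_det: "(\<lambda>A. inverse (det A)) \<in> regular_functions K n"
  | add: "f \<in> regular_functions K n \<Longrightarrow> g \<in> regular_functions K n \<Longrightarrow>
          (\<lambda>A. f A + g A) \<in> regular_functions K n"
  | mult: "f \<in> regular_functions K n \<Longrightarrow> g \<in> regular_functions K n \<Longrightarrow>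
          (\<lambda>A. f A * g A) \<in> regular_functions K n"

definition zero_locus :: "complex set \<Rightarrow> nat \<Rightarrow> (complex mat \<Rightarrow> complex) set \<Rightarrow> complex mat set" where
  "zero_locus K n F = {A \<in> carrier (GL K n). \<forall>f\<in>F. f A = 0}"

definition zariski :: "complex set \<Rightarrow> nat \<Rightarrow> complex mat topology" where
  "zariski K n = topology (\<lambda>U. \<exists>F \<subseteq> regular_functions K n. U = carrier (GL K n) - zero_locus K n F)"

lemma istopology_zariski:
  "istopology (\<lambda>U. \<exists>F \<subseteq> regular_functions K n. U = carrier (GL K n) - zero_locus K n F)"
  (is "istopology ?L")
  unfolding istopology_def
proof (intro conjI allI impI)
  fix S T assume "?L S" "?L T"
  then obtain F F' where F: "F \<subseteq> regular_functions K n" "S = carrier (GL K n) - zero_locus K n F"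
    and F': "F' \<subseteq> regular_functions K n" "T = carrier (GL K n) - zero_locus K n F'" by blast
  let ?P = "{(\<lambda>A. f A * g A) | f g. f \<in> F \<and> g \<in> F'}"
  have "?P \<subseteq> regular_functions K n"
    using F(1) F'(1) by (auto intro: regular_functions.mult)
  moreover have "S \<inter> T = carrier (GL K n) - zero_locus K n ?P"
    unfolding F(2) F'(2) zero_locus_def by fastforce
  ultimately show "?L (S \<inter> T)" by blast
next
  fix \<U> assume "\<forall>U\<in>\<U>. ?L U"
  then obtain F where F: "\<And>U. U \<in> \<U> \<Longrightarrow> F U \<subseteq> regular_functions K n"
    "\<And>U. U \<in> \<U> \<Longrightarrow> U = carrier (GL K n) - zero_locus K n (F U)" by metis
  have "\<Union>\<U> = (\<Union>U\<in>\<U>. carrier (GL K n) - zero_locus K n (F U))"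
    using F(2) by auto
  also have "\<dots> = carrier (GL K n) - zero_locus K n (\<Union>U\<in>\<U>. F U)"
    unfolding zero_locus_def by blast
  finally show "?L (\<Union>\<U>)"
    using F(1) by (intro exI[of _ "\<Union>U\<in>\<U>. F U"]) blast
qed

lemma openin_zariski:
  "openin (zariski K n) U \<longleftrightarrow>
     (\<exists>F \<subseteq> regular_functions K n. U = carrier (GL K n) - zero_locus K n F)"
  unfolding zariski_def topology_inverse'[OF istopology_zariski] ..

lemma topspace_zariski:
  assumes "subfield K class_ring"
  shows "topspace (zariski K n) = carrier (GL K n)"
proof -
  interpret subfield K "class_ring :: complex ring" by fact
  have "1 \<in> K" using one_closed by simp
  then have "{\<lambda>_. 1} \<subseteq> regular_functions K n"
    by (auto intro: regular_functions.const)
  then have "openin (zariski K n) (carrier (GL K n))"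
    unfolding openin_zariski by (intro exI[of _ "{\<lambda>_. 1}"]) (auto simp: zero_locus_def)
  moreover have "topspace (zariski K n) \<subseteq> carrier (GL K n)"
    using openin_topspace[of "zariski K n"] unfolding openin_zariski by blast
  ultimately show ?thesis by (simp add: openin_subset subset_antisym)
qed

lemma closedin_zariski:
  assumes "subfield K class_ring"
  shows "closedin (zariski K n) Z \<longleftrightarrow> (\<exists>F \<subseteq> regular_functions K n. Z = zero_locus K n F)"
proof -
  have "zero_locus K n F \<subseteq> carrier (GL K n)" for F
    unfolding zero_locus_def by blast
  then show ?thesis
    unfolding closedin_def topspace_zariski[OF assms] openin_zariski
    by (metis double_diff subset_refl)
qed

definition algebraic_group :: "complex set \<Rightarrow> nat \<Rightarrow> complex mat set \<Rightarrow> bool" where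
  "algebraic_group K n G \<longleftrightarrow> subgroup G (GL K n) \<and> closedin (zariski K n) G"

definition identity_component :: "complex set \<Rightarrow> nat \<Rightarrow> complex mat set \<Rightarrow> complex mat set" where
  "identity_component K n G = connected_component_of_set (subtopology (zariski K n) G) (1\<^sub>m n)"

definition component_group :: "complex set \<Rightarrow> nat \<Rightarrow> complex mat set \<Rightarrow> complex mat set monoid" where
  "component_group K n G = (GL K n)\<lparr>carrier := G\<rparr> Mod identity_component K n G"

definition regular_map_on ::
    "complex set \<Rightarrow> nat \<Rightarrow> nat \<Rightarrow> complex mat set \<Rightarrow> (complex mat \<Rightarrow> complex mat) \<Rightarrow> bool" where
  "regular_map_on K n m X \<phi> \<longleftrightarrow>
     (\<forall>i<m. \<forall>j<m. \<exists>f \<in> regular_functions K n. \<forall>A\<in>X. \<phi> A $$ (i, j) = f A)"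

text \<open>Isomorphism of the algebraic groups \<open>G \<subseteq> GL\<^sub>n\<close> and \<open>H \<subseteq> GL\<^sub>m\<close>: an isomorphism of abstract
  groups that is regular in both directions.\<close>

definition algebraic_group_iso ::
    "complex set \<Rightarrow> nat \<Rightarrow> complex mat set \<Rightarrow> nat \<Rightarrow> complex mat set \<Rightarrow> bool" where
  "algebraic_group_iso K n G m H \<longleftrightarrow>
     (\<exists>\<phi> \<in> iso ((GL K n)\<lparr>carrier := G\<rparr>) ((GL K m)\<lparr>carrier := H\<rparr>).
        regular_map_on K n m G \<phi> \<and> regular_map_on K m n H (inv_into G \<phi>))"

text \<open>The algebraic group \<open>(K\<^sup>*)\<^sup>m\<close>, realised as the diagonal matrices of \<open>GL\<^sub>m\<close>.\<close>

definition torus :: "complex set \<Rightarrow> nat \<Rightarrow> complex mat set" where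
  "torus K m = {mat_diag m \<alpha> | \<alpha>. \<forall>i<m. \<alpha> i \<in> K - {0}}"


subsection \<open>Irreducible and imprimitive matrix groups\<close>

definition vector_space_over :: "complex set \<Rightarrow> nat \<Rightarrow> (complex, complex vec) module" where
  "vector_space_over K n =
     (module_vec TYPE(complex) n)\<lparr>carrier := {v \<in> carrier_vec n. \<forall>i<n. v $ i \<in> K}\<rparr>"

abbreviation linear_subspace :: "complex set \<Rightarrow> nat \<Rightarrow> complex vec set \<Rightarrow> bool" where
  "linear_subspace K n W \<equiv>
     VectorSpace.subspace (class_ring\<lparr>carrier := K\<rparr>) W (vector_space_over K n)"

lemma linear_subspace_iff:
  assumes "subfield K class_ring"
  shows "linear_subspace K n W \<longleftrightarrow>
    W \<subseteq> carrier_vec n \<and> (\<forall>w\<in>W. \<forall>i<n. w $ i \<in> K) \<and> 0\<^sub>v n \<in> W \<and>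
    (\<forall>v\<in>W. \<forall>w\<in>W. v + w \<in> W) \<and> (\<forall>c\<in>K. \<forall>w\<in>W. c \<cdot>\<^sub>v w \<in> W)"
proof -
  let ?R = "(class_ring :: complex ring)\<lparr>carrier := K\<rparr>" and ?V = "vector_space_over K n"
  have R: "ring (class_ring :: complex ring)"
    using class_field by (metis cring.axioms(1) domain.axioms(1) field.axioms(1))
  have F: "field ?R" using ring.subfield_iff(2)[OF R assms] .
  note sub = subringE[OF subfieldE(1)[OF assms]]
  have K: "0 \<in> K" "1 \<in> K" "\<And>a b. a \<in> K \<Longrightarrow> b \<in> K \<Longrightarrow> a + b \<in> K"
    "\<And>a b. a \<in> K \<Longrightarrow> b \<in> K \<Longrightarrow> a * b \<in> K"
    using sub(2,3,6,7) by auto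
  have uminus: "- a \<in> K" if "a \<in> K" for a
  proof -
    have "0 = \<ominus>\<^bsub>class_ring\<^esub> a + a"
      using ring.ring_simprules(9)[OF R, of a] by simp
    then have "\<ominus>\<^bsub>class_ring\<^esub> a = - a"
      by (simp add: eq_neg_iff_add_eq_0)
    then show ?thesis using sub(5)[OF that] by simp
  qed
  have M: "Module.module ?R ?V"
  proof (rule Module.moduleI)
    show "cring ?R" using F by (metis domain.axioms(1) field.axioms(1))
    show "abelian_group ?V"
    proof (rule abelian_groupI)
      fix x assume "x \<in> carrier ?V"
      then show "\<exists>y \<in> carrier ?V. y \<oplus>\<^bsub>?V\<^esub> x = \<zero>\<^bsub>?V\<^esub>"
        by (intro bexI[of _ "- x"]) (auto simp: vector_space_over_def module_vec_def uminus)
    qed (auto simp: vector_space_over_def module_vec_def K comm_add_vec)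
  qed (auto simp: vector_space_over_def module_vec_def K smult_add_distrib_vec
        add_smult_distrib_vec smult_smult_assoc)
  then have "vectorspace ?R ?V" using F by (simp add: vectorspace_def)
  with M show ?thesis
    unfolding VectorSpace.subspace_def submodule_def
    by (auto simp: vector_space_over_def module_vec_def)
qed

definition irreducible_group :: "complex set \<Rightarrow> nat \<Rightarrow> complex mat set \<Rightarrow> bool" where
  "irreducible_group K n G \<longleftrightarrow>
     (\<forall>W. linear_subspace K n W \<and> (\<forall>A\<in>G. \<forall>w\<in>W. A *\<^sub>v w \<in> W) \<longrightarrow>
          W = {0\<^sub>v n} \<or> W = carrier (vector_space_over K n))"

definition direct_decomposition ::
    "complex set \<Rightarrow> nat \<Rightarrow> nat \<Rightarrow> (nat \<Rightarrow> complex vec set) \<Rightarrow> bool" where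
  "direct_decomposition K n k V \<longleftrightarrow>
     (\<forall>i<k. linear_subspace K n (V i)) \<and>
     (\<forall>v \<in> carrier (vector_space_over K n).
        \<exists>!w. w \<in> Pi\<^sub>E {..<k} V \<and> v = finsum_vec TYPE(complex) n w {..<k})"

definition imprimitive_group :: "complex set \<Rightarrow> nat \<Rightarrow> complex mat set \<Rightarrow> bool" where
  "imprimitive_group K n G \<longleftrightarrow>
     (\<exists>k\<ge>2. \<exists>V. direct_decomposition K n k V \<and> (\<forall>i<k. V i \<noteq> {0\<^sub>v n}) \<and>
        (\<forall>A\<in>G. \<exists>\<sigma>. \<sigma> permutes {..<k} \<and> (\<forall>i<k. (\<lambda>v. A *\<^sub>v v) ` V i = V (\<sigma> i))))"


subsection \<open>Monomial matrices\<close>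

text \<open>Matrix and coefficient indices run from \<open>0\<close> to \<open>n - 1\<close>.\<close>

definition E :: "nat \<Rightarrow> complex mat" where
  "E n = mat n n (\<lambda>(i, j). if i + 1 = j \<or> (i + 1 = n \<and> j = 0) then 1 else 0)"

definition E_diag :: "nat \<Rightarrow> (nat \<Rightarrow> complex) \<Rightarrow> complex mat" where
  "E_diag n \<alpha> = mat_diag n \<alpha> * E n"

definition monomial_matrices :: "complex set \<Rightarrow> nat \<Rightarrow> nat \<Rightarrow> complex mat set" where
  "monomial_matrices K n l = {mat_diag n \<alpha> * E n ^\<^sub>m l | \<alpha>. \<forall>i<n. \<alpha> i \<in> K - {0}}"

definition conjugate_group ::
    "complex set \<Rightarrow> nat \<Rightarrow> complex mat \<Rightarrow> complex mat set \<Rightarrow> complex mat set" where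
  "conjugate_group K n P G = (\<lambda>A. P * A * inv\<^bsub>GL K n\<^esub> P) ` G"

definition roots_of_unity :: "nat \<Rightarrow> complex set" where
  "roots_of_unity m = {z. z ^ m = 1}"

end

theory Submission
  imports Defs "HOL-Computational_Algebra.Polynomial_Factorial" "Jordan_Normal_Form.Char_Poly"
begin

hide_const (open) UnivPoly.coeff UnivPoly.monom Module.smult UnivPoly.deg

text \<open>The projections onto the \<open>k\<close> blocks of an imprimitive irreducible group are permuted transitively, so
  they have the same characteristic polynomial \<open>c\<close>, and \<open>c\<^sup>k = (x\<^sup>k\<^sup>-\<^sup>1 (x - 1))\<^sup>n\<close>. Comparing multiplicities of
  the root \<open>1\<close> gives \<open>k dvd n\<close>, hence \<open>k = n\<close> and the group is monomial. By connectedness \<open>G\<^sup>0\<close> is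
  diagonal, so the cyclic group \<open>G / G\<^sup>0\<close> permutes the coordinate lines transitively and its generator
  becomes \<open>E\<^sub>n(1, \<dots>, 1, a)\<close>. The closed group \<open>G\<^sup>0\<close> is cut out by the characters that are trivial on it.
  These form an ideal of \<open>\<int>[x] / (x\<^sup>n - 1)\<close> that is saturated because \<open>G\<^sup>0\<close> is connected, and that does
  not contain \<open>x - 1\<close>: otherwise \<open>G\<^sup>0\<close> is scalar and an eigenline of the generator is invariant. As the
  cyclotomic polynomial \<open>\<Phi>\<^sub>n\<close> is irreducible, the ideal is contained in \<open>(\<Phi>\<^sub>n)\<close>, so \<open>G\<^sup>0\<close> is the full torus
  or its subgroup of determinant \<open>1\<close>.\<close>

subsection \<open>Ideals modulo the cyclotomic polynomial\<close>

text \<open>Connectedness gives saturation as follows: if a power of a character is trivial on the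
  identity component, the character takes finitely many values there, and a regular function with
  finitely many values on a connected set is constant. Saturation in turn compensates for
  \<open>int poly\<close> not being a principal ideal ring. The trivial characters are stable under
  multiplication by x because conjugation by the generator h = E_n(1,...,1,a) shifts diagonal
  entries cyclically. An eigenline of h over \<open>K\<close> exists because \<open>K\<close>
  contains an n-th root of a. The integers of case (2) come from h^n being the scalar matrix a: s is
  the order of its determinant a^n, so that a = e^(2 pi i k/(ns)), and exactness of this order means
  gcd(k,s) = 1. The two formulas for det(G) differ because det E_n is -1 for n = 2 and 1 for odd
  n.\<close>

lemma eisenstein_aux:
  fixes g h :: "int poly"
  assumes p: "prime p" and low: "\<And>i. i < degree (g * h) \<Longrightarrow> p dvd coeff (g * h) i"
    and lg: "\<not> p dvd lead_coeff g" and h0: "\<not> p dvd coeff h 0" and nz: "h \<noteq> 0"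
  shows "degree h = 0"
proof -
  \<comment> \<open>Modulo \<open>p\<close>, the coefficient of \<open>g * h\<close> at the least
    such index \<open>i\<close> is \<open>coeff g i * coeff h 0\<close>, which is nonzero. Hence
    \<open>i\<close> is at least the degree of the product, although
    \<open>i \<le> degree g\<close>.\<close>
  define i where "i = (LEAST i. \<not> p dvd coeff g i)"
  have i: "\<not> p dvd coeff g i"
    unfolding i_def using lg by (rule LeastI)
  have i_le: "i \<le> degree g"
    unfolding i_def using lg by (rule Least_le)
  have less: "p dvd coeff g j" if "j < i" for j
    using that not_less_Least unfolding i_def by blast
  have "coeff (g * h) i = coeff g i * coeff h 0 + (\<Sum>j<i. coeff g j * coeff h (i - j))"
    unfolding coeff_mult by (subst lessThan_Suc_atMost[symmetric], subst sum.lessThan_Suc) simp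
  moreover have "p dvd (\<Sum>j<i. coeff g j * coeff h (i - j))"
    by (rule dvd_sum) (simp add: less)
  moreover have "\<not> p dvd coeff g i * coeff h 0"
    using p i h0 by (simp add: prime_dvd_mult_iff)
  ultimately have "\<not> p dvd coeff (g * h) i"
    by (simp add: dvd_add_left_iff)
  then have "\<not> i < degree (g * h)" using low by blast
  moreover have "degree (g * h) = degree g + degree h"
    using nz lg by (intro degree_mult_eq) auto
  ultimately show ?thesis using i_le by simp
qed

text \<open>Because of \<open>sq\<close>, \<open>p\<close> cannot divide the constant coefficients
  of both factors. \<open>eisenstein_aux\<close> makes the factor it misses constant, and monicity
  of \<open>f\<close> makes that constant a unit.\<close>

lemma eisenstein_irreducible:
  fixes f :: "int poly"
  assumes p: "prime p" and monic: "lead_coeff f = 1" and deg: "degree f > 0"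
    and low: "\<And>i. i < degree f \<Longrightarrow> p dvd coeff f i" and sq: "\<not> p\<^sup>2 dvd coeff f 0"
  shows "irreducible f"
proof (rule irreducibleI)
  show "f \<noteq> 0" "\<not> f dvd 1" using deg by (auto dest: dvd_imp_degree_le)
next
  fix g h assume f: "f = g * h"
  have lc: "lead_coeff g * lead_coeff h = 1" using monic unfolding f lead_coeff_mult .
  then have u: "is_unit (lead_coeff g)" "is_unit (lead_coeff h)"
    by (metis dvdI, metis dvdI mult.commute)
  have np: "\<not> p dvd u" if "is_unit u" for u
    using that p by (meson dvd_trans not_prime_unit)
  have unit: "k dvd 1" if "degree k = 0" "is_unit (lead_coeff k)" for k :: "int poly"
    using that by (auto elim!: degree_eq_zeroE simp: is_unit_const_poly_iff)
  have nz: "g \<noteq> 0" "h \<noteq> 0" using deg f by auto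
  have "\<not> (p dvd coeff g 0 \<and> p dvd coeff h 0)"
    using sq unfolding f coeff_mult_0 power2_eq_square by (meson mult_dvd_mono)
  moreover have "p dvd coeff g 0 \<or> p dvd coeff h 0"
    using low[of 0] deg p unfolding f coeff_mult_0 by (simp add: prime_dvd_mult_iff)
  ultimately consider "\<not> p dvd coeff h 0" | "\<not> p dvd coeff g 0" by blast
  then show "g dvd 1 \<or> h dvd 1"
  proof cases
    case 1
    have "degree h = 0" by (rule eisenstein_aux[OF p, of g]) (use low f np u nz 1 in auto)
    then show ?thesis using unit u by blast
  next
    case 2
    have "degree g = 0" by (rule eisenstein_aux[OF p, of h]) (use low f np u nz 2 in \<open>auto simp: mult.commute\<close>)
    then show ?thesis using unit u by blast
  qed
qed

text \<open>This is (x^n - 1)/(x - 1), which coincides with the n-th cyclotomic polynomial for prime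
  \<open>n\<close>.\<close>

definition cyclotomic_prime :: "nat \<Rightarrow> int poly" where
  "cyclotomic_prime n = (\<Sum>i<n. monom 1 i)"

lemma coeff_cyclotomic_prime: "coeff (cyclotomic_prime n) i = (if i < n then 1 else 0)"
  by (simp add: cyclotomic_prime_def coeff_sum)

lemma degree_cyclotomic_prime:
  assumes "n > 0" shows "degree (cyclotomic_prime n) = n - 1"
proof (rule antisym)
  show "degree (cyclotomic_prime n) \<le> n - 1"
    by (rule degree_le) (use assms in \<open>auto simp: coeff_cyclotomic_prime\<close>)
  show "n - 1 \<le> degree (cyclotomic_prime n)"
    by (rule le_degree) (use assms in \<open>auto simp: coeff_cyclotomic_prime\<close>)
qed

lemma cyclotomic_prime_mult: "[:-1, 1:] * cyclotomic_prime n = monom 1 n - 1"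
proof (rule poly_eqI)
  fix i
  show "coeff ([:-1, 1:] * cyclotomic_prime n) i = coeff (monom 1 n - 1) i"
    by (cases i) (auto simp: coeff_cyclotomic_prime coeff_pCons)
qed

text \<open>Eisenstein at \<open>n\<close> applies after substituting x + 1 for x, which gives ((x +
  1)^n - 1)/x with coefficients \<open>n choose Suc i\<close>. The substitution is an automorphism
  of the ring, so primality transfers back.\<close>

lemma prime_elem_cyclotomic_prime:
  assumes "prime n" shows "prime_elem (cyclotomic_prime n)"
proof -
  have n: "n \<ge> 2" using assms by (rule prime_ge_2_nat)
  define F where "F = pcompose (cyclotomic_prime n) [:1, 1:]"
  have pcompose_monom: "pcompose (monom 1 k) [:1, 1:] = ([:1, 1:] ^ k :: int poly)" for k
    by (induction k) (simp_all add: monom_Suc pcompose_pCons monom_0 pcompose_const)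
  have "[:0, 1:] * F = pcompose ([:-1, 1:] * cyclotomic_prime n) [:1, 1:]"
    unfolding F_def pcompose_mult by (simp add: pcompose_pCons)
  also have "\<dots> = [:1, 1:] ^ n - 1"
    unfolding cyclotomic_prime_mult by (simp add: pcompose_diff pcompose_1 pcompose_monom)
  finally have xF: "pCons 0 F = [:1, 1:] ^ n - 1" by simp
  have coeff_F: "coeff F i = int (n choose Suc i)" for i
  proof -
    have "coeff F i = coeff (pCons 0 F) (Suc i)" by simp
    also have "\<dots> = int (n choose Suc i)" unfolding xF
      by (cases "Suc i \<le> n") (simp_all add: coeff_linear_poly_power binomial_eq_0 coeff_eq_0 degree_linear_power)
    finally show ?thesis .
  qed
  have degF: "degree F = n - 1"
    using n by (simp add: F_def degree_pcompose degree_cyclotomic_prime)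
  have "irreducible F"
  proof (rule eisenstein_irreducible[of "int n"])
    show "prime (int n)" using assms by simp
    show "lead_coeff F = 1" "degree F > 0" using n by (simp_all add: degF coeff_F)
    show "int n dvd coeff F i" if "i < degree F" for i
      unfolding coeff_F of_nat_dvd_iff
      using that degF assms n by (intro dvd_choose_prime) auto
    show "\<not> (int n)\<^sup>2 dvd coeff F 0"
      using n by (auto simp: coeff_F power2_eq_square)
  qed
  then have prime_F: "prime_elem F" by (rule irreducible_imp_prime_elem)
  have inv: "pcompose (pcompose f [:1, 1:]) [:-1, 1:] = f" for f :: "int poly"
    by (simp add: pcompose_assoc[symmetric] pcompose_pCons)
  have dvd: "cyclotomic_prime n dvd f \<longleftrightarrow> F dvd pcompose f [:1, 1:]" for f
  proof
    assume "cyclotomic_prime n dvd f"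
    then show "F dvd pcompose f [:1, 1:]" unfolding F_def by (auto simp: pcompose_mult elim!: dvdE)
  next
    assume "F dvd pcompose f [:1, 1:]"
    then obtain g where "pcompose f [:1, 1:] = F * g" by (elim dvdE)
    then have "pcompose (pcompose f [:1, 1:]) [:-1, 1:] = pcompose F [:-1, 1:] * pcompose g [:-1, 1:]"
      by (simp add: pcompose_mult)
    then show "cyclotomic_prime n dvd f" unfolding inv F_def by simp
  qed
  show ?thesis
  proof (rule prime_elemI)
    have "degree (cyclotomic_prime n) > 0" using n by (simp add: degree_cyclotomic_prime)
    then show "cyclotomic_prime n \<noteq> 0" "\<not> cyclotomic_prime n dvd 1" by (auto dest: dvd_imp_degree_le)
    fix f g assume "cyclotomic_prime n dvd f * g"
    then show "cyclotomic_prime n dvd f \<or> cyclotomic_prime n dvd g"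
      unfolding dvd pcompose_mult using prime_F by (simp add: prime_elem_dvd_mult_iff)
  qed
qed

text \<open>An ideal of Z[x] need not be principal, but saturation allows replacing an element of
  least degree by its primitive part \<open>d\<close>. Pseudo-division shows that \<open>d\<close>
  divides an integer multiple of each element, and Gauss's lemma removes the integer.\<close>

lemma saturated_ideal_principal:
  fixes I :: "int poly set"
  assumes add: "\<And>f g. f \<in> I \<Longrightarrow> g \<in> I \<Longrightarrow> f + g \<in> I"
    and mult: "\<And>f g. f \<in> I \<Longrightarrow> g * f \<in> I"
    and sat: "\<And>c f. c \<noteq> 0 \<Longrightarrow> Polynomial.smult c f \<in> I \<Longrightarrow> f \<in> I"
    and ex: "f0 \<in> I" "f0 \<noteq> 0"
  obtains d where "d \<in> I" "\<And>f. f \<in> I \<Longrightarrow> d dvd f"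
proof -
  define k where "k = (LEAST k. \<exists>f\<in>I. f \<noteq> 0 \<and> degree f = k)"
  have "\<exists>k. \<exists>f\<in>I. f \<noteq> 0 \<and> degree f = k" using ex by blast
  then have "\<exists>f\<in>I. f \<noteq> 0 \<and> degree f = k" unfolding k_def by (rule LeastI_ex)
  then obtain e where e: "e \<in> I" "e \<noteq> 0" "degree e = k" by blast
  have least: "degree f \<ge> k" if "f \<in> I" "f \<noteq> 0" for f
    unfolding k_def using that by (intro Least_le) auto
  define d where "d = primitive_part e"
  have d: "d \<in> I" "d \<noteq> 0" "degree d = k" "content d = 1"
    using e sat[of "content e" d] by (auto simp: d_def)
  have "d dvd f" if f: "f \<in> I" for f
  proof -
    obtain q r where qr: "pseudo_divmod f d = (q, r)" by fastforce
    let ?c = "lead_coeff d ^ (Suc (degree f) - degree d)"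
    have c: "?c \<noteq> 0" using d(2) by (simp del: power_Suc)
    have eq: "Polynomial.smult ?c f = d * q + r" and r: "r = 0 \<or> degree r < degree d"
      using pseudo_divmod[OF d(2) qr] by auto
    have "r = [:?c:] * f + (- q) * d" using eq by (simp add: algebra_simps)
    then have "r \<in> I" using add mult f d(1) by metis
    then have "r = 0" using r least[of r] d(3) by (metis not_less)
    then have *: "d dvd Polynomial.smult ?c f" using eq by simp
    then obtain q' where q': "Polynomial.smult ?c f = d * q'" by (elim dvdE)
    \<comment> \<open>Over the fraction field the scalar \<open>?c\<close> is invertible;
      \<open>content d = 1\<close> brings the divisibility back to integer polynomials.\<close>
    have "fract_poly d dvd fract_poly f"
    proof -
      have "Polynomial.smult (to_fract ?c) (fract_poly f) = fract_poly d * fract_poly q'"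
        using arg_cong[OF q', of fract_poly] by simp
      then have "fract_poly d dvd Polynomial.smult (to_fract ?c) (fract_poly f)" by simp
      moreover have "to_fract ?c \<noteq> 0" using c by (simp only: to_fract_eq_0_iff not_False_eq_True)
      ultimately show ?thesis using dvd_smult_cancel by blast
    qed
    then show ?thesis using d(4) by (rule fract_poly_dvdD)
  qed
  with d(1) show thesis by (rule that)
qed

text \<open>A saturated ideal is principal, and its generator divides \<open>x\<^sup>n - 1 = (x - 1) \<Phi>\<^sub>n\<close>.\<close>

lemma saturated_ideal_cyclotomic:
  fixes I :: "int poly set"
  assumes n: "prime n"
    and add: "\<And>f g. f \<in> I \<Longrightarrow> g \<in> I \<Longrightarrow> f + g \<in> I"
    and mult: "\<And>f g. f \<in> I \<Longrightarrow> g * f \<in> I"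
    and sat: "\<And>c f. c \<noteq> 0 \<Longrightarrow> Polynomial.smult c f \<in> I \<Longrightarrow> f \<in> I"
    and xn: "monom 1 n - 1 \<in> I" and x: "[:-1, 1:] \<notin> I" and f: "f \<in> I"
  shows "cyclotomic_prime n dvd f"
proof (cases "f = 0")
  case False
  obtain d where d: "d \<in> I" "\<And>f. f \<in> I \<Longrightarrow> d dvd f"
    by (rule saturated_ideal_principal[of I f]) (use add mult sat f False in auto)
  have pr: "prime_elem (cyclotomic_prime n)" using n by (rule prime_elem_cyclotomic_prime)
  obtain q where q: "[:-1, 1:] * cyclotomic_prime n = d * q"
    using d(2)[OF xn] unfolding cyclotomic_prime_mult by (elim dvdE)
  then have "cyclotomic_prime n dvd d * q" by (metis dvd_triv_right)
  then consider "cyclotomic_prime n dvd d" | "cyclotomic_prime n dvd q"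
    using pr by (auto simp: prime_elem_dvd_mult_iff)
  then show ?thesis
  proof cases
    case 1 then show ?thesis using d(2)[OF f] by (rule dvd_trans)
  next
    case 2
    \<comment> \<open>Cancelling the cyclotomic factor leaves \<open>[:-1, 1:] = r * d\<close>,
      which would put x - 1 into the ideal.\<close>
    then obtain r where "q = cyclotomic_prime n * r" by (elim dvdE)
    then have "[:-1, 1:] * cyclotomic_prime n = (r * d) * cyclotomic_prime n"
      using q by (simp add: ac_simps)
    then have "[:-1, 1:] = r * d" using pr by (simp only: mult_cancel_right) auto
    then show ?thesis using mult[OF d(1), of r] x by simp
  qed
qed simp

text \<open>The degree bound leaves only a constant as cofactor, and the coefficients of
  \<open>cyclotomic_prime n\<close> below \<open>n\<close> are all 1.\<close>

lemma coeff_multiple_of_cyclotomic_prime: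
  assumes "n > 0" "cyclotomic_prime n dvd f" "degree f < n" "i < n" "j < n"
  shows "coeff f i = coeff f j"
proof (cases "f = 0")
  case False
  obtain q where q: "f = cyclotomic_prime n * q" using assms(2) by (elim dvdE)
  have "degree f = degree (cyclotomic_prime n) + degree q"
    unfolding q using False q by (intro degree_mult_eq) auto
  then have "degree q = 0" using assms degree_cyclotomic_prime[of n] by simp
  then obtain c where "q = [:c:]" by (rule degree_eq_zeroE)
  then show ?thesis using q assms by (simp add: coeff_cyclotomic_prime)
qed simp

subsection \<open>The general linear group over a subfield\<close>

text \<open>The dimension \<open>n\<close> is an arbitrary parameter, which permits a second
  interpretation at \<open>n - 1\<close> for the smaller torus.\<close>

locale matrix_group_field =
  fixes K :: "complex set" and n :: nat
  assumes subfield_K: "subfield K class_ring"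
begin

lemma class_ring_ring: "ring (class_ring :: complex ring)"
  using class_field by (metis cring.axioms(1) domain.axioms(1) field.axioms(1))

lemma
  shows zero_K: "0 \<in> K" and one_K: "1 \<in> K"
    and add_K: "\<And>a b. a \<in> K \<Longrightarrow> b \<in> K \<Longrightarrow> a + b \<in> K"
    and mult_K: "\<And>a b. a \<in> K \<Longrightarrow> b \<in> K \<Longrightarrow> a * b \<in> K"
  using subringE(2,3,6,7)[OF subfieldE(1)[OF subfield_K]] by auto

lemma uminus_K:
  assumes "a \<in> K" shows "- a \<in> K"
proof -
  have "0 = \<ominus>\<^bsub>class_ring\<^esub> a + a"
    using ring.ring_simprules(9)[OF class_ring_ring, of a] by simp
  then have "\<ominus>\<^bsub>class_ring\<^esub> a = - a"
    by (simp add: eq_neg_iff_add_eq_0)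
  then show ?thesis using subringE(5)[OF subfieldE(1)[OF subfield_K] assms] by simp
qed

lemma inverse_K:
  assumes "a \<in> K" shows "inverse a \<in> K"
proof (cases "a = 0")
  case False
  have "field (class_ring\<lparr>carrier := K\<rparr> :: complex ring)"
    using ring.subfield_iff(2)[OF class_ring_ring subfield_K] .
  then have "Units (class_ring\<lparr>carrier := K\<rparr> :: complex ring) = K - {0}"
    using field.field_Units by fastforce
  then obtain b where "b \<in> K" "a * b = 1"
    using assms False unfolding Units_def by auto
  then show ?thesis using False by (metis inverse_unique)
qed (simp add: zero_K)

lemma divide_K: "a \<in> K \<Longrightarrow> b \<in> K \<Longrightarrow> a / b \<in> K"
  by (simp add: divide_inverse mult_K inverse_K)

lemma sum_K: "(\<And>i. i \<in> I \<Longrightarrow> f i \<in> K) \<Longrightarrow> sum f I \<in> K"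
  by (induction I rule: infinite_finite_induct) (auto simp: zero_K add_K)

lemma prod_K: "(\<And>i. i \<in> I \<Longrightarrow> f i \<in> K) \<Longrightarrow> prod f I \<in> K"
  by (induction I rule: infinite_finite_induct) (auto simp: one_K mult_K)

lemma power_K: "a \<in> K \<Longrightarrow> a ^ k \<in> K" for k :: nat
  by (induction k) (auto simp: one_K mult_K)

lemma det_K:
  assumes "A \<in> carrier_mat m m" "\<And>i j. i < m \<Longrightarrow> j < m \<Longrightarrow> A $$ (i, j) \<in> K"
  shows "det A \<in> K"
proof -
  have "of_int (sign p) * (\<Prod>i = 0..<m. A $$ (i, p i)) \<in> K" if "p permutes {0..<m}" for p
  proof (intro mult_K prod_K)
    show "of_int (sign p) \<in> K" by (auto simp: sign_def one_K uminus_K)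
    show "A $$ (i, p i) \<in> K" if "i \<in> {0..<m}" for i
      using assms(2) that permutes_in_image[OF \<open>p permutes {0..<m}\<close>, of i] by auto
  qed
  then show ?thesis
    unfolding det_def'[OF assms(1)] by (intro sum_K) auto
qed

abbreviation "GLK \<equiv> GL K n"

lemma GL_iff: "A \<in> carrier GLK \<longleftrightarrow>
    A \<in> carrier_mat n n \<and> (\<forall>i<n. \<forall>j<n. A $$ (i, j) \<in> K) \<and> det A \<noteq> 0"
  by (simp add: GL_def)

lemma mult_GL [simp]: "monoid.mult GLK A B = A * B" and one_GL [simp]: "one GLK = 1\<^sub>m n"
  by (simp_all add: GL_def)

lemma GL_mat: "A \<in> carrier GLK \<Longrightarrow> A \<in> carrier_mat n n"
  and GL_entry: "A \<in> carrier GLK \<Longrightarrow> i < n \<Longrightarrow> j < n \<Longrightarrow> A $$ (i, j) \<in> K"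
  and GL_det: "A \<in> carrier GLK \<Longrightarrow> det A \<noteq> 0"
  by (auto simp: GL_iff)

lemma mult_entry:
  "A \<in> carrier_mat n n \<Longrightarrow> B \<in> carrier_mat n n \<Longrightarrow> i < n \<Longrightarrow> j < n \<Longrightarrow>
    (A * B) $$ (i, j) = (\<Sum>k<n. A $$ (i, k) * B $$ (k, j))"
  by (simp add: scalar_prod_def atLeast0LessThan)

lemma group_GL: "group GLK"
proof (rule groupI)
  fix A B assume A: "A \<in> carrier GLK" and B: "B \<in> carrier GLK"
  show "monoid.mult GLK A B \<in> carrier GLK"
    using A B unfolding mult_GL GL_iff
    by (auto simp: mult_entry det_mult intro!: sum_K mult_K simp del: index_mult_mat)
next
  fix A B C assume "A \<in> carrier GLK" "B \<in> carrier GLK" "C \<in> carrier GLK"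
  then show "monoid.mult GLK (monoid.mult GLK A B) C = monoid.mult GLK A (monoid.mult GLK B C)"
    by (auto simp: GL_iff)
next
  show "one GLK \<in> carrier GLK" by (auto simp: GL_iff zero_K one_K)
next
  fix A assume A: "A \<in> carrier GLK"
  then show "monoid.mult GLK (one GLK) A = A" by (auto simp: GL_iff)
  note A' = GL_mat[OF A]
  \<comment> \<open>The adjugate formula is used because its entries are minors divided by the
    determinant and so visibly lie in \<open>K\<close>.\<close>
  define B where "B = inverse (det A) \<cdot>\<^sub>m adj_mat A"
  have carrier: "B \<in> carrier_mat n n" using adj_mat(1)[OF A'] by (simp add: B_def)
  have BA: "B * A = 1\<^sub>m n"
    using adj_mat[OF A'] GL_det[OF A] A'
    by (auto simp: B_def mult_smult_assoc_mat[of _ n n _ n] intro!: eq_matI)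
  have "det B * det A = 1" using det_mult[OF carrier A'] BA by simp
  then have "det B \<noteq> 0" by auto
  moreover have "B $$ (i, j) \<in> K" if ij: "i < n" "j < n" for i j
  proof -
    have "det (mat_delete A j i) \<in> K"
    proof (rule det_K)
      show "mat_delete A j i \<in> carrier_mat (n - 1) (n - 1)" using A' by (auto simp: mat_delete_def)
      show "mat_delete A j i $$ (a, b) \<in> K" if "a < n - 1" "b < n - 1" for a b
        using that A' ij GL_entry[OF A] by (auto simp: mat_delete_def)
    qed
    moreover have "(-1) ^ (j + i) \<in> K" by (intro power_K uminus_K one_K)
    moreover have "det A \<in> K" using A' GL_entry[OF A] by (rule det_K)
    ultimately show ?thesis
      using ij A' by (auto simp: B_def adj_mat_def cofactor_def intro!: mult_K inverse_K)
  qed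
  ultimately have "B \<in> carrier GLK" using carrier unfolding GL_iff by blast
  then show "\<exists>B\<in>carrier GLK. monoid.mult GLK B A = one GLK" unfolding mult_GL one_GL using BA by blast
qed

lemmas GL_monoid = group.is_monoid[OF group_GL]

lemmas GL_m_closed = monoid.m_closed[OF GL_monoid, unfolded mult_GL one_GL]
  and GL_one_closed = monoid.one_closed[OF GL_monoid, unfolded mult_GL one_GL]
  and GL_m_assoc = monoid.m_assoc[OF GL_monoid, unfolded mult_GL one_GL]
  and GL_l_one = monoid.l_one[OF GL_monoid, unfolded mult_GL one_GL]
  and GL_r_one = monoid.r_one[OF GL_monoid, unfolded mult_GL one_GL]
  and GL_nat_pow_closed = monoid.nat_pow_closed[OF GL_monoid]
  and GL_inv_closed = group.inv_closed[OF group_GL]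
  and GL_l_inv = group.l_inv[OF group_GL, unfolded mult_GL one_GL]
  and GL_r_inv = group.r_inv[OF group_GL, unfolded mult_GL one_GL]
  and GL_inv_inv = group.inv_inv[OF group_GL]
  and GL_inv_equality = group.inv_equality[OF group_GL, unfolded mult_GL one_GL]
  and GL_inv_comm = group.inv_comm[OF group_GL, unfolded mult_GL one_GL]
  and GL_inv_mult_group = group.inv_mult_group[OF group_GL, unfolded mult_GL one_GL]
  and GL_subgroupI = group.subgroupI[OF group_GL, unfolded mult_GL one_GL]

lemma det_in_K: "A \<in> carrier GLK \<Longrightarrow> det A \<in> K"
  by (rule det_K[OF GL_mat GL_entry])

abbreviation "iv A \<equiv> inv\<^bsub>GL K n\<^esub> A"

lemma GL_pow: "A \<in> carrier GLK \<Longrightarrow> A [^]\<^bsub>GLK\<^esub> (k::nat) = A ^\<^sub>m k"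
  using GL_mat[of A] by (induction k) auto

lemma GL_pow_closed: "A \<in> carrier GLK \<Longrightarrow> A ^\<^sub>m k \<in> carrier GLK"
  using GL_nat_pow_closed GL_pow by metis

subsection \<open>Zariski topology\<close>

abbreviation "zar \<equiv> zariski K n"

lemma topspace_zar [simp]: "topspace zar = carrier GLK"
  using topspace_zariski[OF subfield_K] .

lemma regular_sum:
  assumes "finite I" "\<And>i. i \<in> I \<Longrightarrow> f i \<in> regular_functions K n"
  shows "(\<lambda>A. \<Sum>i\<in>I. f i A) \<in> regular_functions K n"
  using assms
  by (induction I rule: finite_induct)
    (auto intro: regular_functions.const[OF zero_K] regular_functions.add)

lemma regular_prod:
  assumes "finite I" "\<And>i. i \<in> I \<Longrightarrow> f i \<in> regular_functions K n"
  shows "(\<lambda>A. \<Prod>i\<in>I. f i A) \<in> regular_functions K n"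
  using assms
  by (induction I rule: finite_induct)
    (auto intro: regular_functions.const[OF one_K] regular_functions.mult)

lemma regular_power:
  assumes "f \<in> regular_functions K n" shows "(\<lambda>A. f A ^ k) \<in> regular_functions K n"
proof (induction k)
  case 0
  show ?case using regular_functions.const[OF one_K] by simp
next
  case (Suc k)
  show ?case using regular_functions.mult[OF assms Suc] by simp
qed

lemma regular_diff_const:
  assumes "f \<in> regular_functions K n" "c \<in> K" shows "(\<lambda>A. f A - c) \<in> regular_functions K n"
  using regular_functions.add[OF assms(1) regular_functions.const[OF uminus_K[OF assms(2)]]]
  by (simp only: add_uminus_conv_diff)

lemma regular_value_K:
  assumes "f \<in> regular_functions K n" "A \<in> carrier GLK" shows "f A \<in> K"
  using assms(1)
  by induction (auto simp: add_K mult_K inverse_K det_in_K[OF assms(2)] GL_entry[OF assms(2)])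

text \<open>Each entry of \<open>B * A * C\<close> is a \<open>K\<close>-linear form in the entries
  of \<open>A\<close>, and the inverse determinant only acquires a constant factor. The witness
  \<open>g\<close> agrees with the translate on invertible matrices, which is all that the topology
  sees.\<close>

lemma regular_translate:
  assumes B: "B \<in> carrier GLK" and C: "C \<in> carrier GLK" and f: "f \<in> regular_functions K n"
  shows "\<exists>g\<in>regular_functions K n. \<forall>A\<in>carrier GLK. g A = f (B * A * C)"
  using f
proof induction
  case (const c)
  show ?case by (rule bexI[of _ "\<lambda>_. c"]) (use const in \<open>simp_all add: regular_functions.const\<close>)
next
  case (entry i j)
  have "(B * A * C) $$ (i, j) = (\<Sum>k<n. \<Sum>l<n. (B $$ (i, l) * C $$ (k, j)) * A $$ (l, k))"
    if "A \<in> carrier GLK" for A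
  proof -
    note m = GL_mat[OF B] GL_mat[OF that] GL_mat[OF C] mult_carrier_mat
    have "(B * A * C) $$ (i, j) = (\<Sum>k<n. (B * A) $$ (i, k) * C $$ (k, j))"
      using m entry by (intro mult_entry) auto
    also have "\<dots> = (\<Sum>k<n. (\<Sum>l<n. B $$ (i, l) * A $$ (l, k)) * C $$ (k, j))"
      using m entry by (intro sum.cong refl arg_cong2[of _ _ _ _ "(*)"] mult_entry) auto
    finally show ?thesis by (simp add: sum_distrib_right sum_distrib_left ac_simps)
  qed
  moreover have "(\<lambda>A. \<Sum>k<n. \<Sum>l<n. (B $$ (i, l) * C $$ (k, j)) * A $$ (l, k)) \<in> regular_functions K n"
    using entry B C
    by (intro regular_sum regular_functions.mult regular_functions.const regular_functions.entry)
      (auto intro: mult_K GL_entry)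
  ultimately show ?case by (intro bexI ballI) auto
next
  case inverse_det
  have "inverse (det B) * inverse (det C) * inverse (det A) = inverse (det (B * A * C))"
    if "A \<in> carrier GLK" for A
    using GL_mat[OF B] GL_mat[OF that] GL_mat[OF C] by (simp add: det_mult[of _ n])
  moreover have "(\<lambda>A. inverse (det B) * inverse (det C) * inverse (det A)) \<in> regular_functions K n"
    using B C by (intro regular_functions.mult[OF regular_functions.const regular_functions.inverse_det]
      mult_K inverse_K det_in_K)
  ultimately show ?case by (intro bexI) auto
next
  case (add f g)
  from add.IH obtain f' g' where "f' \<in> regular_functions K n" "g' \<in> regular_functions K n"
    "\<forall>A\<in>carrier GLK. f' A = f (B * A * C)" "\<forall>A\<in>carrier GLK. g' A = g (B * A * C)" by blast
  then show ?case by (intro bexI[of _ "\<lambda>A. f' A + g' A"]) (simp_all add: regular_functions.add)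
next
  case (mult f g)
  from mult.IH obtain f' g' where "f' \<in> regular_functions K n" "g' \<in> regular_functions K n"
    "\<forall>A\<in>carrier GLK. f' A = f (B * A * C)" "\<forall>A\<in>carrier GLK. g' A = g (B * A * C)" by blast
  then show ?case by (intro bexI[of _ "\<lambda>A. f' A * g' A"]) (simp_all add: regular_functions.mult)
qed

lemma closedin_zero_set:
  assumes "f \<in> regular_functions K n" shows "closedin zar {A \<in> carrier GLK. f A = 0}"
  unfolding closedin_zariski[OF subfield_K]
  using assms by (intro exI[of _ "{f}"]) (auto simp: zero_locus_def)

lemma GL_triple: "B \<in> carrier GLK \<Longrightarrow> A \<in> carrier GLK \<Longrightarrow> C \<in> carrier GLK \<Longrightarrow> B * A * C \<in> carrier GLK"
  using GL_m_closed by blast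

lemma continuous_translate:
  assumes B: "B \<in> carrier GLK" and C: "C \<in> carrier GLK"
  shows "continuous_map zar zar (\<lambda>A. B * A * C)"
  unfolding continuous_map_closedin
proof (intro conjI ballI allI impI)
  show "(\<lambda>A. B * A * C) \<in> topspace zar \<rightarrow> topspace zar" using GL_triple B C by auto
next
  fix Z assume "closedin zar Z"
  then obtain F where F: "F \<subseteq> regular_functions K n" "Z = zero_locus K n F"
    unfolding closedin_zariski[OF subfield_K] by blast
  have "\<forall>f\<in>F. \<exists>g\<in>regular_functions K n. \<forall>A\<in>carrier GLK. g A = f (B * A * C)"
    using regular_translate[OF B C] F(1) by blast
  then obtain g where g: "\<And>f. f \<in> F \<Longrightarrow> g f \<in> regular_functions K n"
    "\<And>f A. f \<in> F \<Longrightarrow> A \<in> carrier GLK \<Longrightarrow> g f A = f (B * A * C)" by metis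
  have "zero_locus K n (g ` F) = {A \<in> carrier GLK. \<forall>f\<in>F. f (B * A * C) = 0}"
    unfolding zero_locus_def by (auto simp: g(2))
  also have "\<dots> = {A \<in> topspace zar. B * A * C \<in> Z}"
    unfolding F(2) zero_locus_def topspace_zar using GL_triple[OF B _ C] by blast
  finally have eq: "{A \<in> topspace zar. B * A * C \<in> Z} = zero_locus K n (g ` F)" by (rule sym)
  have "g ` F \<subseteq> regular_functions K n" using g(1) by blast
  then show "closedin zar {A \<in> topspace zar. B * A * C \<in> Z}"
    unfolding closedin_zariski[OF subfield_K] eq by blast
qed

lemma connected_translate:
  assumes "connectedin zar X" "B \<in> carrier GLK" "C \<in> carrier GLK"
  shows "connectedin zar ((\<lambda>A. B * A * C) ` X)"
  using connectedin_continuous_map_image[OF continuous_translate] assms by blast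

text \<open>On \<open>X\<close> the zero sets of \<open>f\<close> and \<open>g\<close> are disjoint,
  closed and cover \<open>X\<close>; connectedness leaves just one of them, and \<open>A0\<close>
  decides for \<open>g\<close>.\<close>

lemma connected_zero_product:
  assumes X: "connectedin zar X" and f: "f \<in> regular_functions K n" and g: "g \<in> regular_functions K n"
    and "\<And>A. A \<in> X \<Longrightarrow> f A = 0 \<or> g A = 0" and "\<And>A. A \<in> X \<Longrightarrow> f A \<noteq> 0 \<or> g A \<noteq> 0"
    and "A0 \<in> X" "g A0 = 0" and "A \<in> X"
  shows "g A = 0"
proof (rule ccontr)
  assume "g A \<noteq> 0"
  have sub: "X \<subseteq> carrier GLK" using connectedin_subset_topspace[OF X] by simp
  let ?E1 = "{A \<in> carrier GLK. f A = 0}" and ?E2 = "{A \<in> carrier GLK. g A = 0}"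
  have "closedin zar ?E1" "closedin zar ?E2" using f g by (auto intro: closedin_zero_set)
  moreover have "X \<subseteq> ?E1 \<union> ?E2" "?E1 \<inter> ?E2 \<inter> X = {}" using assms(4,5) sub by blast+
  moreover have "?E1 \<inter> X \<noteq> {}" "?E2 \<inter> X \<noteq> {}"
    using assms(4,6,7,8) sub \<open>g A \<noteq> 0\<close> by blast+
  ultimately show False
    using X[unfolded connectedin_closedin, THEN conjunct2] by meson
qed

text \<open>On \<open>X\<close>, the product of \<open>f - v\<close> over all values
  \<open>v\<close> other than \<open>f A0\<close> vanishes exactly where \<open>f\<close> differs
  from \<open>f A0\<close>, so \<open>connected_zero_product\<close> applies. The values lie in
  \<open>K\<close>, which keeps \<open>f - v\<close> regular.\<close>

lemma connected_finite_values:
  assumes X: "connectedin zar X" and f: "f \<in> regular_functions K n" and fin: "finite (f ` X)"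
    and A0: "A0 \<in> X" and A: "A \<in> X"
  shows "f A = f A0"
proof -
  have sub: "X \<subseteq> carrier GLK" using connectedin_subset_topspace[OF X] by simp
  let ?V = "f ` X - {f A0}"
  have "f A - f A0 = 0"
  proof (rule connected_zero_product[OF X, where f = "\<lambda>A. \<Prod>v\<in>?V. f A - v" and g = "\<lambda>A. f A - f A0", OF _ _ _ _ A0 _ A])
    show "(\<lambda>A. \<Prod>v\<in>?V. f A - v) \<in> regular_functions K n"
      using fin f sub by (intro regular_prod regular_diff_const) (auto intro: regular_value_K)
    show "(\<lambda>A. f A - f A0) \<in> regular_functions K n"
      using f A0 sub by (intro regular_diff_const) (auto intro: regular_value_K)
    have prod: "(\<Prod>v\<in>?V. f B - v) = 0 \<longleftrightarrow> f B \<in> ?V" for B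
      using fin by (subst prod_zero_iff) auto
    show "(\<Prod>v\<in>?V. f B - v) = 0 \<or> f B - f A0 = 0" "(\<Prod>v\<in>?V. f B - v) \<noteq> 0 \<or> f B - f A0 \<noteq> 0"
      if "B \<in> X" for B
      using that unfolding prod by auto
  qed simp
  then show ?thesis by simp
qed

subsection \<open>Identity components\<close>

abbreviation "idc \<equiv> identity_component K n"

lemma GL_subgroup_one:
  assumes "subgroup G GLK" shows "1\<^sub>m n \<in> G"
  using subgroup.one_closed[OF assms] by simp

lemma GL_subgroup_mult:
  assumes "subgroup G GLK" "A \<in> G" "B \<in> G" shows "A * B \<in> G"
  using subgroup.m_closed[OF assms] by simp

lemma GL_subgroup_pow:
  assumes "subgroup G GLK" "A \<in> G" shows "A ^\<^sub>m k \<in> G"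
proof (induction k)
  case 0
  show ?case using subgroup.mem_carrier[OF assms] GL_subgroup_one[OF assms(1)] by (auto simp: GL_iff)
next
  case (Suc k)
  then show ?case using GL_subgroup_mult[OF assms(1) Suc assms(2)] by simp
qed

lemma idc_subset: "idc G \<subseteq> G"
  unfolding identity_component_def
  using connected_component_of_subset_topspace[of "subtopology zar G" "1\<^sub>m n"] by auto

lemma connected_idc: "connectedin zar (idc G)"
  unfolding identity_component_def
  using connectedin_connected_component_of[of "subtopology zar G"] by (simp add: connectedin_subtopology)

lemma idc_maximal:
  assumes "connectedin zar X" "1\<^sub>m n \<in> X" "X \<subseteq> G" shows "X \<subseteq> idc G"
  unfolding identity_component_def
  using assms by (intro connected_component_of_maximal) (auto simp: connectedin_subtopology)

lemma closedin_idc: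
  assumes "closedin zar G" shows "closedin zar (idc G)"
  unfolding identity_component_def
  using closedin_trans_full[OF closedin_connected_component_of assms] .

lemma one_in_idc:
  assumes "subgroup G GLK" shows "1\<^sub>m n \<in> idc G"
proof -
  have "{1\<^sub>m n} \<subseteq> idc G"
    by (rule idc_maximal) (use GL_subgroup_one[OF assms] GL_one_closed in \<open>simp_all only: connectedin_sing topspace_zar singletonI empty_subsetI insert_subset simp_thms\<close>)
  then show ?thesis by blast
qed

lemma subgroup_idc:
  assumes G: "subgroup G GLK" shows "subgroup (idc G) GLK"
proof -
  have sub: "idc G \<subseteq> carrier GLK" using idc_subset subgroup.subset[OF G] by blast
  have div: "iv A * B \<in> idc G" if A: "A \<in> idc G" and B: "B \<in> idc G" for A B
  proof -
    \<comment> \<open>The translate of the component by \<open>iv A\<close> is connected, contains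
      the identity as \<open>iv A * A\<close> and stays in \<open>G\<close>, so it lies in the
      component again. The trailing identity matrix only fits the two-sided translation
      lemma.\<close>
    let ?X = "(\<lambda>B. iv A * B * 1\<^sub>m n) ` idc G"
    have Ac: "A \<in> carrier GLK" using A sub by blast
    have X: "iv A * C * 1\<^sub>m n = iv A * C" if "C \<in> carrier GLK" for C
      using GL_m_closed[OF GL_inv_closed[OF Ac] that] GL_r_one by blast
    have "?X \<subseteq> idc G"
    proof (rule idc_maximal)
      show "connectedin zar ?X"
        using connected_idc GL_inv_closed[OF Ac] GL_one_closed by (rule connected_translate)
      show "1\<^sub>m n \<in> ?X" using A X[OF Ac] GL_l_inv[OF Ac] by (intro image_eqI[of _ _ A]) simp_all
      show "?X \<subseteq> G"
        proof
        fix Y assume "Y \<in> ?X"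
        then obtain C where C: "C \<in> idc G" "Y = iv A * C * 1\<^sub>m n" by blast
        have "A \<in> G" "C \<in> G" using A C(1) idc_subset by blast+
        moreover have "C \<in> carrier GLK" using C(1) sub by blast
        ultimately show "Y \<in> G"
          unfolding C(2) X[OF \<open>C \<in> carrier GLK\<close>]
          using GL_subgroup_mult[OF G subgroup.m_inv_closed[OF G]] by blast
      qed
    qed
    then have "iv A * B * 1\<^sub>m n \<in> idc G" using B by blast
    moreover have "B \<in> carrier GLK" using B sub by blast
    ultimately show ?thesis using X by simp
  qed
  have inv: "iv A \<in> idc G" if "A \<in> idc G" for A
    using div[OF that one_in_idc[OF G]] that sub GL_r_one GL_inv_closed by (metis subsetD)
  have mult: "A * B \<in> idc G" if "A \<in> idc G" "B \<in> idc G" for A B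
    using div[OF inv[OF that(1)] that(2)] that(1) sub GL_inv_inv by (metis subsetD)
  show ?thesis
  proof (rule GL_subgroupI)
    show "idc G \<subseteq> carrier GLK" "idc G \<noteq> {}" using sub one_in_idc[OF G] by blast+
  qed (fact inv mult)+
qed

section \<open>Conjugation in the general linear group\<close>

abbreviation "cj P A \<equiv> P * A * iv P"

lemma iv_closed: "P \<in> carrier GLK \<Longrightarrow> iv P \<in> carrier GLK"
  by (rule GL_inv_closed)

lemma iv_mult: "P \<in> carrier GLK \<Longrightarrow> iv P * P = 1\<^sub>m n" "P \<in> carrier GLK \<Longrightarrow> P * iv P = 1\<^sub>m n"
  by (rule GL_l_inv, assumption, rule GL_r_inv)

lemma iv_cancel:
  assumes "P \<in> carrier GLK" "A \<in> carrier GLK"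
  shows "iv P * (P * A) = A" "P * (iv P * A) = A"
proof -
  show "iv P * (P * A) = A"
    unfolding GL_m_assoc[OF iv_closed[OF assms(1)] assms, symmetric] iv_mult(1)[OF assms(1)]
    by (rule GL_l_one[OF assms(2)])
  show "P * (iv P * A) = A"
    unfolding GL_m_assoc[OF assms(1) iv_closed[OF assms(1)] assms(2), symmetric] iv_mult(2)[OF assms(1)]
    by (rule GL_l_one[OF assms(2)])
qed

lemma cj_closed: "P \<in> carrier GLK \<Longrightarrow> A \<in> carrier GLK \<Longrightarrow> cj P A \<in> carrier GLK"
  by (intro GL_triple iv_closed)

lemma cj_one: "P \<in> carrier GLK \<Longrightarrow> cj P (1\<^sub>m n) = 1\<^sub>m n"
  by (metis iv_mult(2) GL_r_one)

lemma cj_mult: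
  assumes "P \<in> carrier GLK" "A \<in> carrier GLK" "B \<in> carrier GLK"
  shows "cj P A * cj P B = cj P (A * B)"
  using assms iv_closed[OF assms(1)] by (simp add: GL_m_assoc iv_cancel GL_m_closed)

lemma cj_pow:
  assumes "P \<in> carrier GLK" "A \<in> carrier GLK" shows "cj P A ^\<^sub>m k = cj P (A ^\<^sub>m k)"
proof (induction k)
  case 0
  have "dim_row A = n" "dim_row (cj P A) = n"
    using GL_mat[OF assms(2)] GL_mat[OF cj_closed[OF assms]] by blast+
  then show ?case using cj_one[OF assms(1)] by simp
next
  case (Suc k)
  then show ?case using cj_mult[OF assms(1) GL_pow_closed[OF assms(2)] assms(2)] by simp
qed

lemma cj_cj:
  assumes "P \<in> carrier GLK" "Q \<in> carrier GLK" "A \<in> carrier GLK"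
  shows "cj P (cj Q A) = cj (P * Q) A"
  using assms iv_closed[OF assms(1)] iv_closed[OF assms(2)]
  by (simp add: GL_m_assoc GL_inv_mult_group GL_m_closed)

lemma cj_inv:
  assumes "P \<in> carrier GLK" "A \<in> carrier GLK"
  shows "iv P * cj P A * P = A"
  using assms iv_closed[OF assms(1)]
  by (simp add: GL_m_assoc iv_cancel GL_m_closed iv_mult GL_r_one)

lemma cj_inv':
  assumes "P \<in> carrier GLK" "A \<in> carrier GLK"
  shows "cj P (iv P * A * P) = A"
  using assms iv_closed[OF assms(1)]
  by (simp add: GL_m_assoc iv_cancel GL_m_closed iv_mult GL_r_one)

lemma subgroup_cj:
  assumes P: "P \<in> carrier GLK" and G: "subgroup G GLK"
  shows "subgroup (cj P ` G) GLK"
proof -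
  have sub: "\<And>A. A \<in> G \<Longrightarrow> A \<in> carrier GLK" using subgroup.mem_carrier[OF G] .
  show ?thesis
  proof (rule GL_subgroupI)
    show "cj P ` G \<subseteq> carrier GLK" using cj_closed[OF P] sub by blast
    show "cj P ` G \<noteq> {}" using GL_subgroup_one[OF G] by blast
  next
    fix B assume "B \<in> cj P ` G"
    then obtain A where A: "A \<in> G" "B = cj P A" by blast
    have "cj P A * cj P (iv A) = 1\<^sub>m n"
      using cj_mult[OF P sub[OF A(1)] iv_closed[OF sub[OF A(1)]]] iv_mult(2)[OF sub[OF A(1)]] cj_one[OF P] by simp
    then have "iv B = cj P (iv A)" unfolding A(2)
      using GL_inv_equality[of "cj P (iv A)" "cj P A"] cj_closed[OF P] sub A(1) iv_closed
      by (metis GL_inv_comm)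
    then show "iv B \<in> cj P ` G" using subgroup.m_inv_closed[OF G A(1)] by simp
  next
    fix B C assume "B \<in> cj P ` G" "C \<in> cj P ` G"
    then obtain A D where "A \<in> G" "B = cj P A" "D \<in> G" "C = cj P D" by blast
    then show "B * C \<in> cj P ` G" using cj_mult[OF P] sub GL_subgroup_mult[OF G] by auto
  qed
qed

lemma cj_idc:
  assumes P: "P \<in> carrier GLK" and G: "subgroup G GLK"
  shows "cj P ` idc G \<subseteq> idc (cj P ` G)"
proof (rule idc_maximal)
  show "connectedin zar (cj P ` idc G)"
    using connected_idc P iv_closed[OF P] by (rule connected_translate)
  show "1\<^sub>m n \<in> cj P ` idc G" using cj_one[OF P] one_in_idc[OF G] by (intro image_eqI[of _ _ "1\<^sub>m n"]) simp_all
  show "cj P ` idc G \<subseteq> cj P ` G" using idc_subset by (rule image_mono)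
qed

lemma cj_idc_self:
  assumes G: "subgroup G GLK" and P: "P \<in> G" and A: "A \<in> idc G"
  shows "cj P A \<in> idc G"
proof -
  have Pc: "P \<in> carrier GLK" using subgroup.mem_carrier[OF G P] .
  have "cj P ` G \<subseteq> G"
    using GL_subgroup_mult[OF G] subgroup.m_inv_closed[OF G P] P by blast
  then have "cj P ` idc G \<subseteq> G" using idc_subset by blast
  moreover have "connectedin zar (cj P ` idc G)"
    using connected_idc Pc iv_closed[OF Pc] by (rule connected_translate)
  moreover have "1\<^sub>m n \<in> cj P ` idc G" using cj_one[OF Pc] one_in_idc[OF G] by (intro image_eqI[of _ _ "1\<^sub>m n"]) simp_all
  ultimately have "cj P ` idc G \<subseteq> idc G" by (intro idc_maximal)
  then show ?thesis using A by blast
qed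

lemma algebraic_group_cj:
  assumes P: "P \<in> carrier GLK" and G: "algebraic_group K n G"
  shows "algebraic_group K n (cj P ` G)"
  unfolding algebraic_group_def
proof
  have sg: "subgroup G GLK" and cl: "closedin zar G" using G by (auto simp: algebraic_group_def)
  show "subgroup (cj P ` G) GLK" using P sg by (rule subgroup_cj)
  \<comment> \<open>Rewriting the image as a preimage under the inverse conjugation makes closedness
    a matter of continuity.\<close>
  have "cj P ` G = {A \<in> topspace zar. iv P * A * P \<in> G}"
  proof (intro equalityI subsetI)
    fix B assume "B \<in> cj P ` G"
    then show "B \<in> {A \<in> topspace zar. iv P * A * P \<in> G}"
      using cj_inv[OF P] cj_closed[OF P] subgroup.mem_carrier[OF sg] by force
  next
    fix B assume "B \<in> {A \<in> topspace zar. iv P * A * P \<in> G}"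
    then show "B \<in> cj P ` G" using cj_inv'[OF P, of B] by (intro image_eqI[of _ _ "iv P * B * P"]) simp_all
  qed
  then show "closedin zar (cj P ` G)"
    using closedin_continuous_map_preimage[OF continuous_translate[OF iv_closed[OF P] P] cl] by simp
qed

subsection \<open>Cyclic component groups\<close>

text \<open>An elementwise form of \<open>G\<close> modulo \<open>idc G\<close> being finite cyclic
  with the class of \<open>g\<close> as generator; it passes to conjugates without any quotient
  group. \<open>N\<close> is some exponent that sends \<open>g\<close> into the component, not
  necessarily the order of its class, and its positivity is why natural exponents \<open>j\<close>
  suffice.\<close>

definition cyclic_over :: "complex mat set \<Rightarrow> complex mat \<Rightarrow> nat \<Rightarrow> bool" where
  "cyclic_over G g N \<longleftrightarrow> g \<in> G \<and> N > 0 \<and> g ^\<^sub>m N \<in> idc G \<and> (\<forall>A\<in>G. \<exists>j. \<exists>B\<in>idc G. A = B * g ^\<^sub>m j)"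

lemma cyclic_over_cj:
  assumes P: "P \<in> carrier GLK" and G: "subgroup G GLK" and c: "cyclic_over G g N"
  shows "cyclic_over (cj P ` G) (cj P g) N"
  unfolding cyclic_over_def
proof (intro conjI ballI)
  have sub: "\<And>A. A \<in> G \<Longrightarrow> A \<in> carrier GLK" using subgroup.mem_carrier[OF G] .
  have g: "g \<in> G" "N > 0" "g ^\<^sub>m N \<in> idc G" and ex: "\<And>A. A \<in> G \<Longrightarrow> \<exists>j. \<exists>B\<in>idc G. A = B * g ^\<^sub>m j"
    using c by (auto simp: cyclic_over_def)
  note pow = cj_pow[OF P sub[OF g(1)]]
  show "cj P g \<in> cj P ` G" "N > 0" using g by auto
  show "cj P g ^\<^sub>m N \<in> idc (cj P ` G)" unfolding pow using cj_idc[OF P G] g(3) by blast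
  fix A assume "A \<in> cj P ` G"
  then obtain B where B: "B \<in> G" "A = cj P B" by blast
  obtain j D where D: "D \<in> idc G" "B = D * g ^\<^sub>m j" using ex[OF B(1)] by blast
  have "D \<in> carrier GLK" using D(1) idc_subset sub by blast
  then have "A = cj P D * cj P g ^\<^sub>m j"
    unfolding pow B(2) D(2) using cj_mult[OF P _ GL_pow_closed[OF sub[OF g(1)]]] by simp
  then show "\<exists>j. \<exists>D\<in>idc (cj P ` G). A = D * cj P g ^\<^sub>m j"
    using cj_idc[OF P G] D(1) by blast
qed

lemma normal_idc:
  assumes G: "subgroup G GLK"
  shows "idc G \<lhd> GLK\<lparr>carrier := G\<rparr>"
proof -
  have grp: "group (GLK\<lparr>carrier := G\<rparr>)"
    using subgroup.subgroup_is_group[OF G group_GL] .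
  have inv: "inv\<^bsub>GLK\<lparr>carrier := G\<rparr>\<^esub> A = iv A" if "A \<in> G" for A
    using group.m_inv_consistent[OF group_GL G that] .
  have "subgroup (idc G) (GLK\<lparr>carrier := G\<rparr>)"
    using group.subgroup_incl[OF group_GL subgroup_idc[OF G] G idc_subset] .
  then show "idc G \<lhd> GLK\<lparr>carrier := G\<rparr>"
    unfolding group.normal_inv_iff[OF grp] using cj_idc_self[OF G] inv by simp
qed

lemma carrier_pow:
  assumes "subgroup G GLK" "A \<in> G"
  shows "A [^]\<^bsub>GLK\<lparr>carrier := G\<rparr>\<^esub> (k::nat) = A ^\<^sub>m k"
  using GL_pow[OF subgroup.mem_carrier[OF assms], of k]
    monoid.nat_pow_consistent[OF group.is_monoid[OF group_GL], of A k G] by simp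

lemma coset_self:
  assumes "subgroup G GLK" "A \<in> G" shows "A \<in> idc G #>\<^bsub>GLK\<lparr>carrier := G\<rparr>\<^esub> A"
proof -
  have "A = 1\<^sub>m n * A" using subgroup.mem_carrier[OF assms] GL_l_one by metis
  then show ?thesis using one_in_idc[OF assms(1)] by (force simp: r_coset_def)
qed

lemma cyclic_component_group_imp:
  assumes G: "subgroup G GLK" and fin: "finite (carrier (component_group K n G))"
    and cyc: "cyclic_group (component_group K n G)"
  obtains g N where "cyclic_over G g N"
proof -
  let ?GG = "GLK\<lparr>carrier := G\<rparr>"
  let ?Q = "?GG Mod idc G"
  interpret N: normal "idc G" ?GG using normal_idc[OF G] .
  have Q: "component_group K n G = ?Q" by (simp add: component_group_def)
  have grp: "group ?Q" by (rule N.factorgroup_is_group)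
  have "\<exists>x \<in> carrier ?Q. carrier ?Q = range (\<lambda>n::int. x [^]\<^bsub>?Q\<^esub> n)"
    using cyc[unfolded Q] group.cyclic_group[OF grp] by blast
  then obtain x where x: "x \<in> carrier ?Q" "carrier ?Q = range (\<lambda>n::int. x [^]\<^bsub>?Q\<^esub> n)" by blast
  obtain g where g: "g \<in> G" "x = idc G #>\<^bsub>?GG\<^esub> g" using x(1) unfolding carrier_FactGroup by auto
  have xpow: "x [^]\<^bsub>?Q\<^esub> k = idc G #>\<^bsub>?GG\<^esub> (g ^\<^sub>m k)" for k :: nat
    using N.FactGroup_pow[of g k] g carrier_pow[OF G g(1)] by simp
  define M where "M = Coset.order ?Q"
  have M: "M > 0" unfolding M_def Coset.order_def using x(1) fin[unfolded Q] by (auto simp only: card_gt_0_iff)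
  have xM: "x [^]\<^bsub>?Q\<^esub> M = \<one>\<^bsub>?Q\<^esub>" unfolding M_def using group.pow_order_eq_1[OF grp x(1)] .
  have gM: "g ^\<^sub>m M \<in> idc G"
  proof -
    have "idc G #>\<^bsub>?GG\<^esub> (g ^\<^sub>m M) = idc G" using xM unfolding xpow by simp
    then show ?thesis using coset_self[OF G GL_subgroup_pow[OF G g(1)], of M] by simp
  qed
  have "\<exists>j. \<exists>B\<in>idc G. A = B * g ^\<^sub>m j" if A: "A \<in> G" for A
  proof -
    have "idc G #>\<^bsub>?GG\<^esub> A \<in> carrier ?Q" using A by (simp add: carrier_FactGroup)
    then obtain k :: int where k: "idc G #>\<^bsub>?GG\<^esub> A = x [^]\<^bsub>?Q\<^esub> k" using x(2) by auto
    \<comment> \<open>Reducing the integer exponent modulo the group order turns it into the natural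
      exponent that \<open>cyclic_over\<close> asks for.\<close>
    define j where "j = nat (k mod int M)"
    have "x [^]\<^bsub>?Q\<^esub> k = x [^]\<^bsub>?Q\<^esub> (int j + int M * (k div int M))"
      using M by (simp add: j_def)
    also have "\<dots> = x [^]\<^bsub>?Q\<^esub> int j \<otimes>\<^bsub>?Q\<^esub> (x [^]\<^bsub>?Q\<^esub> int M) [^]\<^bsub>?Q\<^esub> (k div int M)"
      using group.int_pow_mult[OF grp x(1)] group.int_pow_pow[OF grp x(1)] by simp
    also have "\<dots> = x [^]\<^bsub>?Q\<^esub> j"
      using xM group.int_pow_one[OF grp] group.is_monoid[OF grp] x(1)
      by (simp only: int_pow_int monoid.r_one monoid.nat_pow_closed)
    finally have "idc G #>\<^bsub>?GG\<^esub> A = idc G #>\<^bsub>?GG\<^esub> (g ^\<^sub>m j)" using k xpow by simp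
    then have "A \<in> idc G #>\<^bsub>?GG\<^esub> (g ^\<^sub>m j)" using coset_self[OF G A] by simp
    then show ?thesis by (auto simp: r_coset_def)
  qed
  then have "cyclic_over G g M" using g(1) M gM by (simp add: cyclic_over_def)
  then show thesis by (rule that)
qed

lemma r_coset_carrier: "H #>\<^bsub>GLK\<lparr>carrier := G\<rparr>\<^esub> A = H #>\<^bsub>GLK\<^esub> A"
  by (simp add: r_coset_def)

text \<open>Converse of \<open>cyclic_component_group_imp\<close>: \<open>M\<close> is any exponent
  supplied by \<open>cyclic_over\<close>, whereas \<open>N\<close> is the exact order of
  \<open>g\<close> modulo the identity component and thus the order of the quotient.\<close>

lemma component_group_cyclic:
  assumes G: "subgroup G GLK" and c: "cyclic_over G g M"
    and N: "N > 0" "\<And>j. g ^\<^sub>m j \<in> idc G \<longleftrightarrow> N dvd j"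
  shows "component_group K n G \<cong> integer_mod_group N"
    and "generate (component_group K n G) {idc G #>\<^bsub>GLK\<^esub> g} = carrier (component_group K n G)"
proof -
  let ?GG = "GLK\<lparr>carrier := G\<rparr>"
  let ?Q = "?GG Mod idc G"
  interpret N: normal "idc G" ?GG using normal_idc[OF G] .
  have Q: "component_group K n G = ?Q" by (simp add: component_group_def)
  have grp: "group ?Q" by (rule N.factorgroup_is_group)
  have g: "g \<in> G" "\<And>A. A \<in> G \<Longrightarrow> \<exists>j. \<exists>B\<in>idc G. A = B * g ^\<^sub>m j" using c by (auto simp: cyclic_over_def)
  define x where "x = idc G #>\<^bsub>?GG\<^esub> g"
  have x: "x \<in> carrier ?Q" using g(1) by (simp add: carrier_FactGroup x_def)
  have xpow: "x [^]\<^bsub>?Q\<^esub> k = idc G #>\<^bsub>?GG\<^esub> (g ^\<^sub>m k)" for k :: nat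
    using N.FactGroup_pow[of g k] g carrier_pow[OF G g(1)] by (simp add: x_def)
  have one: "x [^]\<^bsub>?Q\<^esub> k = \<one>\<^bsub>?Q\<^esub> \<longleftrightarrow> N dvd k" for k :: nat
  proof -
    have "idc G #>\<^bsub>?GG\<^esub> (g ^\<^sub>m k) = idc G \<longleftrightarrow> g ^\<^sub>m k \<in> idc G"
      using group.coset_join1[OF N.is_group, of "idc G" "g ^\<^sub>m k"] group.coset_join2[OF N.is_group, of "g ^\<^sub>m k" "idc G"]
        GL_subgroup_pow[OF G g(1)] idc_subset N.is_subgroup by auto
    then show ?thesis unfolding xpow using N(2) by simp
  qed
  have ord: "group.ord ?Q x = N"
    using group.ord_unique[OF grp x] one by blast
  have powers: "carrier ?Q = range (\<lambda>k::nat. x [^]\<^bsub>?Q\<^esub> k)"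
  proof (intro equalityI subsetI)
    fix y assume "y \<in> carrier ?Q"
    then obtain A where A: "A \<in> G" "y = idc G #>\<^bsub>?GG\<^esub> A" by (auto simp: carrier_FactGroup)
    obtain j B where B: "B \<in> idc G" "A = B * g ^\<^sub>m j" using g(2)[OF A(1)] by blast
    have "idc G #>\<^bsub>?GG\<^esub> (B \<otimes>\<^bsub>?GG\<^esub> g ^\<^sub>m j) = (idc G #>\<^bsub>?GG\<^esub> B) #>\<^bsub>?GG\<^esub> (g ^\<^sub>m j)"
      using group.coset_mult_assoc[OF N.is_group, of "idc G" B "g ^\<^sub>m j"] idc_subset B(1) GL_subgroup_pow[OF G g(1)]
      by auto
    also have "idc G #>\<^bsub>?GG\<^esub> B = idc G"
      using group.coset_join2[OF N.is_group, of B "idc G"] B(1) idc_subset N.is_subgroup by auto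
    finally show "y \<in> range (\<lambda>k::nat. x [^]\<^bsub>?Q\<^esub> k)" using A B xpow by simp
  next
    fix y assume "y \<in> range (\<lambda>k::nat. x [^]\<^bsub>?Q\<^esub> k)"
    then show "y \<in> carrier ?Q" using monoid.nat_pow_closed[OF group.is_monoid[OF grp] x] by auto
  qed
  have mod: "x [^]\<^bsub>?Q\<^esub> (k mod N) = x [^]\<^bsub>?Q\<^esub> k" for k :: nat
  proof -
    have "x [^]\<^bsub>?Q\<^esub> k = x [^]\<^bsub>?Q\<^esub> (N * (k div N)) \<otimes>\<^bsub>?Q\<^esub> x [^]\<^bsub>?Q\<^esub> (k mod N)"
      using monoid.nat_pow_mult[OF group.is_monoid[OF grp] x, of "N * (k div N)" "k mod N"] by simp
    moreover have "x [^]\<^bsub>?Q\<^esub> (N * (k div N)) = \<one>\<^bsub>?Q\<^esub>" using one by simp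
    ultimately show ?thesis
      using monoid.l_one[OF group.is_monoid[OF grp]] monoid.nat_pow_closed[OF group.is_monoid[OF grp] x] by metis
  qed
  show "generate (component_group K n G) {idc G #>\<^bsub>GLK\<^esub> g} = carrier (component_group K n G)"
  proof
    show "generate (component_group K n G) {idc G #>\<^bsub>GLK\<^esub> g} \<subseteq> carrier (component_group K n G)"
      unfolding Q using group.generate_incl[OF grp, of "{x}"] x by (simp add: x_def r_coset_carrier)
    have "x [^]\<^bsub>?Q\<^esub> k \<in> generate ?Q {x}" for k :: nat
    proof (induction k)
      case 0
      show ?case using generate.one[of ?Q] monoid.nat_pow_0[OF group.is_monoid[OF grp]] by metis
    next
      case (Suc k)
      then show ?case using generate.eng[OF Suc generate.incl[of x "{x}" ?Q]]
        monoid.nat_pow_Suc[OF group.is_monoid[OF grp]] by (metis singletonI)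
    qed
    then show "carrier (component_group K n G) \<subseteq> generate (component_group K n G) {idc G #>\<^bsub>GLK\<^esub> g}"
      unfolding Q powers using x_def r_coset_carrier by auto
  qed
  \<comment> \<open>The carrier of \<open>integer_mod_group N\<close> consists of the integers from
    0 to \<open>N - 1\<close>, so \<open>nat\<close> loses nothing. The isomorphism is built out of
    this group and inverted at the end.\<close>
  define f where "f = (\<lambda>k::int. x [^]\<^bsub>?Q\<^esub> nat k)"
  have "f \<in> iso (integer_mod_group N) ?Q"
  proof (rule isoI)
    show "f \<in> hom (integer_mod_group N) ?Q"
    proof (rule homI)
      fix k assume "k \<in> carrier (integer_mod_group N)"
      then show "f k \<in> carrier ?Q" using powers by (auto simp: f_def)
    next
      fix k l assume "k \<in> carrier (integer_mod_group N)" "l \<in> carrier (integer_mod_group N)"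
      then have "0 \<le> k" "0 \<le> l" using N(1) by (auto simp: carrier_integer_mod_group)
      then obtain a b where ab: "k = int a" "l = int b" by (metis nonneg_int_cases)
      have "f (k \<otimes>\<^bsub>integer_mod_group N\<^esub> l) = x [^]\<^bsub>?Q\<^esub> ((a + b) mod N)"
        unfolding f_def ab mult_integer_mod_group
        by (metis nat_int of_nat_add zmod_int)
      also have "\<dots> = f k \<otimes>\<^bsub>?Q\<^esub> f l"
        unfolding mod f_def ab using monoid.nat_pow_mult[OF group.is_monoid[OF grp] x] by simp
      finally show "f (k \<otimes>\<^bsub>integer_mod_group N\<^esub> l) = f k \<otimes>\<^bsub>?Q\<^esub> f l" .
    qed
    show "bij_betw f (carrier (integer_mod_group N)) (carrier ?Q)"
      unfolding bij_betw_def
    proof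
      have c: "carrier (integer_mod_group N) = int ` {..<N}"
        using N(1) by (simp add: carrier_integer_mod_group image_int_atLeastLessThan atLeast0LessThan[symmetric])
      have fc: "f (int k) = x [^]\<^bsub>?Q\<^esub> k" for k by (simp add: f_def)
      have inj: "k = l" if "k < N" "l < N" "k \<le> l" "x [^]\<^bsub>?Q\<^esub> k = x [^]\<^bsub>?Q\<^esub> l" for k l :: nat
      proof -
        have "x [^]\<^bsub>?Q\<^esub> (l - k) \<otimes>\<^bsub>?Q\<^esub> x [^]\<^bsub>?Q\<^esub> k = \<one>\<^bsub>?Q\<^esub> \<otimes>\<^bsub>?Q\<^esub> x [^]\<^bsub>?Q\<^esub> k"
          using monoid.nat_pow_mult[OF group.is_monoid[OF grp] x, of "l - k" k] that
            monoid.l_one[OF group.is_monoid[OF grp]] monoid.nat_pow_closed[OF group.is_monoid[OF grp] x] by simp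
        then have "x [^]\<^bsub>?Q\<^esub> (l - k) = \<one>\<^bsub>?Q\<^esub>"
          using Group.group.right_cancel[OF grp] monoid.nat_pow_closed[OF group.is_monoid[OF grp] x]
            monoid.one_closed[OF group.is_monoid[OF grp]] by meson
        then have "N dvd l - k" using one by blast
        then show ?thesis using that by (meson dvd_imp_le le_antisym diff_is_0_eq less_imp_diff_less linorder_not_le not_gr_zero)
      qed
      have inj': "k = l" if "k < N" "l < N" "x [^]\<^bsub>?Q\<^esub> k = x [^]\<^bsub>?Q\<^esub> l" for k l :: nat
        using inj[of k l] inj[of l k] that by (cases "k \<le> l") auto
      show "inj_on f (carrier (integer_mod_group N))"
        unfolding c by (rule inj_onI) (use inj' fc in auto)
      have "range (\<lambda>k::nat. x [^]\<^bsub>?Q\<^esub> k) = (\<lambda>k. x [^]\<^bsub>?Q\<^esub> k) ` {..<N}"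
      proof (intro equalityI subsetI)
        fix y assume "y \<in> range (\<lambda>k::nat. x [^]\<^bsub>?Q\<^esub> k)"
        then obtain k :: nat where "y = x [^]\<^bsub>?Q\<^esub> k" by blast
        then show "y \<in> (\<lambda>k. x [^]\<^bsub>?Q\<^esub> k) ` {..<N}"
          using mod[of k] N(1) by (intro image_eqI[of _ _ "k mod N"]) simp_all
      qed blast
      then show "f ` carrier (integer_mod_group N) = carrier ?Q"
        unfolding c powers by (simp add: image_image fc)
    qed
  qed
  then show "component_group K n G \<cong> integer_mod_group N"
    unfolding Q using group.iso_sym[OF group_integer_mod_group] is_isoI by blast
qed

end

lemma prod_powi: "(\<Prod>i\<in>I. f i powi k) = (\<Prod>i\<in>I. f i :: complex) powi k"
  by (induction I rule: infinite_finite_induct) (auto simp: power_int_mult_distrib)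

subsection \<open>Laurent monomials\<close>

definition laurent_monomial :: "nat \<Rightarrow> (nat \<Rightarrow> int) \<Rightarrow> (nat \<Rightarrow> complex) \<Rightarrow> complex" where
  "laurent_monomial n m \<alpha> = (\<Prod>i<n. \<alpha> i powi m i)"

lemma laurent_monomial_add:
  assumes "\<forall>i<n. \<alpha> i \<noteq> 0"
  shows "laurent_monomial n (\<lambda>i. m i + l i) \<alpha> = laurent_monomial n m \<alpha> * laurent_monomial n l \<alpha>"
  unfolding laurent_monomial_def prod.distrib[symmetric]
  using assms by (intro prod.cong) (auto simp: power_int_add)

lemma laurent_monomial_diff:
  assumes "\<forall>i<n. \<alpha> i \<noteq> 0"
  shows "laurent_monomial n (\<lambda>i. m i - l i) \<alpha> = laurent_monomial n m \<alpha> / laurent_monomial n l \<alpha>"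
  unfolding laurent_monomial_def prod_dividef[symmetric]
  using assms by (intro prod.cong) (auto simp: power_int_diff)

lemma laurent_monomial_nonzero: "\<forall>i<n. \<alpha> i \<noteq> 0 \<Longrightarrow> laurent_monomial n m \<alpha> \<noteq> 0"
  by (auto simp: laurent_monomial_def)

lemma laurent_monomial_mult:
  "laurent_monomial n m (\<lambda>i. \<alpha> i * \<beta> i) = laurent_monomial n m \<alpha> * laurent_monomial n m \<beta>"
  by (simp add: laurent_monomial_def power_int_mult_distrib prod.distrib)

text \<open>A list of terms in which exponents may repeat, so that sums and products are list
  operations and the induction in \<open>laurent_eval_vanish\<close> can run on the length.\<close>

definition laurent_eval :: "nat \<Rightarrow> (complex \<times> (nat \<Rightarrow> int)) list \<Rightarrow> (nat \<Rightarrow> complex) \<Rightarrow> complex" where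
  "laurent_eval n xs \<alpha> = (\<Sum>(c, m)\<leftarrow>xs. c * laurent_monomial n m \<alpha>)"

lemma laurent_eval_Nil [simp]: "laurent_eval n [] \<alpha> = 0"
  and laurent_eval_Cons: "laurent_eval n ((c, m) # xs) \<alpha> = c * laurent_monomial n m \<alpha> + laurent_eval n xs \<alpha>"
  and laurent_eval_append: "laurent_eval n (xs @ ys) \<alpha> = laurent_eval n xs \<alpha> + laurent_eval n ys \<alpha>"
  by (simp_all add: laurent_eval_def)

lemma laurent_eval_monomial_mult:
  assumes "\<forall>i<n. \<alpha> i \<noteq> 0"
  shows "laurent_eval n (map (\<lambda>(d, l). (c * d, \<lambda>i. m i + l i)) ys) \<alpha> =
    c * laurent_monomial n m \<alpha> * laurent_eval n ys \<alpha>"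
  by (induction ys) (auto simp: laurent_eval_Cons laurent_monomial_add[OF assms] algebra_simps)

lemma laurent_eval_mult:
  "\<exists>zs. \<forall>\<alpha>. (\<forall>i<n. \<alpha> i \<noteq> 0) \<longrightarrow> laurent_eval n zs \<alpha> = laurent_eval n xs \<alpha> * laurent_eval n ys \<alpha>"
proof (induction xs)
  case Nil
  show ?case by (rule exI[of _ "[]"]) simp
next
  case (Cons x xs)
  then obtain zs where zs: "\<forall>\<alpha>. (\<forall>i<n. \<alpha> i \<noteq> 0) \<longrightarrow>
    laurent_eval n zs \<alpha> = laurent_eval n xs \<alpha> * laurent_eval n ys \<alpha>" by blast
  obtain c m where x: "x = (c, m)" by fastforce
  show ?case
  proof (intro exI allI impI)
    fix \<alpha> :: "nat \<Rightarrow> complex" assume nz: "\<forall>i<n. \<alpha> i \<noteq> 0"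
    show "laurent_eval n (map (\<lambda>(d, l). (c * d, \<lambda>i. m i + l i)) ys @ zs) \<alpha> =
        laurent_eval n (x # xs) \<alpha> * laurent_eval n ys \<alpha>"
      unfolding laurent_eval_append laurent_eval_monomial_mult[OF nz] x laurent_eval_Cons
      using zs nz by (simp add: algebra_simps)
  qed
qed

lemma det_mat_diag: "det (mat_diag n \<alpha>) = (\<Prod>i<n. \<alpha> i)" for \<alpha> :: "nat \<Rightarrow> complex"
proof -
  have "det (mat_diag n \<alpha>) = prod_list (diag_mat (mat_diag n \<alpha>))"
    by (rule det_upper_triangular[of _ n]) (auto simp: mat_diag_def)
  also have "\<dots> = (\<Prod>i<n. \<alpha> i)"
    by (simp add: diag_mat_def mat_diag_def prod.list_conv_set_nth atLeast0LessThan)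
  finally show ?thesis .
qed

lemma mat_diag_entry: "i < n \<Longrightarrow> j < n \<Longrightarrow> mat_diag n \<alpha> $$ (i, j) = (if i = j then \<alpha> j else 0)"
  by (simp add: mat_diag_def)

text \<open>Off-diagonal entries vanish on diagonal matrices, and the inverse determinant becomes
  the monomial whose exponents are all -1; this is where negative exponents enter.\<close>

lemma regular_on_diagonal:
  assumes "f \<in> regular_functions K n"
  shows "\<exists>xs. \<forall>\<alpha>. (\<forall>i<n. \<alpha> i \<noteq> 0) \<longrightarrow> f (mat_diag n \<alpha>) = laurent_eval n xs \<alpha>"
  using assms
proof induction
  case (const c)
  show ?case
    by (intro exI[of _ "[(c, \<lambda>_. 0)]"]) (simp add: laurent_eval_Cons laurent_monomial_def)
next
  case (entry i j)
  show ?case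
  proof (cases "i = j")
    case True
    have "laurent_monomial n (\<lambda>k. if k = j then 1 else 0) \<alpha> = \<alpha> j" for \<alpha>
    proof -
      have "(\<Prod>k<n. \<alpha> k powi (if k = j then 1 else 0)) = (\<Prod>k<n. if k = j then \<alpha> k else 1)"
        by (intro prod.cong) auto
      then show ?thesis using entry by (simp add: laurent_monomial_def)
    qed
    then show ?thesis
      using entry True by (intro exI[of _ "[(1, \<lambda>k. if k = j then 1 else 0)]"])
        (simp add: laurent_eval_Cons mat_diag_entry)
  next
    case False
    then show ?thesis using entry by (intro exI[of _ "[]"]) (simp add: mat_diag_entry)
  qed
next
  case inverse_det
  show ?case
    by (intro exI[of _ "[(1, \<lambda>_. -1)]"])
      (simp add: laurent_eval_Cons laurent_monomial_def det_mat_diag power_int_minus prod_inversef[of _ "{..<n}", unfolded o_def])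
next
  case (add f g)
  then obtain xs ys where
    "\<forall>\<alpha>. (\<forall>i<n. \<alpha> i \<noteq> 0) \<longrightarrow> f (mat_diag n \<alpha>) = laurent_eval n xs \<alpha>"
    "\<forall>\<alpha>. (\<forall>i<n. \<alpha> i \<noteq> 0) \<longrightarrow> g (mat_diag n \<alpha>) = laurent_eval n ys \<alpha>" by blast
  then show ?case by (intro exI[of _ "xs @ ys"]) (simp add: laurent_eval_append)
next
  case (mult f g)
  then obtain xs ys where *:
    "\<forall>\<alpha>. (\<forall>i<n. \<alpha> i \<noteq> 0) \<longrightarrow> f (mat_diag n \<alpha>) = laurent_eval n xs \<alpha>"
    "\<forall>\<alpha>. (\<forall>i<n. \<alpha> i \<noteq> 0) \<longrightarrow> g (mat_diag n \<alpha>) = laurent_eval n ys \<alpha>" by blast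
  obtain zs where "\<forall>\<alpha>. (\<forall>i<n. \<alpha> i \<noteq> 0) \<longrightarrow>
    laurent_eval n zs \<alpha> = laurent_eval n xs \<alpha> * laurent_eval n ys \<alpha>" using laurent_eval_mult by blast
  with * show ?case by (intro exI[of _ zs]) simp
qed

text \<open>Dedekind's independence of characters: a Laurent polynomial vanishing on \<open>D\<close> vanishes wherever
  all monomials that are trivial on \<open>D\<close> are trivial.\<close>

lemma laurent_eval_vanish:
  assumes nz: "\<And>\<alpha>. \<alpha> \<in> D \<Longrightarrow> \<forall>i<n. \<alpha> i \<noteq> 0"
    and ne: "D \<noteq> {}" and mult: "\<And>\<alpha> \<beta>. \<alpha> \<in> D \<Longrightarrow> \<beta> \<in> D \<Longrightarrow> (\<lambda>i. \<alpha> i * \<beta> i) \<in> D"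
    and t: "\<forall>i<n. t i \<noteq> 0"
    and triv: "\<And>m. \<forall>\<alpha>\<in>D. laurent_monomial n m \<alpha> = 1 \<Longrightarrow> laurent_monomial n m t = 1"
  shows "\<forall>\<alpha>\<in>D. laurent_eval n xs \<alpha> = 0 \<Longrightarrow> laurent_eval n xs t = 0"
proof (induction xs rule: length_induct)
  case (1 xs)
  show ?case
  proof (cases xs)
    case (Cons x xs')
    obtain c1 m1 where x: "x = (c1, m1)" by fastforce
    show ?thesis
    proof (cases "\<forall>(c, m)\<in>set xs. \<forall>\<alpha>\<in>D. laurent_monomial n m \<alpha> = laurent_monomial n m1 \<alpha>")
      case True
      \<comment> \<open>All terms restrict to one character on \<open>D\<close>, so the polynomial
        is \<open>C\<close> times that character on \<open>D\<close> and at \<open>t\<close> alike;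
        since the character does not vanish, \<open>C = 0\<close>.\<close>
      define C where "C = sum_list (map fst xs)"
      have eval: "laurent_eval n ys \<alpha> = sum_list (map fst ys) * laurent_monomial n m1 \<alpha>"
        if "\<forall>(c, m)\<in>set ys. laurent_monomial n m \<alpha> = laurent_monomial n m1 \<alpha>" for ys \<alpha>
        using that by (induction ys) (auto simp: laurent_eval_Cons algebra_simps)
      obtain \<alpha> where \<alpha>: "\<alpha> \<in> D" using ne by blast
      have "laurent_eval n xs \<alpha> = C * laurent_monomial n m1 \<alpha>"
        unfolding C_def by (rule eval) (use True \<alpha> in auto)
      then have "C = 0" using 1(2) \<alpha> laurent_monomial_nonzero[OF nz[OF \<alpha>]] by auto
      moreover have "laurent_monomial n m t = laurent_monomial n m1 t" if "(c, m) \<in> set xs" for c m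
      proof -
        have "\<forall>\<alpha>\<in>D. laurent_monomial n (\<lambda>i. m i - m1 i) \<alpha> = 1"
          using True that by (auto simp: laurent_monomial_diff[OF nz] laurent_monomial_nonzero[OF nz])
        then have "laurent_monomial n (\<lambda>i. m i - m1 i) t = 1" by (rule triv)
        then show ?thesis by (simp add: laurent_monomial_diff[OF t] laurent_monomial_nonzero[OF t])
      qed
      then have "laurent_eval n xs t = C * laurent_monomial n m1 t"
        unfolding C_def by (intro eval) auto
      ultimately show ?thesis by simp
    next
      case False
      then obtain c2 m2 s where s: "(c2, m2) \<in> set xs" "s \<in> D"
        "laurent_monomial n m2 s \<noteq> laurent_monomial n m1 s" by auto
      let ?F = "\<lambda>\<alpha>. laurent_eval n (map (\<lambda>(c, m). (c * laurent_monomial n m s, m)) xs) \<alpha>"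
      \<comment> \<open>Write P for the polynomial \<open>xs\<close>. The combination P(s alpha) - v
        P(alpha) still vanishes on \<open>D\<close> but loses every term whose monomial has value
        \<open>v\<close> at \<open>s\<close>, so the induction hypothesis applies. Used for the two
        distinct values of \<open>m1\<close> and \<open>m2\<close> at \<open>s\<close>, it expresses
        \<open>?F t\<close> as two different multiples of P(t), which forces P(t) = 0.\<close>
      have eq: "?F t = v * laurent_eval n xs t" if v: "(c, m) \<in> set xs" "v = laurent_monomial n m s" for c m v
      proof -
        define ys where "ys = map (\<lambda>(c, m). (c * (laurent_monomial n m s - v), m))
          (filter (\<lambda>(c, m). laurent_monomial n m s \<noteq> v) xs)"
        have eval: "laurent_eval n ys \<alpha> = ?F \<alpha> - v * laurent_eval n xs \<alpha>" for \<alpha>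
          unfolding ys_def
          by (induction xs) (auto simp: laurent_eval_Cons algebra_simps)
        have shift: "?F \<alpha> = laurent_eval n xs (\<lambda>i. s i * \<alpha> i)" for \<alpha>
          by (induction xs) (auto simp: laurent_eval_Cons laurent_monomial_mult)
        have "length ys < length xs"
          unfolding ys_def length_map by (rule length_filter_less[OF v(1)]) (simp add: v(2))
        moreover have "\<forall>\<alpha>\<in>D. laurent_eval n ys \<alpha> = 0"
          unfolding eval shift using 1(2) mult[OF s(2)] by auto
        ultimately have "laurent_eval n ys t = 0" using 1(1) by blast
        then show ?thesis unfolding eval by simp
      qed
      have "(c1, m1) \<in> set xs" using Cons x by simp
      from eq[OF this refl] eq[OF s(1) refl] s(3) show ?thesis by auto
    qed
  qed simp
qed

context matrix_group_field begin

text \<open>Each equation of \<open>H\<close> restricts to a Laurent polynomial that vanishes on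
  \<open>D\<close>, and \<open>laurent_eval_vanish\<close> carries the vanishing over to
  \<open>t\<close>. Closed diagonal groups are thus cut out by their trivial characters.\<close>

lemma closed_diagonal_group:
  assumes cl: "closedin zar H"
    and D: "D = {\<alpha>. mat_diag n \<alpha> \<in> H}" and ne: "D \<noteq> {}"
    and mult: "\<And>A B. A \<in> H \<Longrightarrow> B \<in> H \<Longrightarrow> A * B \<in> H"
    and t: "\<forall>i<n. t i \<in> K - {0}"
    and triv: "\<And>m. \<forall>\<alpha>\<in>D. laurent_monomial n m \<alpha> = 1 \<Longrightarrow> laurent_monomial n m t = 1"
  shows "mat_diag n t \<in> H"
proof -
  obtain F where F: "F \<subseteq> regular_functions K n" "H = zero_locus K n F"
    using cl unfolding closedin_zariski[OF subfield_K] by blast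
  have H: "H \<subseteq> carrier GLK" unfolding F(2) zero_locus_def by blast
  have nz: "\<forall>i<n. \<alpha> i \<noteq> 0" if "\<alpha> \<in> D" for \<alpha>
  proof -
    have "mat_diag n \<alpha> \<in> carrier GLK" using that D H by blast
    then have "(\<Prod>i<n. \<alpha> i) \<noteq> 0" using GL_det by (metis det_mat_diag)
    then show ?thesis by simp
  qed
  have tnz: "\<forall>i<n. t i \<noteq> 0" using t by blast
  have "f (mat_diag n t) = 0" if f: "f \<in> F" for f
  proof -
    obtain xs where xs: "\<And>\<alpha>. \<forall>i<n. \<alpha> i \<noteq> 0 \<Longrightarrow> f (mat_diag n \<alpha>) = laurent_eval n xs \<alpha>"
      using regular_on_diagonal f F(1) by blast
    have "\<forall>\<alpha>\<in>D. laurent_eval n xs \<alpha> = 0"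
    proof
      fix \<alpha> assume \<alpha>: "\<alpha> \<in> D"
      then have "f (mat_diag n \<alpha>) = 0" using f D unfolding F(2) zero_locus_def by blast
      then show "laurent_eval n xs \<alpha> = 0" using xs[OF nz[OF \<alpha>]] by simp
    qed
    moreover have "(\<lambda>i. \<alpha> i * \<beta> i) \<in> D" if "\<alpha> \<in> D" "\<beta> \<in> D" for \<alpha> \<beta>
      using that mult unfolding D by (metis mat_diag_diag mem_Collect_eq)
    ultimately have "laurent_eval n xs t = 0"
      using laurent_eval_vanish[OF nz ne _ tnz triv] by blast
    then show ?thesis using xs[OF tnz] by simp
  qed
  moreover have "mat_diag n t \<in> carrier GLK"
    using t by (auto simp: GL_iff mat_diag_entry zero_K det_mat_diag)
  ultimately show ?thesis unfolding F(2) zero_locus_def by blast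
qed

lemma regular_coordinate_powi:
  assumes i: "i < n"
  shows "\<exists>f\<in>regular_functions K n. \<forall>\<alpha>. (\<forall>j<n. \<alpha> j \<noteq> 0) \<longrightarrow> f (mat_diag n \<alpha>) = \<alpha> i powi k"
proof (cases "k \<ge> 0")
  case True
  have "(\<lambda>A. (A $$ (i, i)) ^ nat k) \<in> regular_functions K n"
    using i by (intro regular_power regular_functions.entry)
  then show ?thesis
    using True i by (intro bexI[of _ "\<lambda>A. (A $$ (i, i)) ^ nat k"]) (simp_all add: power_int_def mat_diag_entry)
next
  case False
  \<comment> \<open>The inverse of one diagonal entry is the inverse determinant times the product
    of the other diagonal entries; this supplies the negative powers.\<close>
  let ?g = "\<lambda>A :: complex mat. inverse (det A) * (\<Prod>j\<in>{..<n}-{i}. A $$ (j, j))"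
  have "?g \<in> regular_functions K n"
    by (intro regular_functions.mult regular_functions.inverse_det regular_prod regular_functions.entry) auto
  then have "(\<lambda>A. ?g A ^ nat (- k)) \<in> regular_functions K n" by (rule regular_power)
  moreover have "?g (mat_diag n \<alpha>) ^ nat (- k) = \<alpha> i powi k" if "\<forall>j<n. \<alpha> j \<noteq> 0" for \<alpha> :: "nat \<Rightarrow> complex"
  proof -
    have "(\<Prod>j\<in>{..<n}-{i}. mat_diag n \<alpha> $$ (j, j)) = (\<Prod>j\<in>{..<n}-{i}. \<alpha> j)"
      by (intro prod.cong) (auto simp: mat_diag_entry)
    moreover have "(\<Prod>j<n. \<alpha> j) = \<alpha> i * (\<Prod>j\<in>{..<n}-{i}. \<alpha> j)"
      using i by (intro prod.remove) auto
    moreover have "det (mat_diag n \<alpha>) = (\<Prod>j<n. \<alpha> j)" by (rule det_mat_diag)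
    moreover have "(\<Prod>j\<in>{..<n}-{i}. \<alpha> j) \<noteq> 0" using that by simp
    ultimately have "?g (mat_diag n \<alpha>) = inverse (\<alpha> i)" by simp
    then show ?thesis using False by (simp add: power_int_def)
  qed
  ultimately show ?thesis by (intro bexI) auto
qed

end

subsection \<open>Characters of shift-invariant diagonal groups\<close>

text \<open>The character of the diagonal matrices given by an integer polynomial, read modulo \<open>x\<^sup>n - 1\<close>.\<close>

definition poly_character :: "nat \<Rightarrow> int poly \<Rightarrow> (nat \<Rightarrow> complex) \<Rightarrow> complex" where
  "poly_character n f \<alpha> = (\<Prod>j\<le>degree f. \<alpha> (j mod n) powi coeff f j)"

lemma poly_character_bound:
  assumes "degree f \<le> N" shows "poly_character n f \<alpha> = (\<Prod>j\<le>N. \<alpha> (j mod n) powi coeff f j)"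
  unfolding poly_character_def
  by (rule prod.mono_neutral_left) (use assms in \<open>auto simp: coeff_eq_0\<close>)

lemma poly_character_add:
  assumes "n > 0" "\<forall>i<n. \<alpha> i \<noteq> 0"
  shows "poly_character n (f + g) \<alpha> = poly_character n f \<alpha> * poly_character n g \<alpha>"
proof -
  let ?N = "max (degree f) (degree g)"
  have "poly_character n (f + g) \<alpha> = (\<Prod>j\<le>?N. \<alpha> (j mod n) powi coeff (f + g) j)"
    by (rule poly_character_bound) (rule degree_add_le_max)
  also have "\<dots> = (\<Prod>j\<le>?N. \<alpha> (j mod n) powi coeff f j) * (\<Prod>j\<le>?N. \<alpha> (j mod n) powi coeff g j)"
    unfolding prod.distrib[symmetric] using assms by (intro prod.cong) (auto simp: power_int_add)
  finally show ?thesis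
    by (simp only: poly_character_bound[of f ?N] poly_character_bound[of g ?N] max.cobounded1 max.cobounded2)
qed

lemma poly_character_smult:
  "poly_character n (Polynomial.smult c f) \<alpha> = poly_character n f \<alpha> powi c"
proof -
  have "poly_character n (Polynomial.smult c f) \<alpha> =
      (\<Prod>j\<le>degree f. \<alpha> (j mod n) powi coeff (Polynomial.smult c f) j)"
    by (rule poly_character_bound) (rule degree_smult_le)
  also have "\<dots> = (\<Prod>j\<le>degree f. (\<alpha> (j mod n) powi coeff f j) powi c)"
    by (intro prod.cong) (auto simp: power_int_mult[symmetric] mult.commute)
  also have "\<dots> = (\<Prod>j\<le>degree f. \<alpha> (j mod n) powi coeff f j) powi c"
    by (simp add: prod_powi)
  finally show ?thesis by (simp add: poly_character_def)
qed

text \<open>Multiplication by x acts as the cyclic shift of the coordinates; for a shift-invariant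
  \<open>D\<close> this makes the trivial characters an ideal.\<close>

lemma poly_character_pCons:
  assumes "n > 0"
  shows "poly_character n (pCons 0 f) \<alpha> = poly_character n f (\<lambda>i. \<alpha> (Suc i mod n))"
proof -
  have "poly_character n (pCons 0 f) \<alpha> = (\<Prod>j\<le>Suc (degree f). \<alpha> (j mod n) powi coeff (pCons 0 f) j)"
    by (rule poly_character_bound) (rule degree_pCons_le)
  also have "\<dots> = (\<Prod>j\<le>degree f. \<alpha> (Suc j mod n) powi coeff f j)"
    by (subst prod.atMost_Suc_shift) simp
  finally show ?thesis by (simp add: poly_character_def mod_Suc_eq)
qed

lemma poly_character_monom:
  "poly_character n (monom c k) \<alpha> = \<alpha> (k mod n) powi c"
proof -
  have "poly_character n (monom c k) \<alpha> = (\<Prod>j\<le>k. \<alpha> (j mod n) powi coeff (monom c k) j)"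
    by (rule poly_character_bound) (rule degree_monom_le)
  also have "\<dots> = (\<Prod>j\<le>k. if j = k then \<alpha> (k mod n) powi c else 1)"
    by (intro prod.cong) auto
  finally show ?thesis by simp
qed

lemma poly_character_laurent:
  assumes "n > 0"
  shows "poly_character n (\<Sum>i<n. monom (m i) i) \<alpha> = laurent_monomial n m \<alpha>"
proof -
  let ?f = "\<Sum>i<n. monom (m i) i"
  have coeff: "coeff ?f j = (if j < n then m j else 0)" for j
    by (simp add: coeff_sum)
  have "degree ?f \<le> n - 1" by (rule degree_le) (use coeff in auto)
  then have "poly_character n ?f \<alpha> = (\<Prod>j\<le>n - 1. \<alpha> (j mod n) powi coeff ?f j)"
    by (rule poly_character_bound)
  also have "{..n - 1} = {..<n}" using assms by auto
  finally show ?thesis by (simp add: laurent_monomial_def coeff)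
qed

text \<open>Reading indices modulo \<open>n\<close> puts x^n - 1 into the set \<open>I\<close> of
  trivial characters, \<open>sat\<close> makes \<open>I\<close> saturated, and
  \<open>nonconst\<close> keeps x - 1 out. \<open>saturated_ideal_cyclotomic\<close> then applies to
  the polynomial with coefficients \<open>m\<close>.\<close>

lemma shift_invariant_trivial_monomial:
  assumes n: "prime n"
    and nz: "\<And>\<alpha>. \<alpha> \<in> D \<Longrightarrow> \<forall>i<n. \<alpha> i \<noteq> 0"
    and shift: "\<And>\<alpha>. \<alpha> \<in> D \<Longrightarrow> (\<lambda>i. \<alpha> (Suc i mod n)) \<in> D"
    and sat: "\<And>f c. c \<noteq> 0 \<Longrightarrow> \<forall>\<alpha>\<in>D. poly_character n f \<alpha> powi c = 1 \<Longrightarrow> \<forall>\<alpha>\<in>D. poly_character n f \<alpha> = 1"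
    and nonconst: "\<alpha>0 \<in> D" "\<alpha>0 0 \<noteq> \<alpha>0 1"
    and triv: "\<forall>\<alpha>\<in>D. laurent_monomial n m \<alpha> = 1"
    and ij: "i < n" "j < n"
  shows "m i = m j"
proof -
  have n2: "n \<ge> 2" using n by (rule prime_ge_2_nat)
  then have n0: "n > 0" by simp
  define I where "I = {f. \<forall>\<alpha>\<in>D. poly_character n f \<alpha> = 1}"
  have add: "f + g \<in> I" if "f \<in> I" "g \<in> I" for f g
    using that poly_character_add[OF n0 nz] by (simp add: I_def)
  have smult: "Polynomial.smult c f \<in> I" if "f \<in> I" for c f
    using that by (simp add: I_def poly_character_smult)
  have X: "pCons 0 f \<in> I" if "f \<in> I" for f
    using that shift by (simp add: I_def poly_character_pCons[OF n0])
  have mult: "g * f \<in> I" if f: "f \<in> I" for f g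
  proof (induction g)
    case 0
    show ?case using smult[OF f, of 0] by simp
  next
    case (pCons a g)
    then show ?case using add[OF smult[OF f, of a] X[of "g * f"]] by simp
  qed
  define f where "f = (\<Sum>i<n. monom (m i) i)"
  have coeff: "coeff f j = (if j < n then m j else 0)" for j
    by (simp add: f_def coeff_sum)
  have "cyclotomic_prime n dvd f"
  proof (rule saturated_ideal_cyclotomic[OF n, of I])
    show "f \<in> I" using triv by (simp add: I_def f_def poly_character_laurent[OF n0])
    show "h \<in> I" if "c \<noteq> 0" "Polynomial.smult c h \<in> I" for c h
      using sat[OF that(1), of h] that(2) by (simp add: I_def poly_character_smult)
    have eq: "monom 1 n - 1 = (monom 1 n + monom (-1) 0 :: int poly)" by (rule poly_eqI) (simp add: coeff_1 monom_0 coeff_pCons split: nat.split)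
    have "poly_character n (monom 1 n + monom (-1) 0) \<alpha> = 1" if "\<alpha> \<in> D" for \<alpha>
      using nz[OF that] n0 unfolding poly_character_add[OF n0 nz[OF that]] poly_character_monom
      by (simp add: power_int_minus)
    then show "monom 1 n - 1 \<in> I" unfolding I_def eq by blast
    have eq: "[:-1, 1:] = (monom 1 1 + monom (-1) 0 :: int poly)" by (simp add: monom_0 monom_Suc)
    have "poly_character n [:-1, 1:] \<alpha>0 = \<alpha>0 1 / \<alpha>0 0"
      unfolding eq poly_character_add[OF n0 nz[OF nonconst(1)]] poly_character_monom
      using n2 by (simp add: field_simps)
    moreover have "\<alpha>0 1 / \<alpha>0 0 \<noteq> 1"
      using nonconst(2) nz[OF nonconst(1)] n0 by (auto simp: divide_eq_1_iff)
    ultimately show "[:-1, 1:] \<notin> I" unfolding I_def using nonconst(1) by force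
  qed (use add mult in auto)
  moreover have "degree f < n"
    using degree_le[of "n - 1" f] coeff n0 by fastforce
  ultimately have "coeff f i = coeff f j"
    using n0 ij coeff_multiple_of_cyclotomic_prime by blast
  then show ?thesis using ij by (simp add: coeff)
qed

subsection \<open>Imprimitive groups of prime degree\<close>

text \<open>The product of the x - \<pi> i telescopes. With S_m the sum of \<open>\<pi> 0\<close> to
  \<open>\<pi> m\<close> and p the next matrix, S_m p = 0 gives (x^(m+1) - x^m S_m)(x - p) = x^(m+2)
  - x^(m+1) (S_m + p).\<close>

lemma idempotents_char_poly_product:
  fixes \<pi> :: "nat \<Rightarrow> complex mat"
  assumes carrier: "\<And>i. i < k \<Longrightarrow> \<pi> i \<in> carrier_mat n n"
    and orth: "\<And>i j. i < k \<Longrightarrow> j < k \<Longrightarrow> i \<noteq> j \<Longrightarrow> \<pi> i * \<pi> j = 0\<^sub>m n n"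
    and m: "m < k"
  shows "(\<Prod>i\<le>m. det (x \<cdot>\<^sub>m 1\<^sub>m n - \<pi> i)) =
    det (mat n n (\<lambda>(r, c). x ^ Suc m * (if r = c then 1 else 0) - x ^ m * (\<Sum>i\<le>m. \<pi> i $$ (r, c))))"
  using m
proof (induction m)
  case 0
  have "x \<cdot>\<^sub>m 1\<^sub>m n - \<pi> 0 =
      mat n n (\<lambda>(r, c). x ^ Suc 0 * (if r = c then 1 else 0) - x ^ 0 * (\<Sum>i\<le>0. \<pi> i $$ (r, c)))"
    using carrier[OF 0] by (intro eq_matI) auto
  then show ?case by simp
next
  case (Suc m)
  let ?S = "\<lambda>m r c. \<Sum>i\<le>m. \<pi> i $$ (r, c)"
  let ?M = "\<lambda>m. mat n n (\<lambda>(r, c). x ^ Suc m * (if r = c then 1 else 0) - x ^ m * ?S m r c)"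
  have p: "\<pi> (Suc m) \<in> carrier_mat n n" using carrier Suc.prems by blast
  let ?B = "x \<cdot>\<^sub>m 1\<^sub>m n - \<pi> (Suc m)"
  have B: "?B \<in> carrier_mat n n" using p by (auto intro: minus_carrier_mat)
  have "?M m * ?B = ?M (Suc m)"
  proof (rule eq_matI)
    fix r c assume "r < dim_row (?M (Suc m))" "c < dim_col (?M (Suc m))"
    then have rc: "r < n" "c < n" by auto
    have Sp: "(\<Sum>l<n. ?S m r l * \<pi> (Suc m) $$ (l, c)) = 0"
    proof -
      have "(\<Sum>l<n. ?S m r l * \<pi> (Suc m) $$ (l, c)) = (\<Sum>l<n. \<Sum>i\<le>m. \<pi> i $$ (r, l) * \<pi> (Suc m) $$ (l, c))"
        by (simp add: sum_distrib_right)
      also have "\<dots> = (\<Sum>i\<le>m. \<Sum>l<n. \<pi> i $$ (r, l) * \<pi> (Suc m) $$ (l, c))"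
        by (rule sum.swap)
      also have "\<dots> = (\<Sum>i\<le>m. (\<pi> i * \<pi> (Suc m)) $$ (r, c))"
      proof (intro sum.cong refl)
        fix i assume "i \<in> {..m}"
        then have "\<pi> i \<in> carrier_mat n n" using carrier Suc.prems by simp
        then show "(\<Sum>l<n. \<pi> i $$ (r, l) * \<pi> (Suc m) $$ (l, c)) = (\<pi> i * \<pi> (Suc m)) $$ (r, c)"
          using p rc by (simp add: scalar_prod_def atLeast0LessThan)
      qed
      also have "\<dots> = 0"
        using orth Suc.prems rc by (intro sum.neutral) auto
      finally show ?thesis .
    qed
    have "(?M m * ?B) $$ (r, c) = (\<Sum>l<n. ?M m $$ (r, l) * ?B $$ (l, c))"
      using rc B p by (simp add: scalar_prod_def atLeast0LessThan)
    also have "\<dots> = (\<Sum>l<n. (x ^ Suc m * (if r = l then 1 else 0) - x ^ m * ?S m r l) *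
        (x * (if l = c then 1 else 0) - \<pi> (Suc m) $$ (l, c)))"
      using rc p by (intro sum.cong) auto
    also have "\<dots> = (\<Sum>l<n. (if r = l then x ^ Suc m * (x * (if l = c then 1 else 0) - \<pi> (Suc m) $$ (l, c)) else 0)
        - (if l = c then x ^ Suc m * ?S m r l else 0)
        + x ^ m * (?S m r l * \<pi> (Suc m) $$ (l, c)))"
      by (intro sum.cong refl) (auto simp: algebra_simps)
    also have "\<dots> = x ^ Suc m * (x * (if r = c then 1 else 0) - \<pi> (Suc m) $$ (r, c))
        - x ^ Suc m * ?S m r c + x ^ m * (\<Sum>l<n. ?S m r l * \<pi> (Suc m) $$ (l, c))"
      using rc by (simp add: sum.distrib sum_subtractf sum_distrib_left[symmetric])
    also have "\<dots> = ?M (Suc m) $$ (r, c)"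
      unfolding Sp using rc by (simp add: algebra_simps)
    finally show "(?M m * ?B) $$ (r, c) = ?M (Suc m) $$ (r, c)" .
  qed (use B p in auto)
  moreover have "det (?M m * ?B) = det (?M m) * det ?B"
    by (rule det_mult[OF _ B]) simp
  ultimately show ?case using Suc by simp
qed

text \<open>The multiplicity of 1 as a root of the common characteristic polynomial is the rank of
  each projection, so comparing orders at 1 replaces a dimension count for \<open>k\<close> blocks
  of equal dimension.\<close>

lemma card_dvd_of_idempotents:
  fixes \<pi> :: "nat \<Rightarrow> complex mat"
  assumes k: "k > 0" and carrier: "\<And>i. i < k \<Longrightarrow> \<pi> i \<in> carrier_mat n n"
    and orth: "\<And>i j. i < k \<Longrightarrow> j < k \<Longrightarrow> i \<noteq> j \<Longrightarrow> \<pi> i * \<pi> j = 0\<^sub>m n n"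
    and one: "\<And>r c. r < n \<Longrightarrow> c < n \<Longrightarrow> (\<Sum>i<k. \<pi> i $$ (r, c)) = (if r = c then 1 else 0)"
    and sim: "\<And>i. i < k \<Longrightarrow> similar_mat (\<pi> i) (\<pi> 0)"
  shows "k dvd n"
proof -
  have cp: "poly (char_poly A) x = det (x \<cdot>\<^sub>m 1\<^sub>m n - A)" if "A \<in> carrier_mat n n" for A :: "complex mat" and x
  proof -
    have "- (char_matrix A x) = x \<cdot>\<^sub>m 1\<^sub>m n - A"
      using that by (intro eq_matI) (auto simp: char_matrix_def)
    then show ?thesis using char_poly_matrix[OF that] by simp
  qed
  have p0: "\<pi> 0 \<in> carrier_mat n n" using carrier k by blast
  have "poly (char_poly (\<pi> 0) ^ k) x = poly (([:0, 1:] ^ (k - 1) * [:-1, 1:]) ^ n) x" for x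
  proof -
    have k1: "k - 1 < k" "{..k - 1} = {..<k}"
      using k by auto
    have "poly (char_poly (\<pi> 0) ^ k) x = (\<Prod>i<k. poly (char_poly (\<pi> 0)) x)" by simp
    also have "\<dots> = (\<Prod>i<k. poly (char_poly (\<pi> i)) x)"
    proof (intro prod.cong refl)
      fix i assume "i \<in> {..<k}"
      then have "char_poly (\<pi> i) = char_poly (\<pi> 0)" by (intro char_poly_similar sim) simp
      then show "poly (char_poly (\<pi> 0)) x = poly (char_poly (\<pi> i)) x" by (rule arg_cong2[OF sym refl])
    qed
    also have "\<dots> = (\<Prod>i\<le>k - 1. det (x \<cdot>\<^sub>m 1\<^sub>m n - \<pi> i))"
      unfolding k1 using cp carrier by (intro prod.cong) auto
    also have "\<dots> = det (mat n n (\<lambda>(r, c). x ^ Suc (k - 1) * (if r = c then 1 else 0)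
        - x ^ (k - 1) * (\<Sum>i\<le>k - 1. \<pi> i $$ (r, c))))"
      using carrier orth k1(1) by (rule idempotents_char_poly_product)
    also have "mat n n (\<lambda>(r, c). x ^ Suc (k - 1) * (if r = c then 1 else 0)
        - x ^ (k - 1) * (\<Sum>i\<le>k - 1. \<pi> i $$ (r, c))) = (x ^ (k - 1) * (x - 1)) \<cdot>\<^sub>m 1\<^sub>m n"
      unfolding k1(2) using one by (intro eq_matI) (auto simp: algebra_simps)
    also have "det \<dots> = (x ^ (k - 1) * (x - 1)) ^ n"
      by (simp add: det_smult)
    finally show ?thesis by (simp add: algebra_simps)
  qed
  then have eq: "char_poly (\<pi> 0) ^ k = ([:0, 1:] ^ (k - 1) * [:-1, 1:]) ^ n"
    by (intro poly_eqI_degree_lead_coeff poly_ext) auto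
  have nz: "char_poly (\<pi> 0) \<noteq> 0" using degree_monic_char_poly[OF p0] by auto
  have ord1: "Polynomial.order 1 [:0, 1:: complex:] = 0"
    by (rule order_0I) simp
  have ord2: "Polynomial.order 1 [:-1, 1:: complex:] = 1"
    using order_power_n_n[of 1 1] by simp
  have pow: "Polynomial.order 1 (p ^ j) = j * Polynomial.order 1 p" if "p \<noteq> 0" for p :: "complex poly" and j
    using that by (induction j) (auto simp: order_mult)
  have qnz: "[:0, 1:] ^ (k - 1) * [:-1, 1:: complex:] \<noteq> 0"
    unfolding mult_eq_0_iff power_eq_0_iff by simp
  have "k * Polynomial.order 1 (char_poly (\<pi> 0)) = Polynomial.order 1 (char_poly (\<pi> 0) ^ k)"
    using pow[OF nz] by simp
  also have "\<dots> = n * Polynomial.order 1 ([:0, 1:] ^ (k - 1) * [:-1, 1:: complex:])"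
    unfolding eq using qnz by (rule pow)
  also have "\<dots> = n"
    unfolding order_mult[OF qnz] by (subst pow) (simp_all add: ord1 ord2)
  finally show ?thesis by (metis dvd_triv_left)
qed

section \<open>Vectors over the subfield and projections onto blocks\<close>

context matrix_group_field begin

abbreviation "vK \<equiv> carrier (vector_space_over K n)"

lemma vK_iff: "v \<in> vK \<longleftrightarrow> v \<in> carrier_vec n \<and> (\<forall>i<n. v $ i \<in> K)"
  by (simp add: vector_space_over_def)

lemma mat_vec_entry:
  "A \<in> carrier_mat n n \<Longrightarrow> v \<in> carrier_vec n \<Longrightarrow> i < n \<Longrightarrow> (A *\<^sub>v v) $ i = (\<Sum>c<n. A $$ (i, c) * v $ c)"
  by (simp add: scalar_prod_def atLeast0LessThan)

lemma mat_vec_vK: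
  assumes "A \<in> carrier_mat n n" "\<And>i j. i < n \<Longrightarrow> j < n \<Longrightarrow> A $$ (i, j) \<in> K" "v \<in> vK"
  shows "A *\<^sub>v v \<in> vK"
  using assms mat_vec_entry[OF assms(1), of v] unfolding vK_iff
  by (auto intro!: sum_K mult_K simp del: index_mult_mat_vec)

lemma GL_mat_vec_vK: "A \<in> carrier GLK \<Longrightarrow> v \<in> vK \<Longrightarrow> A *\<^sub>v v \<in> vK"
  by (rule mat_vec_vK[OF GL_mat GL_entry])

lemma unit_vec_vK: "unit_vec n c \<in> vK"
  unfolding vK_iff by (auto simp: unit_vec_def zero_K one_K)

lemma finsum_vec_entry:
  fixes k :: nat
  assumes "\<And>i. i < k \<Longrightarrow> f i \<in> carrier_vec n" "r < n"
  shows "finsum_vec TYPE(complex) n f {..<k} $ r = (\<Sum>i<k. f i $ r)"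
  using assms by (intro index_finsum_vec) auto

lemma finsum_vec_carrier:
  fixes k :: nat
  assumes "\<And>i. i < k \<Longrightarrow> f i \<in> carrier_vec n"
  shows "finsum_vec TYPE(complex) n f {..<k} \<in> carrier_vec n"
  using assms by (intro finsum_vec_closed) auto

lemma linear_subspaceD:
  assumes "linear_subspace K n W"
  shows "W \<subseteq> vK" "0\<^sub>v n \<in> W" "\<And>v w. v \<in> W \<Longrightarrow> w \<in> W \<Longrightarrow> v + w \<in> W"
    "\<And>c w. c \<in> K \<Longrightarrow> w \<in> W \<Longrightarrow> c \<cdot>\<^sub>v w \<in> W"
  using assms unfolding linear_subspace_iff[OF subfield_K] by (auto simp: vK_iff)

lemma finsum_vec_Suc:
  fixes k :: nat
  assumes "\<And>i. i < Suc k \<Longrightarrow> f i \<in> carrier_vec n"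
  shows "finsum_vec TYPE(complex) n f {..<Suc k} = f k + finsum_vec TYPE(complex) n f {..<k}"
proof -
  have "finsum_vec TYPE(complex) n f (insert k {..<k}) = f k + finsum_vec TYPE(complex) n f {..<k}"
    using assms by (intro finsum_vec_insert) auto
  then show ?thesis by (simp add: lessThan_Suc)
qed

lemma subspace_finsum:
  fixes k :: nat
  assumes W: "linear_subspace K n W" and f: "\<And>i. i < k \<Longrightarrow> f i \<in> W"
  shows "finsum_vec TYPE(complex) n f {..<k} \<in> W"
  using f
proof (induction k)
  case 0
  show ?case using linear_subspaceD(2)[OF W] by (simp add: finsum_vec_empty)
next
  case (Suc k)
  have "f i \<in> carrier_vec n" if "i < Suc k" for i
    using Suc.prems[OF that] linear_subspaceD(1)[OF W] vK_iff by blast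
  then show ?case
    using Suc linear_subspaceD(3)[OF W] by (simp add: finsum_vec_Suc)
qed

lemma mat_vec_in_subspace:
  assumes W: "linear_subspace K n W" and A: "A \<in> carrier_mat n n"
    and cols: "\<And>c. c < n \<Longrightarrow> col A c \<in> W" and v: "v \<in> vK"
  shows "A *\<^sub>v v \<in> W"
proof -
  have v': "v \<in> carrier_vec n" "\<And>c. c < n \<Longrightarrow> v $ c \<in> K" using v by (auto simp: vK_iff)
  let ?f = "\<lambda>c. v $ c \<cdot>\<^sub>v col A c"
  have f: "?f c \<in> carrier_vec n" if "c < n" for c :: nat using A by auto
  have "A *\<^sub>v v = finsum_vec TYPE(complex) n ?f {..<n}"
  proof (rule eq_vecI)
    fix r assume "r < dim_vec (finsum_vec TYPE(complex) n ?f {..<n})"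
    then have r: "r < n" using finsum_vec_carrier[of n ?f, OF f] by auto
    have "finsum_vec TYPE(complex) n ?f {..<n} $ r = (\<Sum>c<n. ?f c $ r)"
      using f r by (rule finsum_vec_entry)
    also have "\<dots> = (\<Sum>c<n. A $$ (r, c) * v $ c)"
      using A r by (intro sum.cong) auto
    finally show "(A *\<^sub>v v) $ r = finsum_vec TYPE(complex) n ?f {..<n} $ r"
      using mat_vec_entry[OF A v'(1) r] by simp
  qed (use A finsum_vec_carrier[of n ?f, OF f] in auto)
  also have "\<dots> \<in> W"
    using cols v'(2) by (intro subspace_finsum[OF W] linear_subspaceD(4)[OF W])
  finally show ?thesis .
qed

lemma mat_eq_on_vK:
  assumes A: "A \<in> carrier_mat n n" and B: "B \<in> carrier_mat n n"
    and eq: "\<And>v. v \<in> vK \<Longrightarrow> A *\<^sub>v v = B *\<^sub>v v"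
  shows "A = B"
proof (rule eq_matI)
  fix i j assume "i < dim_row B" "j < dim_col B"
  then have ij: "i < n" "j < n" using B by auto
  have col: "(C *\<^sub>v unit_vec n j) $ i = C $$ (i, j)" if "C \<in> carrier_mat n n" for C :: "complex mat"
  proof -
    have "(C *\<^sub>v unit_vec n j) $ i = (\<Sum>c<n. if c = j then C $$ (i, j) else 0)"
      unfolding mat_vec_entry[OF that unit_vec_carrier ij(1)]
      using ij by (intro sum.cong) auto
    then show ?thesis using ij by simp
  qed
  show "A $$ (i, j) = B $$ (i, j)"
    using eq[OF unit_vec_vK[of j]] col[OF A] col[OF B] by metis
qed (use A B in auto)

text \<open>The columns of \<open>\<pi> i\<close> are the \<open>i\<close>-th components of the unit
  vectors. The last conclusion is uniqueness of components: an identity between projections can be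
  proved by exhibiting one decomposition of a vector.\<close>

lemma decomposition_projections:
  assumes V: "direct_decomposition K n k V"
  obtains \<pi> :: "nat \<Rightarrow> complex mat" where "\<And>i. i < k \<Longrightarrow> \<pi> i \<in> carrier_mat n n"
    "\<And>r c. r < n \<Longrightarrow> c < n \<Longrightarrow> (\<Sum>i<k. \<pi> i $$ (r, c)) = (if r = c then 1 else 0)"
    "\<And>i v. i < k \<Longrightarrow> v \<in> vK \<Longrightarrow> \<pi> i *\<^sub>v v \<in> V i"
    "\<And>u i v. v \<in> vK \<Longrightarrow> (\<And>j. j < k \<Longrightarrow> u j \<in> V j) \<Longrightarrow>
      (\<And>r. r < n \<Longrightarrow> v $ r = (\<Sum>j<k. u j $ r)) \<Longrightarrow> i < k \<Longrightarrow> \<pi> i *\<^sub>v v = u i"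
proof -
  have sub: "linear_subspace K n (V i)" if "i < k" for i
    using V that unfolding direct_decomposition_def by blast
  have Vc: "w \<in> carrier_vec n" "w \<in> vK" if "w \<in> V i" "i < k" for w i
    using linear_subspaceD(1)[OF sub[OF that(2)]] that(1) vK_iff by blast+
  have uniq: "\<exists>!w. w \<in> Pi\<^sub>E {..<k} V \<and> v = finsum_vec TYPE(complex) n w {..<k}" if "v \<in> vK" for v
    using V that unfolding direct_decomposition_def by blast
  define dec where "dec v = (THE w. w \<in> Pi\<^sub>E {..<k} V \<and> v = finsum_vec TYPE(complex) n w {..<k})" for v
  have dec: "dec v \<in> Pi\<^sub>E {..<k} V \<and> v = finsum_vec TYPE(complex) n (dec v) {..<k}" if "v \<in> vK" for v
    unfolding dec_def by (rule theI'[OF uniq[OF that]])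
  define \<pi> where "\<pi> i = mat n n (\<lambda>(r, c). dec (unit_vec n c) i $ r)" for i
  have pc: "\<pi> i \<in> carrier_mat n n" for i by (simp add: \<pi>_def)
  have decV: "dec v i \<in> V i" if "v \<in> vK" "i < k" for v i
    using dec[OF that(1)] that(2) by (auto dest: PiE_mem)
  have one: "(\<Sum>i<k. \<pi> i $$ (r, c)) = (if r = c then 1 else 0)" if "r < n" "c < n" for r c
  proof -
    have "(\<Sum>i<k. \<pi> i $$ (r, c)) = (\<Sum>i<k. dec (unit_vec n c) i $ r)"
      using that by (simp add: \<pi>_def)
    also have "\<dots> = finsum_vec TYPE(complex) n (dec (unit_vec n c)) {..<k} $ r"
      using Vc(1)[OF decV[OF unit_vec_vK]] that(1) by (intro finsum_vec_entry[symmetric])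
    also have "\<dots> = unit_vec n c $ r" using dec[OF unit_vec_vK[of c]] by metis
    finally show ?thesis using that by simp
  qed
  have mem: "\<pi> i *\<^sub>v v \<in> V i" if "i < k" "v \<in> vK" for i v
  proof (rule mat_vec_in_subspace[OF sub[OF that(1)] pc _ that(2)])
    fix c assume c: "c < n"
    have "dec (unit_vec n c) i \<in> carrier_vec n" using Vc(1)[OF decV[OF unit_vec_vK that(1)] that(1)] .
    then have "col (\<pi> i) c = dec (unit_vec n c) i"
      using c by (intro eq_vecI) (auto simp: \<pi>_def)
    then show "col (\<pi> i) c \<in> V i" using decV[OF unit_vec_vK that(1)] by simp
  qed
  have sum: "(\<Sum>i<k. (\<pi> i *\<^sub>v v) $ r) = v $ r" if "v \<in> vK" "r < n" for v r
  proof -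
    have v: "v \<in> carrier_vec n" using that vK_iff by blast
    have "(\<Sum>i<k. (\<pi> i *\<^sub>v v) $ r) = (\<Sum>i<k. \<Sum>c<n. \<pi> i $$ (r, c) * v $ c)"
      using mat_vec_entry[OF pc v that(2)] by (intro sum.cong refl)
    also have "\<dots> = (\<Sum>c<n. (\<Sum>i<k. \<pi> i $$ (r, c)) * v $ c)"
      unfolding sum_distrib_right by (rule sum.swap)
    also have "\<dots> = (\<Sum>c<n. if r = c then v $ c else 0)"
      using one[OF that(2)] by (intro sum.cong) auto
    finally show ?thesis using that by simp
  qed
  have unique: "\<pi> i *\<^sub>v v = u i"
    if v: "v \<in> vK" and u: "\<And>j. j < k \<Longrightarrow> u j \<in> V j" and s: "\<And>r. r < n \<Longrightarrow> v $ r = (\<Sum>j<k. u j $ r)"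
      and i: "i < k" for u i v
  proof -
    \<comment> \<open>\<open>Pi\<^sub>E\<close> consists of extensional functions, so uniqueness is
      only available after restricting families to the index set.\<close>
    have decomp: "restrict f {..<k} \<in> Pi\<^sub>E {..<k} V \<and> v = finsum_vec TYPE(complex) n (restrict f {..<k}) {..<k}"
      if f: "\<And>j. j < k \<Longrightarrow> f j \<in> V j" and fs: "\<And>r. r < n \<Longrightarrow> v $ r = (\<Sum>j<k. f j $ r)" for f
    proof
      show "restrict f {..<k} \<in> Pi\<^sub>E {..<k} V" using f by auto
      have fc: "restrict f {..<k} j \<in> carrier_vec n" if "j < k" for j using Vc(1)[OF f[OF that] that] that by simp
      show "v = finsum_vec TYPE(complex) n (restrict f {..<k}) {..<k}"
      proof -
        let ?w = "finsum_vec TYPE(complex) n (restrict f {..<k}) {..<k}"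
        have w: "?w \<in> carrier_vec n" by (rule finsum_vec_carrier) (rule fc)
        show ?thesis
        proof (rule eq_vecI)
          show "dim_vec v = dim_vec ?w" using v w by (simp add: vK_iff)
          fix r assume "r < dim_vec ?w"
          then have r: "r < n" using w by simp
          have "?w $ r = (\<Sum>j<k. restrict f {..<k} j $ r)"
            by (rule finsum_vec_entry) (rule fc, assumption, rule r)
          also have "\<dots> = (\<Sum>j<k. f j $ r)" by (intro sum.cong) auto
          finally show "v $ r = ?w $ r" using fs[OF r] by simp
        qed
      qed
    qed
    have "restrict (\<lambda>j. \<pi> j *\<^sub>v v) {..<k} = restrict u {..<k}"
      using uniq[OF v] decomp[of "\<lambda>j. \<pi> j *\<^sub>v v"] decomp[of u] mem[OF _ v] sum[OF v] u s by metis
    then show ?thesis using i by (metis lessThan_iff restrict_apply')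
  qed
  show thesis using that[of \<pi>] pc one mem unique by blast
qed

lemma imprimitive_imp_monomial:
  assumes n: "prime n" and G: "subgroup G GLK" and irr: "irreducible_group K n G"
    and imp: "imprimitive_group K n G"
  obtains P where "P \<in> carrier GLK"
    "\<And>B. B \<in> cj P ` G \<Longrightarrow> \<exists>\<sigma>. \<sigma> permutes {..<n} \<and> (\<forall>i<n. \<forall>j<n. B $$ (i, j) \<noteq> 0 \<longrightarrow> i = \<sigma> j)"
proof -
  obtain k V where k: "k \<ge> 2" and V: "direct_decomposition K n k V"
    and ne: "\<And>i. i < k \<Longrightarrow> V i \<noteq> {0\<^sub>v n}"
    and perm: "\<And>A. A \<in> G \<Longrightarrow> \<exists>\<sigma>. \<sigma> permutes {..<k} \<and> (\<forall>i<k. (\<lambda>v. A *\<^sub>v v) ` V i = V (\<sigma> i))"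
    using imp unfolding imprimitive_group_def by blast
  obtain \<pi> where pc: "\<And>i. i < k \<Longrightarrow> \<pi> i \<in> carrier_mat n n"
    and one: "\<And>r c. r < n \<Longrightarrow> c < n \<Longrightarrow> (\<Sum>i<k. \<pi> i $$ (r, c)) = (if r = c then 1 else 0)"
    and mem: "\<And>i v. i < k \<Longrightarrow> v \<in> vK \<Longrightarrow> \<pi> i *\<^sub>v v \<in> V i"
    and uniq: "\<And>u i v. v \<in> vK \<Longrightarrow> (\<And>j. j < k \<Longrightarrow> u j \<in> V j) \<Longrightarrow>
      (\<And>r. r < n \<Longrightarrow> v $ r = (\<Sum>j<k. u j $ r)) \<Longrightarrow> i < k \<Longrightarrow> \<pi> i *\<^sub>v v = u i"
    using decomposition_projections[OF V] by blast
  have sub: "linear_subspace K n (V i)" if "i < k" for i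
    using V that unfolding direct_decomposition_def by blast
  have Vk: "w \<in> vK" if "w \<in> V i" "i < k" for w i
    using linear_subspaceD(1)[OF sub[OF that(2)]] that(1) by blast
  have Vc: "w \<in> carrier_vec n" if "w \<in> V i" "i < k" for w i
    using Vk[OF that] vK_iff by blast
  have Gc: "A \<in> carrier GLK" if "A \<in> G" for A using subgroup.mem_carrier[OF G that] .
  have delta: "\<pi> j *\<^sub>v v = (if i = j then v else 0\<^sub>v n)" if "i < k" "j < k" "v \<in> V i" for i j v
  proof -
    have "\<pi> j *\<^sub>v v = (\<lambda>j. if i = j then v else 0\<^sub>v n) j"
    proof (rule uniq[OF Vk[OF that(3,1)] _ _ that(2)])
      show "(if i = j then v else 0\<^sub>v n) \<in> V j" if "j < k" for j
        using \<open>v \<in> V i\<close> linear_subspaceD(2)[OF sub[OF that]] by (cases "i = j") simp_all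
      fix r assume "r < n"
      then have "(\<Sum>j<k. (if i = j then v else 0\<^sub>v n) $ r) = (\<Sum>j<k. if i = j then v $ r else 0)"
        by (intro sum.cong) auto
      then show "v $ r = (\<Sum>j<k. (if i = j then v else 0\<^sub>v n) $ r)" using that by simp
    qed
    then show ?thesis .
  qed
  have orth: "\<pi> i * \<pi> j = 0\<^sub>m n n" if "i < k" "j < k" "i \<noteq> j" for i j
  proof (rule mat_eq_on_vK)
    fix v assume v: "v \<in> vK"
    then have vc: "v \<in> carrier_vec n" by (simp add: vK_iff)
    have "(\<pi> i * \<pi> j) *\<^sub>v v = \<pi> i *\<^sub>v (\<pi> j *\<^sub>v v)"
      using pc that vc by (intro assoc_mult_mat_vec) auto
    also have "\<dots> = 0\<^sub>v n" using delta[OF that(2,1) mem[OF that(2) v]] that(3) by simp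
    finally show "(\<pi> i * \<pi> j) *\<^sub>v v = 0\<^sub>m n n *\<^sub>v v" using vc by (auto intro!: eq_vecI)
  qed (use mult_carrier_mat[OF pc[OF that(1)] pc[OF that(2)]] in simp_all)
  \<comment> \<open>If v has components v_i, then A v has components A v_i, placed in the blocks
    \<open>\<sigma> i\<close>; uniqueness of components gives the intertwining relation.\<close>
  have comm: "A * \<pi> i = \<pi> (\<sigma> i) * A"
    if A: "A \<in> G" and \<sigma>: "\<sigma> permutes {..<k}" and act: "\<forall>i<k. (\<lambda>v. A *\<^sub>v v) ` V i = V (\<sigma> i)" and i: "i < k" for A \<sigma> i
  proof -
    note Ac = Gc[OF A]
    have \<sigma>k: "\<sigma> j < k \<longleftrightarrow> j < k" for j using permutes_in_image[OF \<sigma>, of j] by simp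
    have ik: "Hilbert_Choice.inv \<sigma> j < k \<longleftrightarrow> j < k" for j using permutes_in_image[OF permutes_inv[OF \<sigma>], of j] by simp
    show ?thesis
    proof (rule mat_eq_on_vK)
      fix v assume v: "v \<in> vK"
      then have vc: "v \<in> carrier_vec n" by (simp add: vK_iff)
      define u where "u j = A *\<^sub>v (\<pi> (Hilbert_Choice.inv \<sigma> j) *\<^sub>v v)" for j
      have u\<sigma>: "u (\<sigma> j) = A *\<^sub>v (\<pi> j *\<^sub>v v)" for j
        unfolding u_def using permutes_inverses(2)[OF \<sigma>] by simp
      have "\<pi> (\<sigma> i) *\<^sub>v (A *\<^sub>v v) = u (\<sigma> i)"
      proof (rule uniq[OF GL_mat_vec_vK[OF Ac v]])
        fix j assume j: "j < k"
        have "u j \<in> V (\<sigma> (Hilbert_Choice.inv \<sigma> j))"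
          unfolding u_def using act ik[of j] j mem[OF _ v] by blast
        then show "u j \<in> V j" using permutes_inverses(1)[OF \<sigma>] by simp
      next
        fix r assume r: "r < n"
        have "(\<Sum>j<k. u j $ r) = (\<Sum>j<k. u (\<sigma> j) $ r)"
          using sum.permute[OF \<sigma>, of "\<lambda>j. u j $ r"] by (simp add: o_def)
        also have "\<dots> = (\<Sum>j<k. \<Sum>l<n. A $$ (r, l) * (\<pi> j *\<^sub>v v) $ l)"
          unfolding u\<sigma> using mat_vec_entry[OF GL_mat[OF Ac] Vc[OF mem[OF _ v]] r] by (intro sum.cong) auto
        also have "\<dots> = (\<Sum>l<n. A $$ (r, l) * (\<Sum>j<k. (\<pi> j *\<^sub>v v) $ l))"
          unfolding sum_distrib_left by (rule sum.swap)
        also have "\<dots> = (\<Sum>l<n. A $$ (r, l) * v $ l)"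
        proof (intro sum.cong refl)
          fix l assume "l \<in> {..<n}"
          then have l: "l < n" by simp
          have "(\<Sum>j<k. (\<pi> j *\<^sub>v v) $ l) = (\<Sum>j<k. \<Sum>c<n. \<pi> j $$ (l, c) * v $ c)"
            using mat_vec_entry[OF pc vc l] by (intro sum.cong) auto
          also have "\<dots> = (\<Sum>c<n. (\<Sum>j<k. \<pi> j $$ (l, c)) * v $ c)"
            unfolding sum_distrib_right by (rule sum.swap)
          also have "\<dots> = (\<Sum>c<n. if l = c then v $ c else 0)"
            using one[OF l] by (intro sum.cong) auto
          finally show "A $$ (r, l) * (\<Sum>j<k. (\<pi> j *\<^sub>v v) $ l) = A $$ (r, l) * v $ l" using l by simp
        qed
        finally show "(A *\<^sub>v v) $ r = (\<Sum>j<k. u j $ r)"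
          using mat_vec_entry[OF GL_mat[OF Ac] vc r] by simp
      next
        show "\<sigma> i < k" using i \<sigma>k by simp
      qed
      then show "(A * \<pi> i) *\<^sub>v v = (\<pi> (\<sigma> i) * A) *\<^sub>v v"
        unfolding u\<sigma> using pc[OF i] pc[of "\<sigma> i"] i \<sigma>k GL_mat[OF Ac] vc by simp
    qed (use pc[OF i] pc[of "\<sigma> i"] i \<sigma>k GL_mat[OF Ac] in auto)
  qed
  have k0: "0 < k" using k by simp
  have trans: "\<exists>A\<in>G. A * \<pi> 0 = \<pi> i * A" if i: "i < k" for i
  proof (rule ccontr)
    assume notex: "\<not> ?thesis"
    \<comment> \<open>\<open>Orb\<close> is the orbit of block 0, phrased through intertwining
      because a permutation is only known to exist for each matrix. \<open>W\<close> is the sum of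
      the blocks in the orbit, written as the common kernel of the other projections.\<close>
    define Orb where "Orb = {i. i < k \<and> (\<exists>A\<in>G. A * \<pi> 0 = \<pi> i * A)}"
    define W where "W = {v \<in> vK. \<forall>j<k. j \<notin> Orb \<longrightarrow> \<pi> j *\<^sub>v v = 0\<^sub>v n}"
    have "1\<^sub>m n * \<pi> 0 = \<pi> 0 * 1\<^sub>m n" using pc[OF k0] by simp
    then have O0: "0 \<in> Orb" using GL_subgroup_one[OF G] k0 unfolding Orb_def by blast
    have Wc: "v \<in> carrier_vec n" if "v \<in> W" for v using that by (simp add: W_def vK_iff)
    have W: "linear_subspace K n W"
      unfolding linear_subspace_iff[OF subfield_K]
    proof (intro conjI ballI allI impI subsetI)
      show "v \<in> carrier_vec n" if "v \<in> W" for v using Wc[OF that] .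
      show "v $ i \<in> K" if "v \<in> W" "i < n" for v i using that by (simp add: W_def vK_iff)
      have "\<pi> j *\<^sub>v 0\<^sub>v n = 0\<^sub>v n" if "j < k" for j using pc[OF that] by (auto intro!: eq_vecI)
      then show "0\<^sub>v n \<in> W" by (auto simp: W_def vK_iff zero_K)
      fix v w assume vw: "v \<in> W" "w \<in> W"
      have "\<pi> j *\<^sub>v (v + w) = \<pi> j *\<^sub>v v + \<pi> j *\<^sub>v w" if "j < k" for j
        by (rule mult_add_distrib_mat_vec[OF pc[OF that] Wc[OF vw(1)] Wc[OF vw(2)]])
      moreover have "v + w \<in> vK" using vw unfolding W_def vK_iff by (auto simp: add_K)
      ultimately show "v + w \<in> W" using vw by (simp add: W_def)
    next
      fix c v assume c: "c \<in> K" and v: "v \<in> W"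
      have "\<pi> j *\<^sub>v (c \<cdot>\<^sub>v v) = c \<cdot>\<^sub>v (\<pi> j *\<^sub>v v)" if "j < k" for j
        by (rule mult_mat_vec[OF pc[OF that] Wc[OF v]])
      moreover have "c \<cdot>\<^sub>v v \<in> vK" using v c unfolding W_def vK_iff by (auto simp: mult_K)
      ultimately show "c \<cdot>\<^sub>v v \<in> W" using v by (auto simp: W_def)
    qed
    have inv: "A *\<^sub>v w \<in> W" if A: "A \<in> G" and w: "w \<in> W" for A w
    proof -
      note Ac = Gc[OF A]
      obtain \<sigma> where \<sigma>: "\<sigma> permutes {..<k}" "\<forall>i<k. (\<lambda>v. A *\<^sub>v v) ` V i = V (\<sigma> i)" using perm[OF A] by blast
      have wK: "w \<in> vK" and wc: "w \<in> carrier_vec n" using w Wc by (auto simp: W_def)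
      have "\<pi> j *\<^sub>v (A *\<^sub>v w) = 0\<^sub>v n" if j: "j < k" "j \<notin> Orb" for j
      proof -
        define i where "i = Hilbert_Choice.inv \<sigma> j"
        have i: "i < k" "\<sigma> i = j"
          unfolding i_def using permutes_in_image[OF permutes_inv[OF \<sigma>(1)], of j] j permutes_inverses(1)[OF \<sigma>(1)]
          by simp_all
        note c = comm[OF A \<sigma> i(1), unfolded i(2)]
        have "i \<notin> Orb"
        proof
          assume "i \<in> Orb"
          then obtain B where B: "B \<in> G" "B * \<pi> 0 = \<pi> i * B" by (auto simp: Orb_def)
          note m = GL_mat[OF Ac] GL_mat[OF Gc[OF B(1)]] pc[OF k0] pc[OF i(1)] pc[OF j(1)]
          have "(A * B) * \<pi> 0 = A * (B * \<pi> 0)" by (rule assoc_mult_mat[OF m(1-3)])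
          also have "\<dots> = (A * \<pi> i) * B" unfolding B(2) by (rule assoc_mult_mat[OF m(1,4,2), symmetric])
          also have "\<dots> = \<pi> j * (A * B)" unfolding c by (rule assoc_mult_mat[OF m(5,1,2)])
          finally have "j \<in> Orb" unfolding Orb_def using j(1) GL_subgroup_mult[OF G A B(1)] by blast
          then show False using j(2) by blast
        qed
        have "\<pi> j *\<^sub>v (A *\<^sub>v w) = (A * \<pi> i) *\<^sub>v w"
          unfolding c using pc[OF j(1)] GL_mat[OF Ac] wc by (intro assoc_mult_mat_vec[symmetric])
        also have "\<dots> = A *\<^sub>v (\<pi> i *\<^sub>v w)"
          using pc[OF i(1)] GL_mat[OF Ac] wc by (intro assoc_mult_mat_vec)
        also have "\<pi> i *\<^sub>v w = 0\<^sub>v n" using w i(1) \<open>i \<notin> Orb\<close> by (simp add: W_def)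
        finally show ?thesis using GL_mat[OF Ac] by (auto intro!: eq_vecI)
      qed
      then show ?thesis using GL_mat_vec_vK[OF Ac wK] by (simp add: W_def)
    qed
    have nonzero: "\<exists>w\<in>V j. w \<noteq> 0\<^sub>v n" if "j < k" for j
      using ne[OF that] linear_subspaceD(2)[OF sub[OF that]] by blast
    obtain w0 where w0: "w0 \<in> V 0" "w0 \<noteq> 0\<^sub>v n" using nonzero[OF k0] by blast
    have "w0 \<in> W"
      unfolding W_def using Vk[OF w0(1) k0] delta[OF k0 _ w0(1)] O0 by auto
    then have "W = vK" using irr W inv w0(2) unfolding irreducible_group_def by blast
    moreover obtain w where w: "w \<in> V i" "w \<noteq> 0\<^sub>v n" using nonzero[OF i] by blast
    ultimately have "w \<in> W" using Vk[OF w(1) i] by blast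
    moreover have "i \<notin> Orb" using notex i by (simp add: Orb_def)
    ultimately have "\<pi> i *\<^sub>v w = 0\<^sub>v n" using i by (simp add: W_def)
    then show False using delta[OF i i w(1)] w(2) by simp
  qed
  have "similar_mat (\<pi> i) (\<pi> 0)" if i: "i < k" for i
  proof -
    obtain A where A: "A \<in> G" "A * \<pi> 0 = \<pi> i * A" using trans[OF i] by blast
    note Ac = Gc[OF A(1)]
    note m = GL_mat[OF Ac] GL_mat[OF iv_closed[OF Ac]] pc[OF i] pc[OF k0]
    have "A * \<pi> 0 * iv A = \<pi> i * (A * iv A)"
      unfolding A(2) using m by (intro assoc_mult_mat)
    then have "\<pi> i = A * \<pi> 0 * iv A" using iv_mult(2)[OF Ac] m by simp
    then have "similar_mat_wit (\<pi> i) (\<pi> 0) A (iv A)"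
      using m iv_mult[OF Ac] by (auto simp: similar_mat_wit_def Let_def)
    then show ?thesis unfolding similar_mat_def by blast
  qed
  then have "k dvd n" using card_dvd_of_idempotents[OF k0 pc orth one] by blast
  then have kn: "k = n" using n k by (auto simp: prime_nat_iff)
  have "\<exists>w\<in>V j. w \<noteq> 0\<^sub>v n" if "j < n" for j
    using ne[of j] linear_subspaceD(2)[OF sub[of j]] that kn by blast
  then obtain v where v: "\<And>j. j < n \<Longrightarrow> v j \<in> V j" "\<And>j. j < n \<Longrightarrow> v j \<noteq> 0\<^sub>v n" by metis
  have vc: "v j \<in> carrier_vec n" "v j \<in> vK" if "j < n" for j
    using Vc[OF v(1)[OF that]] Vk[OF v(1)[OF that]] that kn by auto
  \<comment> \<open>One nonzero vector per block serves as a column. Since \<open>\<pi> i\<close>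
    recovers the \<open>i\<close>-th coordinate, \<open>Q\<close> has trivial kernel; as
    \<open>k = n\<close> it is square, hence invertible.\<close>
  define Q where "Q = mat n n (\<lambda>(r, c). v c $ r)"
  have Q: "Q \<in> carrier_mat n n" by (simp add: Q_def)
  have colQ: "col Q c = v c" if "c < n" for c
    using that vc(1)[OF that] by (intro eq_vecI) (auto simp: Q_def)
  have coord: "\<pi> i *\<^sub>v (Q *\<^sub>v z) = z $ i \<cdot>\<^sub>v v i" if i: "i < n" and z: "z \<in> carrier_vec n" for i z
  proof -
    have p: "\<pi> i \<in> carrier_mat n n" using pc i kn by simp
    have "\<pi> i *\<^sub>v (Q *\<^sub>v z) = (\<pi> i * Q) *\<^sub>v z"
      using p Q z by (intro assoc_mult_mat_vec[symmetric])
    also have "\<dots> = z $ i \<cdot>\<^sub>v v i"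
    proof (rule eq_vecI)
      fix r assume "r < dim_vec (z $ i \<cdot>\<^sub>v v i)"
      then have r: "r < n" using vc(1)[OF i] by simp
      have "((\<pi> i * Q) *\<^sub>v z) $ r = (\<Sum>c<n. (\<pi> i * Q) $$ (r, c) * z $ c)"
        using p Q z r by (intro mat_vec_entry) auto
      also have "\<dots> = (\<Sum>c<n. if c = i then v i $ r * z $ i else 0)"
      proof (intro sum.cong refl)
        fix c assume "c \<in> {..<n}"
        then have c: "c < n" by simp
        have "(\<pi> i * Q) $$ (r, c) = (\<pi> i *\<^sub>v col Q c) $ r" using p Q r c by simp
        also have "\<dots> = (if c = i then v i else 0\<^sub>v n) $ r"
          unfolding colQ[OF c] using delta[of c i "v c"] v(1)[OF c] c i kn by auto
        finally show "(\<pi> i * Q) $$ (r, c) * z $ c = (if c = i then v i $ r * z $ i else 0)"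
          using r by simp
      qed
      finally show "((\<pi> i * Q) *\<^sub>v z) $ r = (z $ i \<cdot>\<^sub>v v i) $ r" using i r vc(1)[OF i] by simp
    qed (use p Q vc(1)[OF i] in auto)
    finally show ?thesis .
  qed
  have zero: "z $ i = 0" if "z $ i \<cdot>\<^sub>v v i = 0\<^sub>v n" "i < n" for z :: "complex vec" and i
  proof (rule ccontr)
    assume nz: "z $ i \<noteq> 0"
    have "v i $ r = 0" if "r < n" for r
    proof -
      have "(z $ i \<cdot>\<^sub>v v i) $ r = 0" using \<open>z $ i \<cdot>\<^sub>v v i = 0\<^sub>v n\<close> that by simp
      then show ?thesis using nz that vc(1)[OF \<open>i < n\<close>] by simp
    qed
    then have "v i = 0\<^sub>v n" using vc(1)[OF that(2)] by (intro eq_vecI) auto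
    then show False using v(2)[OF that(2)] by simp
  qed
  have p0: "\<pi> i *\<^sub>v 0\<^sub>v n = 0\<^sub>v n" if "i < n" for i
    using pc[of i] that kn by (auto intro!: eq_vecI)
  have "det Q \<noteq> 0"
  proof
    assume "det Q = 0"
    then obtain z where z: "z \<in> carrier_vec n" "z \<noteq> 0\<^sub>v n" "Q *\<^sub>v z = 0\<^sub>v n"
      using det_0_iff_vec_prod_zero[OF Q] by blast
    have "z $ i = 0" if "i < n" for i
      using zero[OF _ that, of z] coord[OF that z(1)] p0[OF that] z(3) by simp
    then have "z = 0\<^sub>v n" using z(1) by (intro eq_vecI) auto
    then show False using z(2) by simp
  qed
  moreover have "Q $$ (i, j) \<in> K" if "i < n" "j < n" for i j
    using vc(2)[OF that(2)] that by (simp add: Q_def vK_iff)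
  ultimately have Qc: "Q \<in> carrier GLK" using Q by (simp add: GL_iff)
  show thesis
  proof (rule that[OF iv_closed[OF Qc]])
    fix B assume "B \<in> cj (iv Q) ` G"
    then obtain A where A: "A \<in> G" "B = iv Q * A * Q" using GL_inv_inv[OF Qc] by auto
    obtain \<sigma> where \<sigma>: "\<sigma> permutes {..<k}" "\<forall>i<k. (\<lambda>v. A *\<^sub>v v) ` V i = V (\<sigma> i)" using perm[OF A(1)] by blast
    note Ac = Gc[OF A(1)]
    have Bc: "B \<in> carrier_mat n n" using GL_triple[OF iv_closed[OF Qc] Ac Qc] GL_mat unfolding A(2) by blast
    have QB: "Q * B = A * Q"
      unfolding A(2) GL_m_assoc[OF iv_closed[OF Qc] Ac Qc]
      by (rule iv_cancel(2)[OF Qc GL_m_closed[OF Ac Qc]])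
    have "i = \<sigma> j" if ij: "i < n" "j < n" "B $$ (i, j) \<noteq> 0" for i j
    proof (rule ccontr)
      \<comment> \<open>\<open>A\<close> maps \<open>v j\<close> into block
        \<open>\<sigma> j\<close>, so every other projection kills the image, and by
        \<open>coord\<close> the entry of column \<open>j\<close> in row \<open>i\<close>
        vanishes.\<close>
      assume ne: "i \<noteq> \<sigma> j"
      have "\<sigma> j < k" using permutes_in_image[OF \<sigma>(1), of j] ij(2) kn by simp
      have "A *\<^sub>v v j \<in> V (\<sigma> j)" using \<sigma>(2) v(1)[OF ij(2)] ij(2) kn by blast
      then have "\<pi> i *\<^sub>v (A *\<^sub>v v j) = 0\<^sub>v n" using delta[OF \<open>\<sigma> j < k\<close>] ij(1) ne kn by auto
      moreover have "A *\<^sub>v v j = Q *\<^sub>v col B j"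
      proof -
        have "A *\<^sub>v v j = col (A * Q) j" by (simp only: col_mult2[OF GL_mat[OF Ac] Q ij(2)] colQ[OF ij(2)])
        also have "\<dots> = Q *\<^sub>v col B j" unfolding QB[symmetric] by (rule col_mult2[OF Q Bc ij(2)])
        finally show ?thesis .
      qed
      moreover have "col B j \<in> carrier_vec n" using Bc by auto
      ultimately have "col B j $ i = 0" using zero[OF _ ij(1), of "col B j"] coord[OF ij(1)] by simp
      then show False using ij Bc by simp
    qed
    then show "\<exists>\<sigma>. \<sigma> permutes {..<n} \<and> (\<forall>i<n. \<forall>j<n. B $$ (i, j) \<noteq> 0 \<longrightarrow> i = \<sigma> j)"
      using \<sigma>(1) kn by blast
  qed
qed

subsection \<open>Monomial groups\<close>

lemma irreducible_cj:
  assumes P: "P \<in> carrier GLK" and G: "G \<subseteq> carrier GLK" and irr: "irreducible_group K n G"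
  shows "irreducible_group K n (cj P ` G)"
  unfolding irreducible_group_def
proof (intro allI impI)
  fix W assume "linear_subspace K n W \<and> (\<forall>A\<in>cj P ` G. \<forall>w\<in>W. A *\<^sub>v w \<in> W)"
  then have W: "linear_subspace K n W" and inv: "\<And>A w. A \<in> G \<Longrightarrow> w \<in> W \<Longrightarrow> cj P A *\<^sub>v w \<in> W" by blast+
  note Wd = linear_subspaceD[OF W]
  note Pm = GL_mat[OF P] and iPm = GL_mat[OF iv_closed[OF P]]
  \<comment> \<open>Invariant subspaces of the conjugate pull back along \<open>P\<close> to
    invariant subspaces of \<open>G\<close>.\<close>
  define W' where "W' = {v \<in> vK. P *\<^sub>v v \<in> W}"
  have W'c: "v \<in> carrier_vec n" if "v \<in> W'" for v using that by (simp add: W'_def vK_iff)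
  have Wc: "v \<in> carrier_vec n" if "v \<in> W" for v using that Wd(1) vK_iff by blast
  have P0: "P *\<^sub>v 0\<^sub>v n = 0\<^sub>v n" using Pm by (auto intro!: eq_vecI)
  have Pi: "P *\<^sub>v (iv P *\<^sub>v v) = v" if "v \<in> carrier_vec n" for v
    using assoc_mult_mat_vec[OF Pm iPm that] iv_mult(2)[OF P] that by simp
  have "linear_subspace K n W'"
    unfolding linear_subspace_iff[OF subfield_K]
  proof (intro conjI ballI allI impI subsetI)
    show "v \<in> carrier_vec n" if "v \<in> W'" for v using W'c[OF that] .
    show "v $ i \<in> K" if "v \<in> W'" "i < n" for v i using that by (simp add: W'_def vK_iff)
    show "0\<^sub>v n \<in> W'" using P0 Wd(2) by (auto simp: W'_def vK_iff zero_K)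
    fix v w assume vw: "v \<in> W'" "w \<in> W'"
    have "P *\<^sub>v (v + w) = P *\<^sub>v v + P *\<^sub>v w"
      by (rule mult_add_distrib_mat_vec[OF Pm W'c[OF vw(1)] W'c[OF vw(2)]])
    moreover have "v + w \<in> vK" using vw unfolding W'_def vK_iff by (auto simp: add_K)
    ultimately show "v + w \<in> W'" using vw Wd(3) by (simp add: W'_def)
  next
    fix c v assume c: "c \<in> K" and v: "v \<in> W'"
    have "P *\<^sub>v (c \<cdot>\<^sub>v v) = c \<cdot>\<^sub>v (P *\<^sub>v v)" by (rule mult_mat_vec[OF Pm W'c[OF v]])
    moreover have "c \<cdot>\<^sub>v v \<in> vK" using v c unfolding W'_def vK_iff by (auto simp: mult_K)
    ultimately show "c \<cdot>\<^sub>v v \<in> W'" using v c Wd(4) by (auto simp: W'_def)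
  qed
  moreover have "A *\<^sub>v v \<in> W'" if A: "A \<in> G" and v: "v \<in> W'" for A v
  proof -
    have Ac: "A \<in> carrier GLK" using A G by blast
    note vc = W'c[OF v] and Am = GL_mat[OF Ac]
    have eq: "P * A = cj P A * P"
      using GL_m_assoc[OF GL_m_closed[OF P Ac] iv_closed[OF P] P] iv_mult(1)[OF P] GL_r_one[OF GL_m_closed[OF P Ac]] by simp
    have "P *\<^sub>v (A *\<^sub>v v) = (P * A) *\<^sub>v v" using assoc_mult_mat_vec[OF Pm Am vc] by simp
    also have "\<dots> = (cj P A * P) *\<^sub>v v" by (rule arg_cong[OF eq])
    also have "\<dots> = cj P A *\<^sub>v (P *\<^sub>v v)"
      by (rule assoc_mult_mat_vec[OF GL_mat[OF cj_closed[OF P Ac]] Pm vc])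
    also have "\<dots> \<in> W" using inv[OF A] v by (simp add: W'_def)
    finally show ?thesis using GL_mat_vec_vK[OF Ac] v by (simp add: W'_def)
  qed
  ultimately consider "W' = {0\<^sub>v n}" | "W' = vK" using irr unfolding irreducible_group_def by blast
  then show "W = {0\<^sub>v n} \<or> W = vK"
  proof cases
    case 1
    have "w = 0\<^sub>v n" if w: "w \<in> W" for w
    proof -
      have "iv P *\<^sub>v w \<in> W'"
        using w Wd(1) GL_mat_vec_vK[OF iv_closed[OF P]] Pi[OF Wc[OF w]] by (auto simp: W'_def)
      then have "iv P *\<^sub>v w = 0\<^sub>v n" using 1 by blast
      then show ?thesis using Pi[OF Wc[OF w]] P0 by simp
    qed
    then show ?thesis using Wd(2) by blast
  next
    case 2
    have "w \<in> W" if w: "w \<in> vK" for w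
    proof -
      have "iv P *\<^sub>v w \<in> W'" using w GL_mat_vec_vK[OF iv_closed[OF P]] 2 by blast
      then show ?thesis using Pi w by (simp add: W'_def vK_iff)
    qed
    then show ?thesis using Wd(1) by blast
  qed
qed

lemma GL_column_nonzero:
  assumes A: "A \<in> carrier GLK" and j: "j < n"
  obtains i where "i < n" "A $$ (i, j) \<noteq> 0"
proof -
  have "(\<Sum>l<n. iv A $$ (j, l) * A $$ (l, j)) = (iv A * A) $$ (j, j)"
    using mult_entry[OF GL_mat[OF iv_closed[OF A]] GL_mat[OF A] j j] by simp
  also have "\<dots> = 1" using iv_mult(1)[OF A] j by simp
  finally have sum: "(\<Sum>l<n. iv A $$ (j, l) * A $$ (l, j)) = 1" .
  have "\<exists>l<n. A $$ (l, j) \<noteq> 0"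
  proof (rule ccontr)
    assume "\<not> ?thesis"
    then have "(\<Sum>l<n. iv A $$ (j, l) * A $$ (l, j)) = 0" by (intro sum.neutral) simp
    then show False using sum by simp
  qed
  then show thesis using that by blast
qed

text \<open>Only the pattern of zeros is recorded, with \<open>\<sigma>\<close> sending a column to
  its row; that the remaining entries are nonzero comes from invertibility in
  \<open>monomial_matrix_nonzero\<close>.\<close>

definition monomial_matrix :: "(nat \<Rightarrow> nat) \<Rightarrow> complex mat \<Rightarrow> bool" where
  "monomial_matrix \<sigma> A \<longleftrightarrow> \<sigma> permutes {..<n} \<and> (\<forall>i<n. \<forall>j<n. A $$ (i, j) \<noteq> 0 \<longrightarrow> i = \<sigma> j)"

lemma monomial_matrix_nonzero:
  assumes "A \<in> carrier GLK" "monomial_matrix \<sigma> A" "j < n"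
  shows "\<sigma> j < n" "A $$ (\<sigma> j, j) \<noteq> 0"
proof -
  obtain i where i: "i < n" "A $$ (i, j) \<noteq> 0" using GL_column_nonzero[OF assms(1,3)] .
  then have "i = \<sigma> j" using assms by (auto simp: monomial_matrix_def)
  then show "\<sigma> j < n" "A $$ (\<sigma> j, j) \<noteq> 0" using i by auto
qed

text \<open>The permutation of a monomial matrix is locally constant.\<close>

lemma idc_monomial_diagonal:
  assumes H: "subgroup H GLK" and mon: "\<And>B. B \<in> H \<Longrightarrow> \<exists>\<sigma>. monomial_matrix \<sigma> B"
    and A: "A \<in> idc H" and ij: "i < n" "j < n" "i \<noteq> j"
  shows "A $$ (i, j) = 0"
proof -
  \<comment> \<open>Column \<open>j\<close> of an invertible monomial matrix has a single nonzero
    entry, so exactly one of the diagonal entry \<open>?f\<close> and the sum \<open>?g\<close> of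
    the others is nonzero. As \<open>?g\<close> vanishes at the identity, it vanishes on the whole
    component.\<close>
  let ?f = "\<lambda>A :: complex mat. A $$ (j, j)" and ?g = "\<lambda>A :: complex mat. \<Sum>l\<in>{..<n}-{j}. A $$ (l, j)"
  have mon': "?g B = (if \<sigma> j = j then 0 else B $$ (\<sigma> j, j)) \<and> (\<sigma> j \<noteq> j \<longrightarrow> ?f B = 0) \<and> B $$ (\<sigma> j, j) \<noteq> 0"
    if B: "B \<in> H" and \<sigma>: "monomial_matrix \<sigma> B" for B \<sigma>
  proof -
    have Bc: "B \<in> carrier GLK" using subgroup.mem_carrier[OF H B] .
    note nz = monomial_matrix_nonzero[OF Bc \<sigma> ij(2)]
    have z: "B $$ (l, j) = 0" if "l < n" "l \<noteq> \<sigma> j" for l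
      using \<sigma> that ij(2) unfolding monomial_matrix_def by blast
    have "?g B = (\<Sum>l\<in>{..<n}-{j}. if l = \<sigma> j then B $$ (\<sigma> j, j) else 0)"
      using z by (intro sum.cong) auto
    then show ?thesis using nz z[OF ij(2)] by auto
  qed
  have g0: "?g A = 0"
  proof (rule connected_zero_product[where X = "idc H" and f = ?f and g = ?g, OF connected_idc])
    show "?f \<in> regular_functions K n" "?g \<in> regular_functions K n"
      using ij(2) by (auto intro!: regular_functions.entry regular_sum)
    show "?f B = 0 \<or> ?g B = 0" if "B \<in> idc H" for B
    proof -
      have B: "B \<in> H" using that idc_subset by blast
      obtain \<sigma> where "monomial_matrix \<sigma> B" using mon[OF B] by blast
      from mon'[OF B this] show ?thesis by argo
    qed
    show "?f B \<noteq> 0 \<or> ?g B \<noteq> 0" if "B \<in> idc H" for B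
    proof -
      have B: "B \<in> H" using that idc_subset by blast
      obtain \<sigma> where "monomial_matrix \<sigma> B" using mon[OF B] by blast
      from mon'[OF B this] show ?thesis by (cases "\<sigma> j = j") auto
    qed
    show "1\<^sub>m n \<in> idc H" by (rule one_in_idc[OF H])
    show "?g (1\<^sub>m n) = 0" using ij(2) by (intro sum.neutral) auto
  qed (rule A)
  have AH: "A \<in> H" using A idc_subset by blast
  obtain \<sigma> where \<sigma>: "monomial_matrix \<sigma> A" using mon[OF AH] by blast
  have "\<sigma> j = j" using mon'[OF AH \<sigma>] g0 by argo
  then show ?thesis using \<sigma> ij unfolding monomial_matrix_def by metis
qed

lemma cj_idc_eq:
  assumes P: "P \<in> carrier GLK" and G: "subgroup G GLK"
  shows "idc (cj P ` G) = cj P ` idc G"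
proof
  have sub: "\<And>A. A \<in> G \<Longrightarrow> A \<in> carrier GLK" using subgroup.mem_carrier[OF G] .
  have unconj: "cj (iv P) (cj P A) = A" if "A \<in> carrier GLK" for A
    using cj_inv[OF P that] GL_inv_inv[OF P] by simp
  have "cj (iv P) ` (cj P ` G) = G"
    using unconj sub by (force simp: image_image)
  then have *: "cj (iv P) ` idc (cj P ` G) \<subseteq> idc G"
    using cj_idc[OF iv_closed[OF P] subgroup_cj[OF P G]] by simp
  show "idc (cj P ` G) \<subseteq> cj P ` idc G"
  proof
    fix B assume B: "B \<in> idc (cj P ` G)"
    then have Bc: "B \<in> carrier GLK"
      using idc_subset subgroup.mem_carrier[OF subgroup_cj[OF P G]] by blast
    have "cj (iv P) B \<in> idc G" using * B by blast
    moreover have "cj P (cj (iv P) B) = B" using cj_inv'[OF P Bc] GL_inv_inv[OF P] by simp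
    ultimately show "B \<in> cj P ` idc G" by (metis image_eqI)
  qed
qed (rule cj_idc[OF P G])

section \<open>The cyclic matrix and the normal form of the generator\<close>

lemma E_entry:
  assumes "i < n" "j < n" shows "E n $$ (i, j) = (if j = Suc i mod n then 1 else 0)"
  using assms by (cases "Suc i = n") (auto simp: E_def)

lemma E_carrier [simp]: "E n \<in> carrier_mat n n"
  by (simp add: E_def)

lemma E_diag_entry:
  assumes "i < n" "j < n" shows "E_diag n \<alpha> $$ (i, j) = (if j = Suc i mod n then \<alpha> i else 0)"
  using assms E_entry by (simp add: E_diag_def mat_diag_mult_left[OF E_carrier])

lemma E_diag_carrier [simp]: "E_diag n \<alpha> \<in> carrier_mat n n"
  by (simp add: E_diag_def mat_diag_mult_left[OF E_carrier])

lemmas E_diag_dim [simp] = carrier_matD[OF E_diag_carrier]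
  and E_dim [simp] = carrier_matD[OF E_carrier]

text \<open>Irreducibility forces \<open>\<sigma>\<close> to be an n-cycle. Numbering the
  coordinates along it and rescaling the basis turns all but one of the nonzero entries of
  \<open>g\<close> into 1 and leaves their product \<open>a\<close> in the last row. The change of
  basis is monomial, so it keeps the identity component diagonal.\<close>

lemma cyclic_normal_form:
  assumes n0: "n > 0" and H: "subgroup H GLK" and irr: "irreducible_group K n H"
    and c: "cyclic_over H g N" and g: "monomial_matrix \<sigma> g"
    and diag: "\<And>A i j. A \<in> idc H \<Longrightarrow> i < n \<Longrightarrow> j < n \<Longrightarrow> i \<noteq> j \<Longrightarrow> A $$ (i, j) = 0"
  obtains P a where "P \<in> carrier GLK" "a \<in> K - {0}"
    "cj P g = E_diag n (\<lambda>i. if Suc i = n then a else 1)"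
    "\<And>A. A \<in> idc H \<Longrightarrow> \<exists>\<alpha>. cj P A = mat_diag n \<alpha>"
proof -
  have gH: "g \<in> H" and dec: "\<And>A. A \<in> H \<Longrightarrow> \<exists>j. \<exists>B\<in>idc H. A = B * g ^\<^sub>m j"
    using c by (auto simp: cyclic_over_def)
  have gc: "g \<in> carrier GLK" using subgroup.mem_carrier[OF H gH] .
  note gm = GL_mat[OF gc]
  have \<sigma>: "\<sigma> permutes {..<n}" and gz: "\<And>i j. i < n \<Longrightarrow> j < n \<Longrightarrow> i \<noteq> \<sigma> j \<Longrightarrow> g $$ (i, j) = 0"
    using g unfolding monomial_matrix_def by blast+
  note g\<sigma> = monomial_matrix_nonzero[OF gc g]
  define orb where "orb m = (\<sigma> ^^ m) 0" for m
  have o0: "orb 0 = 0" and oS: "orb (Suc m) = \<sigma> (orb m)" for m by (simp_all add: orb_def)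
  have on: "orb m < n" for m by (induction m) (use n0 g\<sigma>(1) in \<open>simp_all add: o0 oS\<close>)
  have surj: "i \<in> range orb" if i: "i < n" for i
  proof -
    \<comment> \<open>The span of the coordinate vectors in the orbit of 0 is stable under
      \<open>g\<close> by construction and under the diagonal component, hence under
      \<open>H\<close>.\<close>
    define W where "W = {v \<in> vK. \<forall>i<n. i \<notin> range orb \<longrightarrow> v $ i = 0}"
    have Wc: "v \<in> carrier_vec n" if "v \<in> W" for v using that by (simp add: W_def vK_iff)
    have W: "linear_subspace K n W"
      unfolding linear_subspace_iff[OF subfield_K]
      by (auto simp: W_def vK_iff zero_K add_K mult_K)
    have stab: "A *\<^sub>v w \<in> W" if Ac: "A \<in> carrier GLK" and w: "w \<in> W"
      and A: "\<And>r c. r < n \<Longrightarrow> c < n \<Longrightarrow> r \<notin> range orb \<Longrightarrow> c \<in> range orb \<Longrightarrow> A $$ (r, c) = 0" for A w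
    proof -
      have "(A *\<^sub>v w) $ r = 0" if r: "r < n" "r \<notin> range orb" for r
        unfolding mat_vec_entry[OF GL_mat[OF Ac] Wc[OF w] r(1)]
      proof (rule sum.neutral, rule ballI)
        fix c assume "c \<in> {..<n}"
        then show "A $$ (r, c) * w $ c = 0" using A[OF r(1) _ r(2), of c] w by (cases "c \<in> range orb") (auto simp: W_def)
      qed
      then show ?thesis using GL_mat_vec_vK[OF Ac] w by (simp add: W_def)
    qed
    have gW: "g *\<^sub>v w \<in> W" if "w \<in> W" for w
    proof (rule stab[OF gc that])
      fix r c assume "r < n" "c < n" "r \<notin> range orb" "c \<in> range orb"
      then have "r \<noteq> \<sigma> c" using oS by (metis rangeE rangeI)
      then show "g $$ (r, c) = 0" using gz \<open>r < n\<close> \<open>c < n\<close> by blast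
    qed
    have gpW: "g ^\<^sub>m j *\<^sub>v w \<in> W" if "w \<in> W" for w j
      using that
    proof (induction j arbitrary: w)
      case 0
      then show ?case using gm Wc[OF 0] by simp
    next
      case (Suc j)
      have "g ^\<^sub>m Suc j *\<^sub>v w = g ^\<^sub>m j *\<^sub>v (g *\<^sub>v w)"
        using assoc_mult_mat_vec[OF GL_mat[OF GL_pow_closed[OF gc]] gm Wc[OF Suc.prems]] by simp
      then show ?case using Suc.IH[OF gW[OF Suc.prems]] by simp
    qed
    have "A *\<^sub>v w \<in> W" if A: "A \<in> H" and w: "w \<in> W" for A w
    proof -
      obtain j B where B: "B \<in> idc H" "A = B * g ^\<^sub>m j" using dec[OF A] by blast
      have Bc: "B \<in> carrier GLK" using B(1) idc_subset subgroup.mem_carrier[OF H] by blast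
      have "A *\<^sub>v w = B *\<^sub>v (g ^\<^sub>m j *\<^sub>v w)"
        unfolding B(2) by (rule assoc_mult_mat_vec[OF GL_mat[OF Bc] GL_mat[OF GL_pow_closed[OF gc]] Wc[OF w]])
      also have "\<dots> \<in> W"
        by (rule stab[OF Bc gpW[OF w]]) (use diag[OF B(1)] in metis)
      finally show ?thesis .
    qed
    then consider "W = {0\<^sub>v n}" | "W = vK" using irr W unfolding irreducible_group_def by blast
    then show ?thesis
    proof cases
      case 1
      have "unit_vec n 0 \<in> W"
        using unit_vec_vK[of 0] n0 o0 unfolding W_def by (auto simp: unit_vec_def)
      then show ?thesis using 1 n0 by simp
    next
      case 2
      then have "unit_vec n i \<in> W" using unit_vec_vK by blast
      then show ?thesis using i unfolding W_def by auto
    qed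
  qed
  have \<sigma>inj: "(\<sigma> ^^ a) x = (\<sigma> ^^ a) y \<Longrightarrow> x = y" for a x y
    using bij_is_inj[OF bij_fn[OF permutes_bij[OF \<sigma>]]] by (meson injD)
  have cancel: "orb (b - a) = 0" if "a \<le> b" "orb a = orb b" for a b
  proof -
    have "(\<sigma> ^^ a) ((\<sigma> ^^ (b - a)) 0) = (\<sigma> ^^ a) 0"
      using that unfolding orb_def by (metis comp_apply funpow_add le_add_diff_inverse)
    then show ?thesis unfolding orb_def by (rule \<sigma>inj)
  qed
  \<comment> \<open>If the orbit returned to 0 after \<open>d\<close> steps it would have at most
    \<open>d\<close> points, but it meets all \<open>n\<close> indices.\<close>
  have period: "n \<le> d" if d: "d > 0" "orb d = 0" for d
  proof -
    have "orb m = orb (m mod d)" for m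
      using funpow_mod_eq[of d \<sigma> 0 m] d(2) by (simp add: orb_def)
    then have "range orb \<subseteq> orb ` {..<d}" using d(1) by (metis image_eqI image_subsetI lessThan_iff mod_less_divisor)
    moreover have "{..<n} \<subseteq> range orb" using surj by blast
    ultimately have "card {..<n} \<le> card (orb ` {..<d})" by (intro card_mono) auto
    also have "\<dots> \<le> d" using card_image_le[of "{..<d}" orb] by simp
    finally show ?thesis by simp
  qed
  have inj: "inj_on orb {..<n}"
  proof (rule inj_onI)
    have "a = b" if "a \<le> b" "b < n" "orb a = orb b" for a b
      using cancel[OF that(1,3)] period[of "b - a"] that by (cases "a = b") auto
    then show "a = b" if "a \<in> {..<n}" "b \<in> {..<n}" "orb a = orb b" for a b
      using that by (metis lessThan_iff linorder_le_cases)
  qed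
  have onn: "orb n = 0"
  proof -
    have "orb ` {..<n} = {..<n}" using on inj by (intro endo_inj_surj) auto
    then obtain b where b: "b < n" "orb b = orb n" using on[of n] by (metis imageE lessThan_iff)
    then have "orb (n - b) = 0" using cancel[of b n] by simp
    then have "b = 0" using period[of "n - b"] b(1) by simp
    then show ?thesis using b(2) o0 by simp
  qed
  \<comment> \<open>\<open>d m\<close> accumulates the entries of \<open>g\<close> along the first
    \<open>m\<close> steps of the cycle; these are the scale factors that normalize entries to
    1.\<close>
  define d where "d = rec_nat (1 :: complex) (\<lambda>m x. g $$ (orb (Suc m), orb m) * x)"
  have d0: "d 0 = 1" and dS: "d (Suc m) = g $$ (orb (Suc m), orb m) * d m" for m by (simp_all add: d_def)
  have dK: "d m \<in> K" "d m \<noteq> 0" for m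
  proof (induction m)
    case (Suc m)
    show "d (Suc m) \<in> K" unfolding dS using Suc(1) GL_entry[OF gc on on] by (rule mult_K[rotated])
    show "d (Suc m) \<noteq> 0" unfolding dS using Suc(2) g\<sigma>(2)[OF on[of m]] by (simp add: oS)
  qed (auto simp: d0 one_K)
  \<comment> \<open>The cycle is traversed backwards: \<open>g\<close> carries coordinate
    \<open>\<tau> j\<close> to \<open>\<tau> (j - 1)\<close>, and \<open>E n\<close> has its ones at
    \<open>(j - 1, j)\<close>.\<close>
  define \<tau> where "\<tau> j = orb (n - 1 - j)" for j
  define \<delta> where "\<delta> j = d (n - 1 - j)" for j
  have \<tau>n: "\<tau> j < n" for j by (simp add: \<tau>_def on)
  have \<tau>inj: "j = l" if "j < n" "l < n" "\<tau> j = \<tau> l" for j l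
    using inj_onD[OF inj that(3)[unfolded \<tau>_def]] that by auto
  define Q where "Q = mat n n (\<lambda>(r, j). if r = \<tau> j then \<delta> j else 0)"
  have Qm: "Q \<in> carrier_mat n n" by (simp add: Q_def)
  have Qe: "Q $$ (r, j) = (if r = \<tau> j then \<delta> j else 0)" if "r < n" "j < n" for r j
    using that by (simp add: Q_def)
  have "det Q \<noteq> 0"
  proof
    assume "det Q = 0"
    then obtain z where z: "z \<in> carrier_vec n" "z \<noteq> 0\<^sub>v n" "Q *\<^sub>v z = 0\<^sub>v n"
      using det_0_iff_vec_prod_zero[OF Qm] by blast
    have "z $ j = 0" if j: "j < n" for j
    proof -
      have "(Q *\<^sub>v z) $ \<tau> j = (\<Sum>l<n. if l = j then \<delta> j * z $ j else 0)"
        unfolding mat_vec_entry[OF Qm z(1) \<tau>n]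
        using \<tau>inj[OF j] Qe[OF \<tau>n] by (intro sum.cong) auto
      then have "\<delta> j * z $ j = 0" using j \<tau>n unfolding z(3) by simp
      then show ?thesis using dK(2) by (simp add: \<delta>_def)
    qed
    then have "z = 0\<^sub>v n" using z(1) by (intro eq_vecI) auto
    then show False using z(2) by simp
  qed
  then have Qc: "Q \<in> carrier GLK" using Qm Qe dK(1) by (auto simp: GL_iff \<delta>_def zero_K)
  have conj: "cj (iv Q) A = B" if "A \<in> carrier GLK" "B \<in> carrier_mat n n" "A * Q = Q * B" for A B
  proof -
    have "cj (iv Q) A = iv Q * (A * Q)"
      unfolding GL_inv_inv[OF Qc] by (rule GL_m_assoc[OF iv_closed[OF Qc] that(1) Qc])
    also have "\<dots> = (iv Q * Q) * B"
      unfolding that(3) using GL_mat[OF iv_closed[OF Qc]] Qm that(2) by (intro assoc_mult_mat[symmetric])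
    also have "\<dots> = B" using iv_mult(1)[OF Qc] that(2) by simp
    finally show ?thesis .
  qed
  define a where "a = g $$ (0, \<tau> 0) * \<delta> 0"
  have st0: "\<sigma> (\<tau> 0) = 0" using onn oS[of "n - 1"] n0 by (simp add: \<tau>_def)
  have stS: "\<sigma> (\<tau> j) = \<tau> (j - 1)" "g $$ (\<tau> (j - 1), \<tau> j) * \<delta> j = \<delta> (j - 1)" if "0 < j" "j < n" for j
  proof -
    have "Suc (n - 1 - j) = n - 1 - (j - 1)" using that by simp
    then show "\<sigma> (\<tau> j) = \<tau> (j - 1)" "g $$ (\<tau> (j - 1), \<tau> j) * \<delta> j = \<delta> (j - 1)"
      unfolding \<tau>_def \<delta>_def by (metis oS, metis dS)
  qed
  let ?E = "E_diag n (\<lambda>i. if Suc i = n then a else 1)"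
  have aK: "a \<in> K - {0}"
    using GL_entry[OF gc n0 \<tau>n] dK g\<sigma>(2)[OF \<tau>n[of 0]] unfolding st0 a_def \<delta>_def by (simp add: mult_K)
  have "g * Q = Q * ?E"
  proof (rule eq_matI)
    fix r j assume "r < dim_row (Q * ?E)" "j < dim_col (Q * ?E)"
    then have rj: "r < n" "j < n" using Qm by auto
    have "(g * Q) $$ (r, j) = (\<Sum>l<n. if l = \<tau> j then g $$ (r, \<tau> j) * \<delta> j else 0)"
      unfolding mult_entry[OF gm Qm rj] using Qe rj by (intro sum.cong) auto
    then have L: "(g * Q) $$ (r, j) = g $$ (r, \<tau> j) * \<delta> j" using \<tau>n by simp
    have R: "(Q * ?E) $$ (r, j) = (\<Sum>l<n. if j = Suc l mod n then Q $$ (r, l) * (if Suc l = n then a else 1) else 0)"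
      unfolding mult_entry[OF Qm E_diag_carrier rj] using E_diag_entry rj by (intro sum.cong) auto
    show "(g * Q) $$ (r, j) = (Q * ?E) $$ (r, j)"
    proof (cases "j = 0")
      case True
      have "(Q * ?E) $$ (r, j) = (\<Sum>l<n. if l = n - 1 then Q $$ (r, n - 1) * a else 0)"
        unfolding R using n0 True by (intro sum.cong refl) (auto simp: mod_Suc)
      also have "\<dots> = (if r = 0 then a else 0)"
        using n0 rj by (simp add: Qe \<tau>_def \<delta>_def o0 d0)
      also have "\<dots> = g $$ (r, \<tau> j) * \<delta> j"
        unfolding True using gz[OF rj(1) \<tau>n[of 0]] st0 by (auto simp: a_def)
      finally show ?thesis unfolding L by (rule sym)
    next
      case False
      have "(Q * ?E) $$ (r, j) = (\<Sum>l<n. if l = j - 1 then Q $$ (r, j - 1) else 0)"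
        unfolding R using rj False by (intro sum.cong refl) (auto simp: mod_Suc)
      also have "\<dots> = (if r = \<tau> (j - 1) then \<delta> (j - 1) else 0)"
        using rj less_imp_diff_less[OF rj(2), of 1] by (simp add: Qe)
      also have "\<dots> = g $$ (r, \<tau> j) * \<delta> j"
        using gz[OF rj(1) \<tau>n[of j]] stS[of j] False rj by auto
      finally show ?thesis unfolding L by (rule sym)
    qed
  qed (use Qm gm in auto)
  then have g_conj: "cj (iv Q) g = ?E" by (intro conj gc) auto
  have diag_conj: "\<exists>\<alpha>. cj (iv Q) A = mat_diag n \<alpha>" if A: "A \<in> idc H" for A
  proof -
    have Ac: "A \<in> carrier GLK" using A idc_subset subgroup.mem_carrier[OF H] by blast
    have "A * Q = Q * mat_diag n (\<lambda>j. A $$ (\<tau> j, \<tau> j))"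
    proof (rule eq_matI)
      fix r j assume "r < dim_row (Q * mat_diag n (\<lambda>j. A $$ (\<tau> j, \<tau> j)))" "j < dim_col (Q * mat_diag n (\<lambda>j. A $$ (\<tau> j, \<tau> j)))"
      then have rj: "r < n" "j < n" using Qm by (auto simp: mat_diag_def)
      have "(A * Q) $$ (r, j) = (\<Sum>l<n. if l = \<tau> j then A $$ (r, \<tau> j) * \<delta> j else 0)"
        unfolding mult_entry[OF GL_mat[OF Ac] Qm rj] using Qe rj by (intro sum.cong) auto
      then have "(A * Q) $$ (r, j) = A $$ (r, \<tau> j) * \<delta> j" using \<tau>n by simp
      also have "\<dots> = Q $$ (r, j) * A $$ (\<tau> j, \<tau> j)" using diag[OF A rj(1) \<tau>n[of j]] Qe[OF rj] by auto
      finally show "(A * Q) $$ (r, j) = (Q * mat_diag n (\<lambda>j. A $$ (\<tau> j, \<tau> j))) $$ (r, j)"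
        unfolding mat_diag_mult_right[OF Qm] using rj by simp
    qed (use Qm GL_mat[OF Ac] in \<open>auto simp: mat_diag_def\<close>)
    then have "cj (iv Q) A = mat_diag n (\<lambda>j. A $$ (\<tau> j, \<tau> j))" by (rule conj[OF Ac mat_diag_dim])
    then show ?thesis by blast
  qed
  show thesis using that[OF iv_closed[OF Qc] aK g_conj diag_conj] .
qed

end

subsection \<open>Roots of unity\<close>

lemma powers_primitive_root:
  fixes z :: complex
  assumes M: "M > 0" and prim: "\<And>j. z ^ j = 1 \<longleftrightarrow> M dvd j"
  shows "range (\<lambda>j. z ^ j) = roots_of_unity M"
proof -
  have z0: "z \<noteq> 0" using prim[of M] M by (metis dvd_refl power_0_left zero_neq_one not_gr_zero)
  have sub: "(\<lambda>j. z ^ j) ` {..<M} \<subseteq> roots_of_unity M" "range (\<lambda>j. z ^ j) \<subseteq> roots_of_unity M"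
    using prim[of M] by (auto simp: roots_of_unity_def power_mult[symmetric] mult.commute)
      (metis power_mult power_one mult.commute)+
  have "inj_on (\<lambda>j. z ^ j) {..<M}"
  proof (rule inj_onI)
    have *: "a = b" if "a \<le> b" "b < M" "z ^ a = z ^ b" for a b
    proof -
      have "z ^ a * z ^ (b - a) = z ^ b" using that(1) by (simp flip: power_add)
      then have "z ^ a * z ^ (b - a) = z ^ a * 1" using that(3) by simp
      then have "z ^ (b - a) = 1" using z0 by simp
      then have "M dvd b - a" using prim by blast
      then show ?thesis using that by (auto dest!: dvd_imp_le)
    qed
    fix a b assume "a \<in> {..<M}" "b \<in> {..<M}" and eq: "z ^ a = z ^ b"
    then have "a < M" "b < M" by simp_all
    then show "a = b"
      using *[OF _ _ eq] *[OF _ _ eq[symmetric]] nat_le_linear[of a b] by blast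
  qed
  then have "card ((\<lambda>j. z ^ j) ` {..<M}) = M" by (simp add: card_image)
  moreover have "card (roots_of_unity M) = M" "finite (roots_of_unity M)"
    unfolding roots_of_unity_def using M card_roots_unity_eq[of M] finite_roots_unity[of M] by auto
  ultimately have "(\<lambda>j. z ^ j) ` {..<M} = roots_of_unity M"
    using sub(1) by (intro card_subset_eq) auto
  then show ?thesis using sub(2) by blast
qed

lemma cis_eq_1_iff_dvd:
  assumes m: "m > 0"
  shows "cis (2 * pi * of_int a / of_nat m) ^ j = 1 \<longleftrightarrow> int m dvd a * int j"
proof -
  have "cis (2 * pi * of_int a / of_nat m) ^ j = cis (of_nat j * (2 * pi * of_int a / of_nat m))"
    by (rule DeMoivre)
  also have "\<dots> = 1 \<longleftrightarrow> (\<exists>k::int. of_nat j * (2 * pi * of_int a / of_nat m) = 2 * pi * of_int k)"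
  proof
    assume "cis (of_nat j * (2 * pi * of_int a / of_nat m)) = 1"
    then have "cos (of_nat j * (2 * pi * of_int a / of_nat m)) = 1" by (metis cis.simps(1) one_complex.simps(1))
    then obtain k :: int where "of_nat j * (2 * pi * of_int a / of_nat m) = of_int k * 2 * pi"
      by (auto simp: cos_one_2pi_int)
    then show "\<exists>k::int. of_nat j * (2 * pi * of_int a / of_nat m) = 2 * pi * of_int k"
      by (intro exI[of _ k]) simp
  next
    assume "\<exists>k::int. of_nat j * (2 * pi * of_int a / of_nat m) = 2 * pi * of_int k"
    then obtain k :: int where "of_nat j * (2 * pi * of_int a / of_nat m) = 2 * pi * of_int k" by blast
    then show "cis (of_nat j * (2 * pi * of_int a / of_nat m)) = 1"
      using cis_multiple_2pi[of "of_int k"] by simp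
  qed
  also have "\<dots> \<longleftrightarrow> (\<exists>k::int. a * int j = int m * k)"
  proof (rule ex_cong1)
    fix k :: int
    have "of_nat j * (2 * pi * of_int a / of_nat m) = 2 * pi * of_int k \<longleftrightarrow>
        real_of_int (a * int j) = real_of_int (int m * k)"
      using m by (simp add: field_simps)
    then show "of_nat j * (2 * pi * of_int a / of_nat m) = 2 * pi * of_int k \<longleftrightarrow> a * int j = int m * k"
      by (simp only: of_int_eq_iff)
  qed
  finally show ?thesis by (simp add: dvd_def)
qed

text \<open>After cancelling the gcd of \<open>a\<close> and \<open>m\<close>, numerator and
  denominator are coprime, so the reduced denominator is the order of this root of unity.\<close>

lemma powers_of_cis:
  assumes m: "m > 0"
  shows "range (\<lambda>j. cis (2 * pi * of_int a / of_nat m) ^ j) = roots_of_unity (m div nat (gcd a (int m)))"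
proof (rule powers_primitive_root)
  define g where "g = nat (gcd a (int m))"
  have g: "int g = gcd a (int m)" "g > 0" using m by (simp_all add: g_def)
  obtain m' where m': "int m = int g * int m'"
    by (metis g(1) gcd_dvd2 dvdE of_nat_dvd_iff of_nat_mult)
  obtain a' where a': "a = int g * a'" by (metis g(1) gcd_dvd1 dvdE)
  have mg: "m div g = m'" using m' g(2) by (metis nonzero_mult_div_cancel_left of_nat_eq_iff of_nat_mult not_gr_zero)
  have "int g * gcd a' (int m') = int g * 1"
    using g(1) m' a' by (metis gcd_mult_distrib_int mult.right_neutral abs_of_nat)
  then have cop: "coprime a' (int m')" using g(2) by (simp add: coprime_iff_gcd_eq_1)
  show "0 < m div nat (gcd a (int m))" using m m' mg unfolding g_def[symmetric] by (cases m') auto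
  fix j
  have "int m dvd a * int j \<longleftrightarrow> int m' dvd a' * int j"
    unfolding m' a' using g(2) by (simp add: mult.assoc)
  also have "\<dots> \<longleftrightarrow> int m' dvd int j"
    using cop by (metis coprime_commute coprime_dvd_mult_right_iff)
  finally show "cis (2 * pi * of_int a / of_nat m) ^ j = 1 \<longleftrightarrow> m div nat (gcd a (int m)) dvd j"
    unfolding cis_eq_1_iff_dvd[OF m] g_def[symmetric] mg by simp
qed

lemma root_of_unity_cis:
  fixes z :: complex
  assumes "m > 0" "z ^ m = 1"
  obtains k :: int where "z = cis (2 * pi * of_int k / of_nat m)"
proof -
  have "bij_betw (\<lambda>k. cis (2 * pi * real k / real m)) {..<m} {z. z ^ m = 1}"
    using assms(1) by (rule bij_betw_roots_unity)
  then obtain k where "z = cis (2 * pi * real k / real m)"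
    using assms(2) by (auto simp: bij_betw_def)
  then show thesis using that[of "int k"] by simp
qed

context matrix_group_field begin

subsection \<open>Powers of the cyclic monomial matrix\<close>

lemma mat_diag_cong: "(\<And>i. i < n \<Longrightarrow> \<alpha> i = \<beta> i) \<Longrightarrow> mat_diag n \<alpha> = mat_diag n \<beta>"
  by (intro eq_matI) (auto simp: mat_diag_def)

lemma mat_diag_eq_iff: "mat_diag n \<alpha> = mat_diag n \<beta> \<longleftrightarrow> (\<forall>i<n. \<alpha> i = \<beta> i)" for \<alpha> \<beta> :: "nat \<Rightarrow> complex"
proof
  assume eq: "mat_diag n \<alpha> = mat_diag n \<beta>"
  show "\<forall>i<n. \<alpha> i = \<beta> i"
  proof (intro allI impI)
    fix i assume "i < n"
    then show "\<alpha> i = \<beta> i" using arg_cong[OF eq, of "\<lambda>A. A $$ (i, i)"] by (simp add: mat_diag_entry)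
  qed
qed (blast intro: mat_diag_cong)

lemma mat_diag_GL: "\<forall>i<n. \<alpha> i \<in> K - {0} \<Longrightarrow> mat_diag n \<alpha> \<in> carrier GLK"
  by (auto simp: GL_iff mat_diag_entry zero_K det_mat_diag)

lemma mat_diag_GL_iff: "mat_diag n \<alpha> \<in> carrier GLK \<longleftrightarrow> (\<forall>i<n. \<alpha> i \<in> K - {0})"
proof
  assume A: "mat_diag n \<alpha> \<in> carrier GLK"
  have "(\<Prod>i<n. \<alpha> i) \<noteq> 0" using GL_det[OF A] det_mat_diag by metis
  moreover have "\<alpha> i \<in> K" if "i < n" for i using GL_entry[OF A that that] that by (simp add: mat_diag_entry)
  ultimately show "\<forall>i<n. \<alpha> i \<in> K - {0}" by auto
qed (rule mat_diag_GL)

lemma E_pow_entry: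
  assumes n0: "n > 0" and ij: "i < n" "j < n"
  shows "(E n ^\<^sub>m l) $$ (i, j) = (if j = (i + l) mod n then 1 else 0)"
  using ij
proof (induction l arbitrary: j)
  case 0
  then show ?case by (auto simp: E_def)
next
  case (Suc l)
  have "(E n ^\<^sub>m Suc l) $$ (i, j) = (\<Sum>k<n. (E n ^\<^sub>m l) $$ (i, k) * E n $$ (k, j))"
    using mult_entry[OF pow_carrier_mat[OF E_carrier] E_carrier Suc.prems] by simp
  also have "\<dots> = (\<Sum>k<n. if k = (i + l) mod n then E n $$ ((i + l) mod n, j) else 0)"
    using Suc.IH[OF Suc.prems(1)] by (intro sum.cong) auto
  also have "\<dots> = E n $$ ((i + l) mod n, j)" using n0 by simp
  also have "\<dots> = (if j = (i + Suc l) mod n then 1 else 0)"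
    using E_entry[of "(i + l) mod n" j] n0 Suc.prems(2) by (simp add: mod_Suc_eq)
  finally show ?case .
qed

lemma E_pow_mod: "n > 0 \<Longrightarrow> E n ^\<^sub>m l = E n ^\<^sub>m (l mod n)"
proof -
  assume n0: "n > 0"
  have c: "E n ^\<^sub>m a \<in> carrier_mat n n" for a by (rule pow_carrier_mat[OF E_carrier])
  show ?thesis
    by (rule eq_matI) (simp_all only: carrier_matD[OF c] E_pow_entry[OF n0] mod_add_right_eq)
qed

lemma mat_diag_E_pow_entry:
  assumes "n > 0" "i < n" "j < n"
  shows "(mat_diag n \<alpha> * E n ^\<^sub>m l) $$ (i, j) = (if j = (i + l) mod n then \<alpha> i else 0)"
  using E_pow_entry[OF assms] assms by (simp add: mat_diag_mult_left[OF pow_carrier_mat[OF E_carrier]])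

lemma mat_diag_E_pow_carrier: "mat_diag n \<alpha> * E n ^\<^sub>m l \<in> carrier_mat n n"
  by (rule mult_carrier_mat[OF mat_diag_dim pow_carrier_mat[OF E_carrier]])

lemma E_pow_mult_mat_diag:
  assumes n0: "n > 0"
  shows "E n ^\<^sub>m l * mat_diag n \<alpha> = mat_diag n (\<lambda>i. \<alpha> ((i + l) mod n)) * E n ^\<^sub>m l"
proof (rule eq_matI)
  fix i j assume "i < dim_row (mat_diag n (\<lambda>i. \<alpha> ((i + l) mod n)) * E n ^\<^sub>m l)"
    "j < dim_col (mat_diag n (\<lambda>i. \<alpha> ((i + l) mod n)) * E n ^\<^sub>m l)"
  then have ij: "i < n" "j < n" using mat_diag_E_pow_carrier[of "\<lambda>i. \<alpha> ((i + l) mod n)" l] by auto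
  show "(E n ^\<^sub>m l * mat_diag n \<alpha>) $$ (i, j) = (mat_diag n (\<lambda>i. \<alpha> ((i + l) mod n)) * E n ^\<^sub>m l) $$ (i, j)"
    unfolding mat_diag_E_pow_entry[OF n0 ij]
    using E_pow_entry[OF n0 ij] ij by (simp add: mat_diag_mult_right[OF pow_carrier_mat[OF E_carrier]])
qed (auto simp: mat_diag_def)

lemma E_diag_pow:
  assumes n0: "n > 0"
  shows "E_diag n \<gamma> ^\<^sub>m l = mat_diag n (\<lambda>i. \<Prod>j<l. \<gamma> ((i + j) mod n)) * E n ^\<^sub>m l"
proof (induction l)
  case 0
  have "dim_row (E_diag n \<gamma>) = n" "dim_row (E n) = n" using E_diag_carrier[of \<gamma>] E_carrier by auto
  then show ?case by simp
next
  case (Suc l)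
  let ?b = "\<lambda>l i. \<Prod>j<l. \<gamma> ((i + j) mod n)"
  note Ec = E_carrier and El = pow_carrier_mat[OF E_carrier, of l] and dc = mat_diag_dim
  have "E_diag n \<gamma> ^\<^sub>m Suc l = (mat_diag n (?b l) * E n ^\<^sub>m l) * (mat_diag n \<gamma> * E n)"
    using Suc by (simp add: E_diag_def)
  also have "\<dots> = mat_diag n (?b l) * (E n ^\<^sub>m l * (mat_diag n \<gamma> * E n))"
    by (rule assoc_mult_mat[OF dc El mult_carrier_mat[OF dc Ec]])
  also have "E n ^\<^sub>m l * (mat_diag n \<gamma> * E n) = (E n ^\<^sub>m l * mat_diag n \<gamma>) * E n"
    by (rule assoc_mult_mat[OF El dc Ec, symmetric])
  also have "\<dots> = mat_diag n (\<lambda>i. \<gamma> ((i + l) mod n)) * (E n ^\<^sub>m l * E n)"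
    unfolding E_pow_mult_mat_diag[OF n0] by (rule assoc_mult_mat[OF dc El Ec])
  also have "mat_diag n (?b l) * (mat_diag n (\<lambda>i. \<gamma> ((i + l) mod n)) * (E n ^\<^sub>m l * E n)) =
      (mat_diag n (?b l) * mat_diag n (\<lambda>i. \<gamma> ((i + l) mod n))) * (E n ^\<^sub>m l * E n)"
    by (rule assoc_mult_mat[OF dc dc mult_carrier_mat[OF El Ec], symmetric])
  finally show ?case by simp
qed

lemma E_diag_pow_n:
  assumes n0: "n > 0"
  shows "E_diag n \<gamma> ^\<^sub>m (n * q) = mat_diag n (\<lambda>i. (\<Prod>j<n. \<gamma> j) ^ q)"
proof -
  have E1: "E n ^\<^sub>m (n * q) = 1\<^sub>m n"
    using E_pow_mod[OF n0, of "n * q"] E_carrier by simp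
  have rot: "(\<Prod>j<n. \<gamma> ((i + j) mod n)) = (\<Prod>j<n. \<gamma> j)" for i
  proof (induction i)
    case 0
    show ?case by (intro prod.cong) auto
  next
    case (Suc i)
    \<comment> \<open>Both sides are the product over \<open>n + 1\<close> consecutive indices,
      whose two ends agree modulo \<open>n\<close>. Cancelling the common factor requires it to be
      nonzero, hence the case distinction below.\<close>
    have "(\<Prod>j<n. \<gamma> ((Suc i + j) mod n)) * \<gamma> (i mod n) = (\<Prod>j<Suc n. \<gamma> ((i + j) mod n))"
      by (subst prod.lessThan_Suc_shift) (simp add: mult.commute)
    also have "\<dots> = (\<Prod>j<n. \<gamma> ((i + j) mod n)) * \<gamma> (i mod n)" by simp
    finally have eq: "(\<Prod>j<n. \<gamma> ((Suc i + j) mod n)) * \<gamma> (i mod n) = (\<Prod>j<n. \<gamma> ((i + j) mod n)) * \<gamma> (i mod n)" .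
    show ?case
    proof (cases "\<gamma> (i mod n) = 0")
      case False
      then show ?thesis using eq Suc by simp
    next
      case True
      have im: "i mod n < n" using n0 by simp
      have "(Suc i + (n - 1)) mod n = i mod n" using n0 by simp
      then have "(\<Prod>j<n. \<gamma> ((Suc i + j) mod n)) = 0"
        using True n0 by (intro prod_zero) (auto intro!: bexI[of _ "n - 1"])
      moreover have "(\<Prod>j<n. \<gamma> j) = 0" using True im by (intro prod_zero) auto
      ultimately show ?thesis by metis
    qed
  qed
  have split: "(\<Prod>j<a + b. f j) = (\<Prod>j<a. f j) * (\<Prod>j<b. f (a + j))" for a b and f :: "nat \<Rightarrow> complex"
    by (induction b) (simp_all add: algebra_simps)
  have blk: "(\<Prod>j<n * q. \<gamma> ((i + j) mod n)) = (\<Prod>j<n. \<gamma> j) ^ q" for i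
  proof (induction q)
    case (Suc q)
    have "(\<Prod>j<n * Suc q. \<gamma> ((i + j) mod n)) =
        (\<Prod>j<n * q. \<gamma> ((i + j) mod n)) * (\<Prod>j<n. \<gamma> ((i + (n * q + j)) mod n))"
      using split[where a = "n * q" and b = n and f = "\<lambda>j. \<gamma> ((i + j) mod n)"] by (simp add: algebra_simps)
    also have "(\<Prod>j<n. \<gamma> ((i + (n * q + j)) mod n)) = (\<Prod>j<n. \<gamma> ((i + j) mod n))"
    proof (intro prod.cong refl)
      fix j
      have "(i + (n * q + j)) mod n = (i + j + n * q) mod n" by (simp add: ac_simps)
      then show "\<gamma> ((i + (n * q + j)) mod n) = \<gamma> ((i + j) mod n)" by simp
    qed
    finally show ?case using Suc rot[of i] by simp
  qed simp
  show ?thesis unfolding E_diag_pow[OF n0] E1 blk by (rule right_mult_one_mat[OF mat_diag_dim])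
qed

lemma mat_diag_E_pow_diagonal:
  assumes n0: "n > 0" and eq: "mat_diag n \<alpha> * E n ^\<^sub>m l = mat_diag n \<beta>" and nz: "\<alpha> 0 \<noteq> 0"
  shows "n dvd l"
proof (rule ccontr)
  assume "\<not> n dvd l"
  then have "l mod n \<noteq> 0" by (simp add: dvd_eq_mod_eq_0)
  moreover have "(mat_diag n \<alpha> * E n ^\<^sub>m l) $$ (0, l mod n) = \<alpha> 0"
    using mat_diag_E_pow_entry[OF n0 n0, of "l mod n" \<alpha> l] n0 by simp
  ultimately show False using nz n0 unfolding eq by (simp add: mat_diag_entry)
qed

lemma det_E_sq: "n > 0 \<Longrightarrow> det (E n) ^ 2 = 1"
proof -
  assume n0: "n > 0"
  have "E n * transpose_mat (E n) = 1\<^sub>m n"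
  proof (rule eq_matI)
    fix i j assume "i < dim_row (1\<^sub>m n)" "j < dim_col (1\<^sub>m n)"
    then have ij: "i < n" "j < n" by auto
    have inj: "Suc i mod n = Suc j mod n \<longleftrightarrow> i = j" using ij by (auto simp: mod_Suc split: if_splits)
    have "(E n * transpose_mat (E n)) $$ (i, j) = (\<Sum>k<n. E n $$ (i, k) * transpose_mat (E n) $$ (k, j))"
      using ij by (intro mult_entry) auto
    also have "\<dots> = (\<Sum>k<n. if k = Suc i mod n then (if i = j then 1 else 0) else 0)"
      using ij E_entry E_carrier inj by (intro sum.cong) auto
    also have "\<dots> = 1\<^sub>m n $$ (i, j)" using ij n0 by simp
    finally show "(E n * transpose_mat (E n)) $$ (i, j) = 1\<^sub>m n $$ (i, j)" .
  qed auto
  then have "det (E n) * det (transpose_mat (E n)) = 1"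
    by (metis det_mult[OF E_carrier transpose_carrier_mat[THEN iffD2, OF E_carrier]] det_one)
  then show ?thesis by (simp add: det_transpose[OF E_carrier] power2_eq_square)
qed

lemma det_pow_mat: "A \<in> carrier_mat n n \<Longrightarrow> det (A ^\<^sub>m k) = det A ^ k" for A :: "complex mat"
  by (induction k) (simp_all add: det_mult[OF pow_carrier_mat])

text \<open>The determinant has square 1, as \<open>E n\<close> is orthogonal, and n-th power 1, as
  the n-th power of \<open>E n\<close> is the identity; for odd \<open>n\<close> this determines it
  without the sign of an n-cycle.\<close>

lemma det_E_odd:
  assumes "odd n" shows "det (E n) = 1"
proof -
  have n0: "n > 0" using assms by (cases n) auto
  have "E n ^\<^sub>m n = 1\<^sub>m n" using E_pow_mod[OF n0, of n] E_carrier by simp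
  then have "det (E n) ^ n = 1" using det_pow_mat[OF E_carrier, of n] by simp
  moreover obtain k where "n = 2 * k + 1" using assms by (elim oddE)
  ultimately show ?thesis using det_E_sq[OF n0] by (simp add: power_mult)
qed

lemma det_E_2:
  assumes "n = 2" shows "det (E n) = - 1"
proof -
  have sw: "E n = swaprows 0 1 (1\<^sub>m n)"
    using assms by (intro eq_matI) (auto simp: E_def mat_swaprows_def)
  show ?thesis unfolding sw using assms by (subst det_swaprows[of 0 n 1]) auto
qed

lemma det_E_diag: "det (E_diag n \<gamma>) = (\<Prod>i<n. \<gamma> i) * det (E n)"
  unfolding E_diag_def det_mult[OF mat_diag_dim E_carrier] det_mat_diag ..

end

subsection \<open>Tori\<close>

lemma algebraic_group_iso_refl: "algebraic_group_iso K n G n G"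
  unfolding algebraic_group_iso_def
proof (intro bexI conjI)
  show "(\<lambda>x. x) \<in> iso ((GL K n)\<lparr>carrier := G\<rparr>) ((GL K n)\<lparr>carrier := G\<rparr>)" by (rule iso_set_refl)
  have "inv_into G (\<lambda>x. x) A = A" if "A \<in> G" for A
    using f_inv_into_f[of A "\<lambda>x. x" G] that by simp
  moreover have "\<exists>f\<in>regular_functions K n. \<forall>A\<in>G. A $$ (i, j) = f A" if "i < n" "j < n" for i j
    using regular_functions.entry[OF that, of K] by (intro bexI) auto
  ultimately show "regular_map_on K n n G (\<lambda>x. x)" "regular_map_on K n n G (inv_into G (\<lambda>x. x))"
    by (simp_all add: regular_map_on_def)
qed

context matrix_group_field begin

definition special_torus :: "complex mat set" where
  "special_torus = {mat_diag n \<beta> | \<beta>. (\<forall>i<n. \<beta> i \<in> K - {0}) \<and> (\<Prod>i<n. \<beta> i) = 1}"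

lemma mat_diag_in_special_torus:
  "mat_diag n \<beta> \<in> special_torus \<longleftrightarrow> (\<forall>i<n. \<beta> i \<in> K - {0}) \<and> (\<Prod>i<n. \<beta> i) = 1"
proof
  assume "mat_diag n \<beta> \<in> special_torus"
  then obtain \<alpha> where \<alpha>: "mat_diag n \<beta> = mat_diag n \<alpha>" "\<forall>i<n. \<alpha> i \<in> K - {0}" "(\<Prod>i<n. \<alpha> i) = 1"
    by (auto simp: special_torus_def)
  then have "\<forall>i<n. \<beta> i = \<alpha> i" by (simp add: mat_diag_eq_iff)
  moreover from this have "(\<Prod>i<n. \<beta> i) = (\<Prod>i<n. \<alpha> i)" by (intro prod.cong) auto
  ultimately show "(\<forall>i<n. \<beta> i \<in> K - {0}) \<and> (\<Prod>i<n. \<beta> i) = 1" using \<alpha> by simp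
qed (auto simp: special_torus_def)

lemma mat_diag_in_torus: "mat_diag n \<beta> \<in> torus K n \<longleftrightarrow> (\<forall>i<n. \<beta> i \<in> K - {0})"
proof
  assume "mat_diag n \<beta> \<in> torus K n"
  then obtain \<alpha> where "mat_diag n \<beta> = mat_diag n \<alpha>" "\<forall>i<n. \<alpha> i \<in> K - {0}"
    by (auto simp: torus_def)
  then show "\<forall>i<n. \<beta> i \<in> K - {0}" by (simp add: mat_diag_eq_iff)
qed (auto simp: torus_def)

text \<open>Dropping the last coordinate is inverted by appending the inverse determinant of the
  smaller matrix, which is a regular function, so the isomorphism is regular in both
  directions.\<close>

lemma special_torus_iso:
  assumes n2: "n \<ge> 2"
  shows "algebraic_group_iso K n special_torus (n - 1) (torus K (n - 1))"
proof -
  interpret M: matrix_group_field K "n - 1" by unfold_locales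
  define f where "f A = mat_diag (n - 1) (\<lambda>i. A $$ (i, i))" for A :: "complex mat"
  define g where "g B = mat_diag n (\<lambda>i. if i < n - 1 then B $$ (i, i) else inverse (det B))" for B :: "complex mat"
  have f: "f (mat_diag n \<alpha>) = mat_diag (n - 1) \<alpha>" for \<alpha>
    unfolding f_def by (rule M.mat_diag_cong) (simp add: mat_diag_entry)
  have g: "g (mat_diag (n - 1) \<alpha>) = mat_diag n (\<lambda>i. if i < n - 1 then \<alpha> i else inverse (\<Prod>i<n - 1. \<alpha> i))" for \<alpha>
    unfolding g_def by (rule mat_diag_cong) (simp add: mat_diag_entry det_mat_diag)
  have split: "(\<Prod>i<n. \<alpha> i) = (\<Prod>i<n - 1. \<alpha> i) * \<alpha> (n - 1)" for \<alpha> :: "nat \<Rightarrow> complex"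
    using n2 prod.lessThan_Suc[of \<alpha> "n - 1"] by simp
  have f_mem: "f A \<in> torus K (n - 1)" if A: "A \<in> special_torus" for A
  proof -
    obtain \<alpha> where \<alpha>: "A = mat_diag n \<alpha>" "\<forall>i<n. \<alpha> i \<in> K - {0}"
      using A unfolding special_torus_def by blast
    show ?thesis unfolding \<alpha>(1) f M.mat_diag_in_torus using \<alpha>(2) by simp
  qed
  have g_mem: "g B \<in> special_torus \<and> f (g B) = B" if B: "B \<in> torus K (n - 1)" for B
  proof -
    obtain \<alpha> where \<alpha>: "B = mat_diag (n - 1) \<alpha>" "\<forall>i<n - 1. \<alpha> i \<in> K - {0}"
      using B unfolding torus_def by blast
    let ?P = "\<Prod>i<n - 1. \<alpha> i"
    have P: "?P \<in> K" "?P \<noteq> 0" using \<alpha>(2) by (auto intro!: prod_K)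
    have "(\<Prod>i<n - 1. if i < n - 1 then \<alpha> i else inverse ?P) = ?P" by (intro prod.cong) auto
    then have "(\<Prod>i<n. if i < n - 1 then \<alpha> i else inverse ?P) = 1" unfolding split using P by simp
    moreover have "\<forall>i<n. (if i < n - 1 then \<alpha> i else inverse ?P) \<in> K - {0}"
      using \<alpha>(2) P inverse_K by simp
    ultimately have "g B \<in> special_torus" unfolding \<alpha>(1) g mat_diag_in_special_torus by blast
    moreover have "f (g B) = B" unfolding \<alpha>(1) g f by (rule M.mat_diag_cong) simp
    ultimately show ?thesis ..
  qed
  have gf: "g (f A) = A" if A: "A \<in> special_torus" for A
  proof -
    obtain \<alpha> where \<alpha>: "A = mat_diag n \<alpha>" "\<forall>i<n. \<alpha> i \<in> K - {0}" "(\<Prod>i<n. \<alpha> i) = 1"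
      using A unfolding special_torus_def by blast
    have "inverse (\<Prod>i<n - 1. \<alpha> i) = \<alpha> (n - 1)" using \<alpha>(3) unfolding split by (rule inverse_unique)
    moreover have "i = n - 1" if "i < n" "\<not> i < n - 1" for i using that by simp
    ultimately show ?thesis unfolding \<alpha>(1) f g by (intro mat_diag_cong) auto
  qed
  have bij: "bij_betw f special_torus (torus K (n - 1))"
    by (rule bij_betw_byWitness[where f' = g]) (use f_mem g_mem gf in auto)
  have inv: "inv_into special_torus f B = g B" if "B \<in> torus K (n - 1)" for B
    using bij g_mem[OF that] by (intro inv_into_f_eq) (auto simp: bij_betw_def)
  have hom: "f \<in> hom (GLK\<lparr>carrier := special_torus\<rparr>) ((GL K (n - 1))\<lparr>carrier := torus K (n - 1)\<rparr>)"
  proof (rule homI)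
    fix A B assume "A \<in> carrier (GLK\<lparr>carrier := special_torus\<rparr>)" "B \<in> carrier (GLK\<lparr>carrier := special_torus\<rparr>)"
    then obtain \<alpha> \<beta> where "A = mat_diag n \<alpha>" "B = mat_diag n \<beta>" by (auto simp: special_torus_def)
    then show "f (A \<otimes>\<^bsub>GLK\<lparr>carrier := special_torus\<rparr>\<^esub> B) = f A \<otimes>\<^bsub>(GL K (n - 1))\<lparr>carrier := torus K (n - 1)\<rparr>\<^esub> f B"
      by (simp add: f GL_def)
  qed (use f_mem in auto)
  show ?thesis
    unfolding algebraic_group_iso_def
  proof (intro bexI conjI)
    show "f \<in> iso (GLK\<lparr>carrier := special_torus\<rparr>) ((GL K (n - 1))\<lparr>carrier := torus K (n - 1)\<rparr>)"
      using hom bij by (simp add: iso_def)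
    show "regular_map_on K n (n - 1) special_torus f"
      unfolding regular_map_on_def
    proof (intro allI impI)
      fix i j assume ij: "i < n - 1" "j < n - 1"
      show "\<exists>F\<in>regular_functions K n. \<forall>A\<in>special_torus. f A $$ (i, j) = F A"
      proof (cases "i = j")
        case True
        show ?thesis
          by (rule bexI[OF _ regular_functions.entry[of j n j]]) (use ij True in \<open>auto simp: f_def mat_diag_entry\<close>)
      next
        case False
        show ?thesis
          by (rule bexI[OF _ regular_functions.const[OF zero_K]]) (use ij False in \<open>auto simp: f_def mat_diag_entry\<close>)
      qed
    qed
    show "regular_map_on K (n - 1) n (torus K (n - 1)) (inv_into special_torus f)"
      unfolding regular_map_on_def
    proof (intro allI impI)
      fix i j assume ij: "i < n" "j < n"
      consider "i = j" "j < n - 1" | "i = j" "\<not> j < n - 1" | "i \<noteq> j" by blast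
      then show "\<exists>F\<in>regular_functions K (n - 1). \<forall>A\<in>torus K (n - 1). inv_into special_torus f A $$ (i, j) = F A"
      proof cases
        case 1
        show ?thesis
          by (rule bexI[OF _ regular_functions.entry[of j "n - 1" j]]) (use ij 1 inv in \<open>auto simp: g_def mat_diag_entry\<close>)
      next
        case 2
        show ?thesis
          by (rule bexI[OF _ regular_functions.inverse_det]) (use ij 2 inv in \<open>auto simp: g_def mat_diag_entry\<close>)
      next
        case 3
        show ?thesis
          by (rule bexI[OF _ regular_functions.const[OF zero_K]]) (use ij 3 inv in \<open>auto simp: g_def mat_diag_entry\<close>)
      qed
    qed
  qed
qed

text \<open>Connectedness arguments need regular functions on the whole linear group, whereas
  \<open>poly_character\<close> is a function of diagonal entries; this provides an
  extension.\<close>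

lemma regular_poly_character:
  assumes n0: "n > 0"
  shows "\<exists>F\<in>regular_functions K n. \<forall>\<alpha>. (\<forall>i<n. \<alpha> i \<noteq> 0) \<longrightarrow> F (mat_diag n \<alpha>) = poly_character n f \<alpha>"
proof -
  have "\<forall>j. \<exists>F\<in>regular_functions K n. \<forall>\<alpha>. (\<forall>i<n. \<alpha> i \<noteq> 0) \<longrightarrow> F (mat_diag n \<alpha>) = \<alpha> (j mod n) powi coeff f j"
    using regular_coordinate_powi n0 by simp
  then obtain F where F: "\<And>j. F j \<in> regular_functions K n"
    "\<And>j \<alpha>. \<forall>i<n. \<alpha> i \<noteq> 0 \<Longrightarrow> F j (mat_diag n \<alpha>) = \<alpha> (j mod n) powi coeff f j" by metis
  show ?thesis
    by (rule bexI[of _ "\<lambda>A. \<Prod>j\<le>degree f. F j A"])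
      (auto intro!: regular_prod F simp: F(2) poly_character_def)
qed

end

subsection \<open>Groups generated over the identity component by a cyclic monomial matrix\<close>

text \<open>The situation after conjugation to normal form. \<open>N\<close> is only an exponent as
  in \<open>cyclic_over\<close>; the order of the component group is determined later.\<close>

locale cyclic_monomial_group = matrix_group_field +
  fixes H :: "complex mat set" and N :: nat and a :: complex
  assumes prime_n: "prime n" and closed_K: "algebraically_closed_subfield K"
    and algebraic: "algebraic_group K n H" and irred: "irreducible_group K n H"
    and a_K: "a \<in> K - {0}"
    and cyclic: "cyclic_over H (E_diag n (\<lambda>i. if Suc i = n then a else 1)) N"
    and diag: "\<And>A. A \<in> idc H \<Longrightarrow> \<exists>\<alpha>. A = mat_diag n \<alpha>"
begin

definition \<gamma> :: "nat \<Rightarrow> complex" where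
  "\<gamma> = (\<lambda>i. if Suc i = n then a else 1)"

definition h :: "complex mat" where
  "h = E_diag n \<gamma>"

lemma n2: "n \<ge> 2" and n0: "n > 0"
  using prime_ge_2_nat[OF prime_n] by simp_all

lemma subgroup_H: "subgroup H GLK" and closed_H: "closedin zar H"
  using algebraic by (auto simp: algebraic_group_def)

lemma H_carrier: "A \<in> H \<Longrightarrow> A \<in> carrier GLK"
  by (rule subgroup.mem_carrier[OF subgroup_H])

lemma h_H: "h \<in> H" and N0: "N > 0" and h_N: "h ^\<^sub>m N \<in> idc H"
  and decompose: "\<And>A. A \<in> H \<Longrightarrow> \<exists>j. \<exists>B\<in>idc H. A = B * h ^\<^sub>m j"
  using cyclic by (auto simp: cyclic_over_def h_def \<gamma>_def)

lemma compose: "B \<in> idc H \<Longrightarrow> B * h ^\<^sub>m j \<in> H"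
  using GL_subgroup_mult[OF subgroup_H _ GL_subgroup_pow[OF subgroup_H h_H]] idc_subset by blast

definition D :: "(nat \<Rightarrow> complex) set" where
  "D = {\<alpha>. mat_diag n \<alpha> \<in> idc H}"

lemma D_nonzero:
  assumes "\<alpha> \<in> D" shows "\<forall>i<n. \<alpha> i \<in> K - {0}" "\<forall>i<n. \<alpha> i \<noteq> 0"
proof -
  have "mat_diag n \<alpha> \<in> carrier GLK" using assms idc_subset H_carrier unfolding D_def by blast
  then show "\<forall>i<n. \<alpha> i \<in> K - {0}" by (simp add: mat_diag_GL_iff)
  then show "\<forall>i<n. \<alpha> i \<noteq> 0" by blast
qed

lemma one_D: "(\<lambda>_. 1) \<in> D"
  using one_in_idc[OF subgroup_H] by (simp add: D_def)

text \<open>Conjugation by \<open>h\<close> preserves the identity component. The diagonal part of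
  \<open>h\<close> commutes with diagonal matrices, so what remains is the cyclic shift by
  \<open>E n\<close>.\<close>

lemma shift_D:
  assumes \<alpha>: "\<alpha> \<in> D" shows "(\<lambda>i. \<alpha> (Suc i mod n)) \<in> D"
proof -
  let ?A = "mat_diag n \<alpha>" and ?B = "mat_diag n (\<lambda>i. \<alpha> (Suc i mod n))"
  have hc: "h \<in> carrier GLK" using h_H H_carrier by blast
  have "?B \<in> carrier GLK" using D_nonzero(1)[OF \<alpha>] n0 by (intro mat_diag_GL) auto
  have "h * ?A = ?B * h"
  proof (rule eq_matI)
    fix i j assume "i < dim_row (?B * h)" "j < dim_col (?B * h)"
    then have ij: "i < n" "j < n" by (auto simp: h_def mat_diag_def)
    then show "(h * ?A) $$ (i, j) = (?B * h) $$ (i, j)"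
      unfolding h_def mat_diag_mult_right[OF E_diag_carrier] mat_diag_mult_left[OF E_diag_carrier]
      by (simp add: E_diag_entry)
  qed (auto simp: h_def mat_diag_def)
  then have "cj h ?A = ?B * h * iv h" by simp
  also have "\<dots> = ?B * (h * iv h)" using GL_m_assoc[OF \<open>?B \<in> carrier GLK\<close> hc iv_closed[OF hc]] .
  also have "\<dots> = ?B" using iv_mult(2)[OF hc] GL_r_one[OF \<open>?B \<in> carrier GLK\<close>] by simp
  finally show ?thesis using cj_idc_self[OF subgroup_H h_H, of ?A] \<alpha> by (simp add: D_def)
qed

lemma nonscalar: "\<exists>\<alpha>\<in>D. \<alpha> 0 \<noteq> \<alpha> 1"
proof (rule ccontr)
  assume neg: "\<not> ?thesis"
  \<comment> \<open>The negated claim makes the first two entries of each member of \<open>D\<close>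
    equal; applied to all cyclic shifts it makes all entries equal.\<close>
  have const: "\<alpha> i = \<alpha> 0" if "\<alpha> \<in> D" "i < n" for \<alpha> i
    using that
  proof (induction i arbitrary: \<alpha>)
    case (Suc i)
    have "\<alpha> (Suc i) = (\<lambda>i. \<alpha> (Suc i mod n)) i" using Suc.prems by simp
    also have "\<dots> = (\<lambda>i. \<alpha> (Suc i mod n)) 0"
      using Suc.IH[OF shift_D[OF Suc.prems(1)]] Suc.prems(2) by simp
    also have "\<dots> = \<alpha> 0" using neg Suc.prems(1) n2 by (metis One_nat_def Suc_1 Suc_le_lessD mod_less)
    finally show ?case .
  qed simp
  \<comment> \<open>The eigenvalue is an n-th root of \<open>a\<close>; algebraic closedness of
    \<open>K\<close> supplies it as a root of x^n - a.\<close>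
  obtain l where l: "l \<in> K" "l ^ n = a"
  proof -
    let ?p = "monom 1 n - [:a:] :: complex poly"
    have c: "coeff ?p i = (if i = n then 1 else if i = 0 then - a else 0)" for i
      using n0 by (auto simp: coeff_pCons split: nat.split)
    have "range (coeff ?p) \<subseteq> K" using c a_K zero_K one_K uminus_K by auto
    moreover have "coeff ?p n \<noteq> 0" unfolding c by simp
    then have "degree ?p > 0" using le_degree[of ?p n] n0 by linarith
    ultimately obtain z where "z \<in> K" "poly ?p z = 0"
      using closed_K unfolding algebraically_closed_subfield_def by blast
    then show thesis using that by (simp add: poly_monom)
  qed
  \<comment> \<open>The powers of \<open>l\<close> form an eigenvector: each row of \<open>h\<close>
    moves to the next power, and the last row closes up because \<open>l ^ n = a\<close>. Its line
    is invariant under scalars and \<open>h\<close>, hence under \<open>H\<close>.\<close>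
  define v where "v = vec n (\<lambda>i. l ^ i)"
  have v: "v \<in> vK" "v \<in> carrier_vec n" using l(1) power_K by (auto simp: v_def vK_iff)
  have hv: "h *\<^sub>v v = l \<cdot>\<^sub>v v"
  proof (rule eq_vecI)
    fix i assume "i < dim_vec (l \<cdot>\<^sub>v v)"
    then have i: "i < n" by (simp add: v_def)
    have "(h *\<^sub>v v) $ i = (\<Sum>c<n. if c = Suc i mod n then \<gamma> i * l ^ (Suc i mod n) else 0)"
      unfolding h_def mat_vec_entry[OF E_diag_carrier v(2) i]
      using i by (intro sum.cong) (auto simp: E_diag_entry v_def)
    also have "\<dots> = \<gamma> i * l ^ (Suc i mod n)" using n0 by simp
    also have "\<dots> = l * l ^ i"
    proof (cases "Suc i = n")
      case True
      then have "l * l ^ i = a" using l(2) by (metis power_Suc)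
      then show ?thesis using True by (simp add: \<gamma>_def)
    qed (use i in \<open>simp add: \<gamma>_def\<close>)
    finally show "(h *\<^sub>v v) $ i = (l \<cdot>\<^sub>v v) $ i" using i by (simp add: v_def)
  qed (simp add: v_def h_def)
  define W where "W = {c \<cdot>\<^sub>v v | c. c \<in> K}"
  have "linear_subspace K n W"
    unfolding linear_subspace_iff[OF subfield_K]
  proof (intro conjI ballI allI impI subsetI)
    show "w \<in> carrier_vec n" if "w \<in> W" for w using that v by (auto simp: W_def)
    show "w $ i \<in> K" if "w \<in> W" "i < n" for w i using that v by (auto simp: W_def vK_iff mult_K)
    have "0\<^sub>v n = 0 \<cdot>\<^sub>v v" using v by auto
    then show "0\<^sub>v n \<in> W" unfolding W_def using zero_K by blast
    show "u + w \<in> W" if uw: "u \<in> W" "w \<in> W" for u w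
    proof -
      obtain c d where "u = c \<cdot>\<^sub>v v" "w = d \<cdot>\<^sub>v v" "c \<in> K" "d \<in> K"
        using uw unfolding W_def by blast
      moreover from this have "u + w = (c + d) \<cdot>\<^sub>v v" by (simp add: add_smult_distrib_vec)
      ultimately show ?thesis unfolding W_def using add_K by blast
    qed
    show "c \<cdot>\<^sub>v w \<in> W" if "c \<in> K" "w \<in> W" for c w
      using that mult_K by (auto simp: W_def smult_smult_assoc)
  qed
  moreover have "A *\<^sub>v w \<in> W" if A: "A \<in> H" and w: "w \<in> W" for A w
  proof -
    obtain j B where B: "B \<in> idc H" "A = B * h ^\<^sub>m j" using decompose[OF A] by blast
    obtain \<alpha> where \<alpha>: "B = mat_diag n \<alpha>" using diag[OF B(1)] by blast
    then have \<alpha>D: "\<alpha> \<in> D" using B(1) by (simp add: D_def)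
    obtain c where c: "w = c \<cdot>\<^sub>v v" "c \<in> K" using w by (auto simp: W_def)
    have hm: "h \<in> carrier_mat n n" by (simp add: h_def)
    have hj: "h ^\<^sub>m j *\<^sub>v v = l ^ j \<cdot>\<^sub>v v"
    proof (induction j)
      case 0
      then show ?case using v hm by simp
    next
      case (Suc j)
      have "h ^\<^sub>m Suc j *\<^sub>v v = h ^\<^sub>m j *\<^sub>v (h *\<^sub>v v)"
        using assoc_mult_mat_vec[OF pow_carrier_mat[OF hm] hm v(2)] by simp
      also have "\<dots> = l \<cdot>\<^sub>v (h ^\<^sub>m j *\<^sub>v v)"
        unfolding hv by (rule mult_mat_vec[OF pow_carrier_mat[OF hm] v(2)])
      finally show ?case unfolding Suc by (simp add: smult_smult_assoc)
    qed
    have Bv: "B *\<^sub>v v = \<alpha> 0 \<cdot>\<^sub>v v"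
    proof (rule eq_vecI)
      fix i assume "i < dim_vec (\<alpha> 0 \<cdot>\<^sub>v v)"
      then have i: "i < n" by (simp add: v_def)
      have "(B *\<^sub>v v) $ i = (\<Sum>c<n. if c = i then \<alpha> i * v $ i else 0)"
        unfolding \<alpha> mat_vec_entry[OF mat_diag_dim v(2) i] using i by (intro sum.cong) (auto simp: mat_diag_entry)
      then show "(B *\<^sub>v v) $ i = (\<alpha> 0 \<cdot>\<^sub>v v) $ i" using i const[OF \<alpha>D i] by (simp add: v_def)
    qed (simp add: v_def \<alpha> mat_diag_def)
    have Bm: "B \<in> carrier_mat n n" by (simp add: \<alpha>)
    have "A *\<^sub>v w = c \<cdot>\<^sub>v (B *\<^sub>v (h ^\<^sub>m j *\<^sub>v v))"
      unfolding B(2) c(1) mult_mat_vec[OF mult_carrier_mat[OF Bm pow_carrier_mat[OF hm]] v(2)]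
        assoc_mult_mat_vec[OF Bm pow_carrier_mat[OF hm] v(2)] ..
    also have "\<dots> = (c * (l ^ j * \<alpha> 0)) \<cdot>\<^sub>v v"
      unfolding hj mult_mat_vec[OF Bm v(2)] Bv by (simp add: smult_smult_assoc)
    finally show ?thesis
      unfolding W_def using c(2) power_K[OF l(1)] D_nonzero(1)[OF \<alpha>D] n0 mult_K by blast
  qed
  ultimately have "W = {0\<^sub>v n} \<or> W = vK" using irred unfolding irreducible_group_def by blast
  moreover have "v \<in> W" using v one_K unfolding W_def by (intro CollectI exI[of _ 1]) simp
  moreover have "v $ 0 = 1" using n0 by (simp add: v_def)
  ultimately have "W = vK" using n0 by auto
  \<comment> \<open>The line through \<open>v\<close>, whose entry 0 is 1, cannot contain the second
    unit vector; this is where \<open>n \<ge> 2\<close> enters.\<close>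
  then have "unit_vec n 1 \<in> W" using unit_vec_vK by blast
  then obtain c where c: "unit_vec n 1 = c \<cdot>\<^sub>v v" by (auto simp: W_def)
  have "c = 0" using arg_cong[OF c, of "\<lambda>w. w $ 0"] n2 n0 by (simp add: v_def)
  then show False using arg_cong[OF c, of "\<lambda>w. w $ 1"] n2 by (simp add: v_def)
qed

text \<open>The values of \<open>F\<close> on the component are roots of unity of order dividing
  \<open>\<bar>c\<bar>\<close>, so there are finitely many, and
  \<open>connected_finite_values\<close> makes \<open>F\<close> constant.\<close>

lemma character_saturated:
  assumes F: "F \<in> regular_functions K n" and c: "c \<noteq> 0"
    and p: "\<And>\<alpha>. \<alpha> \<in> D \<Longrightarrow> F (mat_diag n \<alpha>) powi c = 1" and one: "F (1\<^sub>m n) = 1"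
    and \<alpha>: "\<alpha> \<in> D"
  shows "F (mat_diag n \<alpha>) = 1"
proof -
  have "F ` idc H \<subseteq> {z. z ^ nat \<bar>c\<bar> = 1}"
  proof
    fix z assume "z \<in> F ` idc H"
    then obtain \<beta> where "\<beta> \<in> D" "z = F (mat_diag n \<beta>)" using diag by (auto simp: D_def)
    then have "z powi c = 1" using p by blast
    then show "z \<in> {z. z ^ nat \<bar>c\<bar> = 1}"
      by (auto simp: power_int_def abs_if power_inverse split: if_splits)
  qed
  moreover have "finite {z::complex. z ^ nat \<bar>c\<bar> = 1}"
    using c by (intro finite_roots_unity) simp
  ultimately have "finite (F ` idc H)" by (rule finite_subset)
  then have "F (mat_diag n \<alpha>) = F (1\<^sub>m n)"
    using connected_finite_values[OF connected_idc F _ one_in_idc[OF subgroup_H]] \<alpha> by (simp add: D_def)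
  then show ?thesis using one by simp
qed

lemma trivial_monomial_constant:
  assumes "\<forall>\<alpha>\<in>D. laurent_monomial n m \<alpha> = 1" "i < n" "j < n"
  shows "m i = m j"
proof -
  obtain \<alpha>0 where \<alpha>0: "\<alpha>0 \<in> D" "\<alpha>0 0 \<noteq> \<alpha>0 1" using nonscalar by blast
  show ?thesis
  proof (rule shift_invariant_trivial_monomial[OF prime_n D_nonzero(2) shift_D _ \<alpha>0 assms])
    fix f c assume c: "c \<noteq> 0" and p: "\<forall>\<alpha>\<in>D. poly_character n f \<alpha> powi c = 1"
    obtain F where F: "F \<in> regular_functions K n"
      "\<And>\<alpha>. \<forall>i<n. \<alpha> i \<noteq> 0 \<Longrightarrow> F (mat_diag n \<alpha>) = poly_character n f \<alpha>"
      using regular_poly_character[OF n0, of f] by blast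
    have "F (1\<^sub>m n) = 1" using F(2)[of "\<lambda>_. 1"] by (simp add: poly_character_def)
    then have "F (mat_diag n \<alpha>) = 1" if "\<alpha> \<in> D" for \<alpha>
      using character_saturated[OF F(1) c _ _ that] p F(2)[OF D_nonzero(2)] by simp
    then show "\<forall>\<alpha>\<in>D. poly_character n f \<alpha> = 1" using F(2)[OF D_nonzero(2)] by simp
  qed
qed

section \<open>The identity component: full torus or determinant one\<close>

lemma in_idc:
  assumes t: "\<forall>i<n. t i \<in> K - {0}"
    and triv: "\<And>m. \<forall>\<alpha>\<in>D. laurent_monomial n m \<alpha> = 1 \<Longrightarrow> laurent_monomial n m t = 1"
  shows "mat_diag n t \<in> idc H"
proof (rule closed_diagonal_group[OF closedin_idc[OF closed_H] D_def _ _ t triv])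
  show "D \<noteq> {}" using one_D by blast
  show "A * B \<in> idc H" if "A \<in> idc H" "B \<in> idc H" for A B
    using GL_subgroup_mult[OF subgroup_idc[OF subgroup_H] that] .
qed

lemma idc_eqI:
  assumes "\<And>\<alpha>. \<alpha> \<in> D \<longleftrightarrow> mat_diag n \<alpha> \<in> X" "\<And>A. A \<in> X \<Longrightarrow> \<exists>\<alpha>. A = mat_diag n \<alpha>"
  shows "idc H = X"
  using assms diag unfolding D_def by blast

lemma idc_cases:
  obtains "idc H = torus K n" | "idc H = special_torus"
proof (cases "\<forall>m. (\<forall>\<alpha>\<in>D. laurent_monomial n m \<alpha> = 1) \<longrightarrow> (\<forall>i<n. m i = 0)")
  case True
  have "idc H = torus K n"
  proof (rule idc_eqI)
    fix \<alpha>
    show "\<alpha> \<in> D \<longleftrightarrow> mat_diag n \<alpha> \<in> torus K n"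
    proof
      assume "mat_diag n \<alpha> \<in> torus K n"
      then have "\<forall>i<n. \<alpha> i \<in> K - {0}" by (simp add: mat_diag_in_torus)
      moreover have "laurent_monomial n m \<alpha> = 1" if "\<forall>\<alpha>\<in>D. laurent_monomial n m \<alpha> = 1" for m
      proof -
        have "\<forall>i<n. m i = 0" using True[THEN spec, of m] that by (rule mp)
        then show ?thesis by (simp add: laurent_monomial_def)
      qed
      ultimately have "mat_diag n \<alpha> \<in> idc H" by (rule in_idc)
      then show "\<alpha> \<in> D" by (simp add: D_def)
    qed (use D_nonzero(1) mat_diag_in_torus in blast)
  qed (auto simp: torus_def)
  then show thesis by (rule that(1))
next
  case False
  then obtain m i0 where m: "\<forall>\<alpha>\<in>D. laurent_monomial n m \<alpha> = 1" "i0 < n" "m i0 \<noteq> 0" by blast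
  \<comment> \<open>Constant exponents make every trivial character a power of the
    determinant.\<close>
  have const: "laurent_monomial n l \<alpha> = (\<Prod>i<n. \<alpha> i) powi l 0"
    if "\<forall>\<alpha>\<in>D. laurent_monomial n l \<alpha> = 1" for l \<alpha>
  proof -
    have "laurent_monomial n l \<alpha> = (\<Prod>i<n. \<alpha> i powi l 0)"
      unfolding laurent_monomial_def
    proof (intro prod.cong refl)
      fix i assume "i \<in> {..<n}"
      then have "l i = l 0" by (intro trivial_monomial_constant[OF that _ n0]) simp
      then show "\<alpha> i powi l i = \<alpha> i powi l 0" by (rule arg_cong)
    qed
    then show ?thesis by (simp add: prod_powi)
  qed
  have m0: "m 0 \<noteq> 0" using trivial_monomial_constant[OF m(1,2) n0] m(3) by simp
  \<comment> \<open>On diagonal matrices this regular function is the determinant. Some nonzero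
    power of it is trivial on \<open>D\<close>, and saturation makes it trivial itself.\<close>
  let ?F = "\<lambda>A :: complex mat. \<Prod>i<n. A $$ (i, i)"
  have F: "?F \<in> regular_functions K n" by (intro regular_prod regular_functions.entry) auto
  have F_diag: "?F (mat_diag n \<alpha>) = (\<Prod>i<n. \<alpha> i)" for \<alpha> by (intro prod.cong) (auto simp: mat_diag_entry)
  have det1: "(\<Prod>i<n. \<alpha> i) = 1" if "\<alpha> \<in> D" for \<alpha>
    using character_saturated[OF F m0 _ _ that] const[OF m(1)] m(1) unfolding F_diag by simp
  have "idc H = special_torus"
  proof (rule idc_eqI)
    fix \<alpha>
    show "\<alpha> \<in> D \<longleftrightarrow> mat_diag n \<alpha> \<in> special_torus"
    proof
      assume "mat_diag n \<alpha> \<in> special_torus"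
      then have \<alpha>: "\<forall>i<n. \<alpha> i \<in> K - {0}" "(\<Prod>i<n. \<alpha> i) = 1" by (simp_all add: mat_diag_in_special_torus)
      then have "laurent_monomial n l \<alpha> = 1" if "\<forall>\<alpha>\<in>D. laurent_monomial n l \<alpha> = 1" for l
        using const[OF that] by simp
      with \<alpha>(1) have "mat_diag n \<alpha> \<in> idc H" by (rule in_idc)
      then show "\<alpha> \<in> D" by (simp add: D_def)
    qed (use D_nonzero(1) det1 mat_diag_in_special_torus in blast)
  qed (auto simp: special_torus_def)
  then show thesis by (rule that(2))
qed

section \<open>Powers of the generator and the two cases\<close>

definition b :: "nat \<Rightarrow> nat \<Rightarrow> complex" where
  "b j i = (\<Prod>l<j. \<gamma> ((i + l) mod n))"

lemma b_K: "b j i \<in> K - {0}"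
proof -
  have "\<gamma> l \<in> K - {0}" for l using a_K one_K by (simp add: \<gamma>_def)
  then show ?thesis unfolding b_def by (auto intro!: prod_K)
qed

lemma h_pow: "h ^\<^sub>m j = mat_diag n (b j) * E n ^\<^sub>m j"
  unfolding h_def b_def by (rule E_diag_pow[OF n0])

lemma prod_\<gamma>: "(\<Prod>i<n. \<gamma> i) = a"
proof -
  have "(\<Prod>i<n. \<gamma> i) = (\<Prod>i<n. if i = n - 1 then a else 1)"
    using n0 by (intro prod.cong) (auto simp: \<gamma>_def)
  then show ?thesis using n0 by simp
qed

lemma h_pow_n: "h ^\<^sub>m (n * q) = mat_diag n (\<lambda>_. a ^ q)"
  unfolding h_def E_diag_pow_n[OF n0] prod_\<gamma> ..

lemma mat_diag_h_pow: "mat_diag n \<alpha> * h ^\<^sub>m j = mat_diag n (\<lambda>i. \<alpha> i * b j i) * E n ^\<^sub>m j"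
  unfolding h_pow
  using assoc_mult_mat[OF mat_diag_dim mat_diag_dim pow_carrier_mat[OF E_carrier], of \<alpha> "b j" j] by simp

lemma h_pow_diagonal:
  assumes "mat_diag n \<alpha> * h ^\<^sub>m j = mat_diag n \<beta>" "\<alpha> 0 \<noteq> 0"
  shows "n dvd j"
  using mat_diag_E_pow_diagonal[OF n0 assms(1)[unfolded mat_diag_h_pow]] assms(2) b_K[of j 0] by simp

lemma h_pow_idc_dvd:
  assumes "h ^\<^sub>m j \<in> idc H" shows "n dvd j"
proof -
  obtain \<beta> where "h ^\<^sub>m j = mat_diag n \<beta>" using diag[OF assms] by blast
  then show ?thesis using mat_diag_E_pow_diagonal[OF n0, of "b j" j \<beta>] b_K[of j 0] h_pow by simp
qed

lemma cyclic_h: "cyclic_over H h N"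
  using cyclic by (simp add: h_def \<gamma>_def)

lemma component_group_H:
  assumes "M > 0" "\<And>j. h ^\<^sub>m j \<in> idc H \<longleftrightarrow> M dvd j"
  shows "component_group K n H \<cong> integer_mod_group M"
    "generate (component_group K n H) {idc H #>\<^bsub>GLK\<^esub> h} = carrier (component_group K n H)"
  using component_group_cyclic[OF subgroup_H cyclic_h assms] by blast+

lemma torus_case:
  assumes idc: "idc H = torus K n"
  shows "H = (\<Union>l<n. monomial_matrices K n l)"
    and "algebraic_group_iso K n (idc H) n (torus K n)"
    and "component_group K n H \<cong> integer_mod_group n"
    and "det ` H = K - {0}"
proof -
  show "H = (\<Union>l<n. monomial_matrices K n l)"
  proof (intro equalityI subsetI)
    fix A assume "A \<in> H"
    then obtain j B where B: "B \<in> idc H" "A = B * h ^\<^sub>m j" using decompose by blast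
    then obtain \<alpha> where \<alpha>: "B = mat_diag n \<alpha>" "\<forall>i<n. \<alpha> i \<in> K - {0}" unfolding idc torus_def by blast
    have "A = mat_diag n (\<lambda>i. \<alpha> i * b j i) * E n ^\<^sub>m (j mod n)"
      unfolding B(2) \<alpha>(1) mat_diag_h_pow E_pow_mod[OF n0, of j] ..
    moreover have "\<forall>i<n. \<alpha> i * b j i \<in> K - {0}" using \<alpha>(2) b_K mult_K by simp
    ultimately have "A \<in> monomial_matrices K n (j mod n)" unfolding monomial_matrices_def by blast
    then show "A \<in> (\<Union>l<n. monomial_matrices K n l)" using n0 by auto
  next
    fix A assume "A \<in> (\<Union>l<n. monomial_matrices K n l)"
    then obtain l \<alpha> where \<alpha>: "A = mat_diag n \<alpha> * E n ^\<^sub>m l" "\<forall>i<n. \<alpha> i \<in> K - {0}"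
      unfolding monomial_matrices_def by blast
    \<comment> \<open>Dividing by the diagonal part of \<open>h ^\<^sub>m l\<close> leaves a
      diagonal matrix, which the full torus contains.\<close>
    have "\<forall>i<n. \<alpha> i / b l i \<in> K - {0}" using \<alpha>(2) b_K divide_K by simp
    then have "mat_diag n (\<lambda>i. \<alpha> i / b l i) \<in> idc H" unfolding idc by (simp only: mat_diag_in_torus)
    then have "mat_diag n (\<lambda>i. \<alpha> i / b l i) * h ^\<^sub>m l \<in> H" by (rule compose)
    then show "A \<in> H" unfolding mat_diag_h_pow \<alpha>(1) using b_K[of l] by simp
  qed
  show "algebraic_group_iso K n (idc H) n (torus K n)" unfolding idc by (rule algebraic_group_iso_refl)
  show "component_group K n H \<cong> integer_mod_group n"
  proof (rule component_group_H(1)[OF n0])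
    fix j
    have "mat_diag n (\<lambda>_. a ^ q) \<in> torus K n" for q
      using a_K power_K unfolding mat_diag_in_torus by simp
    then show "h ^\<^sub>m j \<in> idc H \<longleftrightarrow> n dvd j"
      using h_pow_idc_dvd[of j] h_pow_n unfolding idc by (metis dvdE)
  qed
  show "det ` H = K - {0}"
  proof (intro equalityI subsetI)
    fix x assume x: "x \<in> K - {0}"
    let ?A = "mat_diag n (\<lambda>i. if i = 0 then x else 1)"
    have "?A \<in> idc H" unfolding idc mat_diag_in_torus using x one_K by simp
    then have "?A \<in> H" using idc_subset by blast
    moreover have "det ?A = x" unfolding det_mat_diag using n0 by simp
    ultimately show "x \<in> det ` H" by (metis image_eqI)
  next
    fix x assume "x \<in> det ` H"
    then obtain A where "A \<in> H" "x = det A" by blast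
    then show "x \<in> K - {0}" using det_in_K[OF H_carrier] GL_det[OF H_carrier] by simp
  qed
qed

lemma special_torus_case:
  assumes idc: "idc H = special_torus"
  obtains s :: nat and k :: int where "s > 0"
    "H \<inter> monomial_matrices K n 0 = {mat_diag n \<beta> | \<beta>. (\<forall>i<n. \<beta> i \<in> K - {0}) \<and> (\<Prod>i<n. \<beta> i) ^ s = 1}"
    "(\<Prod>i<n. \<gamma> i) = exp (2 * \<i> * of_real pi * of_int k / of_nat (n * s))"
    "gcd k (int s) = 1"
    "generate (component_group K n H) {idc H #>\<^bsub>GLK\<^esub> h} = carrier (component_group K n H)"
    "component_group K n H \<cong> integer_mod_group (n * s)"
    "n = 2 \<Longrightarrow> det ` H = roots_of_unity (2 * s div nat (gcd (k + int s) 2))"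
    "n > 2 \<Longrightarrow> det ` H = roots_of_unity (n * s div nat (gcd k (int n)))"
proof -
  have a_pow: "mat_diag n (\<lambda>_. a ^ q) \<in> idc H \<longleftrightarrow> (a ^ n) ^ q = 1" for q
  proof -
    have "(a ^ q) ^ n = (a ^ n) ^ q" by (simp add: power_mult[symmetric] mult.commute)
    then show ?thesis unfolding idc mat_diag_in_special_torus using a_K power_K by simp
  qed
  \<comment> \<open>Since \<open>h ^\<^sub>m n\<close> is the scalar matrix \<open>a\<close>, its
    determinant is a^n; this has finite order because a power of \<open>h\<close> lies in the
    component, where determinants are 1.\<close>
  have "\<exists>q>0. (a ^ n) ^ q = 1"
  proof -
    obtain q where q: "N = n * q" using h_pow_idc_dvd[OF h_N] by (elim dvdE)
    then have "(a ^ n) ^ q = 1" using h_N a_pow h_pow_n by simp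
    then show ?thesis using N0 q by (intro exI[of _ q]) simp
  qed
  \<comment> \<open>The exact order of the determinant a^n of \<open>h ^\<^sub>m n\<close>; it makes
    \<open>n * s\<close> the order of \<open>h\<close> modulo the component.\<close>
  define s where "s = (LEAST s. s > 0 \<and> (a ^ n) ^ s = 1)"
  have s: "s > 0" "(a ^ n) ^ s = 1"
    unfolding s_def using LeastI_ex[OF \<open>\<exists>q>0. (a ^ n) ^ q = 1\<close>] by blast+
  have least: "s \<le> q" if "q > 0" "(a ^ n) ^ q = 1" for q
    unfolding s_def by (rule Least_le) (use that in blast)
  have prim: "(a ^ n) ^ j = 1 \<longleftrightarrow> s dvd j" for j
  proof
    assume j: "(a ^ n) ^ j = 1"
    have "(a ^ n) ^ j = (a ^ n) ^ (s * (j div s) + j mod s)" by simp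
    also have "\<dots> = ((a ^ n) ^ s) ^ (j div s) * (a ^ n) ^ (j mod s)"
      by (simp only: power_add power_mult)
    finally have "(a ^ n) ^ j = ((a ^ n) ^ s) ^ (j div s) * (a ^ n) ^ (j mod s)" .
    then have "(a ^ n) ^ (j mod s) = 1" using j s(2) by simp
    moreover have "j mod s < s" using s(1) by simp
    ultimately have "j mod s = 0" using least[of "j mod s"] by linarith
    then show "s dvd j" by (simp add: dvd_eq_mod_eq_0)
  next
    assume "s dvd j"
    then obtain q where "j = s * q" by (elim dvdE)
    then show "(a ^ n) ^ j = 1" by (simp only: power_mult[of "a ^ n" s q] s(2) power_one)
  qed
  have ns: "n * s > 0" using n0 s(1) by simp
  have "a ^ (n * s) = 1" using s(2) by (simp add: power_mult)
  then obtain k :: int where k: "a = cis (2 * pi * of_int k / of_nat (n * s))"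
    using root_of_unity_cis[OF ns] by blast
  have dvd: "int s dvd k * int j \<longleftrightarrow> s dvd j" for j
  proof -
    have "s dvd j \<longleftrightarrow> a ^ (n * j) = 1" using prim by (simp add: power_mult)
    also have "\<dots> \<longleftrightarrow> int (n * s) dvd k * int (n * j)" unfolding k by (rule cis_eq_1_iff_dvd[OF ns])
    also have "\<dots> \<longleftrightarrow> int n * int s dvd int n * (k * int j)" by (simp add: ac_simps)
    also have "\<dots> \<longleftrightarrow> int s dvd k * int j" using n0 by simp
    finally show ?thesis by simp
  qed
  \<comment> \<open>With a = e^(2 pi i k/(ns)), the power a^n is e^(2 pi i k/s), and its order is
    exactly \<open>s\<close> only if \<open>k\<close> and \<open>s\<close> are coprime.\<close>
  have gcd1: "gcd k (int s) = 1"
  proof -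
    define g where "g = nat (gcd k (int s))"
    have g: "int g = gcd k (int s)" by (simp add: g_def)
    obtain s' where s': "s = g * s'" by (metis g gcd_dvd2 int_dvd_int_iff dvdE)
    obtain k' where "k = int g * k'" by (metis g gcd_dvd1 dvdE)
    then have "k * int s' = int s * k'" using s' by simp
    then have "s dvd s'" using dvd[of s'] by simp
    then have "s \<le> s'" using s(1) s' by (intro dvd_imp_le) (auto intro: Nat.gr0I)
    then have "g = 1" using s' s(1) by (cases "g \<le> 1") (auto simp: le_Suc_eq)
    then show ?thesis using g by simp
  qed
  have h_idc: "h ^\<^sub>m j \<in> idc H \<longleftrightarrow> n * s dvd j" for j
  proof
    assume j: "h ^\<^sub>m j \<in> idc H"
    then obtain q where q: "j = n * q" using h_pow_idc_dvd by (blast elim: dvdE)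
    then have "s dvd q" using j h_pow_n a_pow prim by simp
    then show "n * s dvd j" using q by simp
  next
    assume "n * s dvd j"
    then obtain q where "j = n * s * q" by (elim dvdE)
    then have q: "j = n * (s * q)" by (simp only: mult.assoc)
    then show "h ^\<^sub>m j \<in> idc H" using h_pow_n a_pow prim by simp
  qed
  have H0: "H \<inter> monomial_matrices K n 0 = {mat_diag n \<beta> | \<beta>. (\<forall>i<n. \<beta> i \<in> K - {0}) \<and> (\<Prod>i<n. \<beta> i) ^ s = 1}"
  proof (intro equalityI subsetI)
    fix A assume A: "A \<in> H \<inter> monomial_matrices K n 0"
    then obtain \<beta> where \<beta>: "A = mat_diag n \<beta>" "\<forall>i<n. \<beta> i \<in> K - {0}"
      by (auto simp: monomial_matrices_def right_mult_one_mat[OF mat_diag_dim])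
    obtain j B where B: "B \<in> idc H" "A = B * h ^\<^sub>m j" using A decompose by blast
    then obtain \<alpha> where \<alpha>: "B = mat_diag n \<alpha>" "\<forall>i<n. \<alpha> i \<in> K - {0}" "(\<Prod>i<n. \<alpha> i) = 1"
      unfolding idc special_torus_def by blast
    have "n dvd j" using h_pow_diagonal[of \<alpha> j \<beta>] B(2) \<alpha> \<beta> n0 by auto
    then obtain q where q: "j = n * q" by (elim dvdE)
    have "mat_diag n \<beta> = mat_diag n (\<lambda>i. \<alpha> i * a ^ q)"
      using B(2) \<alpha>(1) \<beta>(1) unfolding q h_pow_n by simp
    then have eq: "\<forall>i<n. \<beta> i = \<alpha> i * a ^ q" by (simp add: mat_diag_eq_iff)
    have "(\<Prod>i<n. \<beta> i) = (\<Prod>i<n. \<alpha> i * a ^ q)" using eq by (intro prod.cong) auto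
    also have "\<dots> = (a ^ n) ^ q" using \<alpha>(3) by (simp add: prod.distrib power_mult[symmetric] mult.commute)
    finally have "(\<Prod>i<n. \<beta> i) ^ s = ((a ^ n) ^ s) ^ q" by (simp add: power_mult[symmetric] ac_simps)
    then show "A \<in> {mat_diag n \<beta> | \<beta>. (\<forall>i<n. \<beta> i \<in> K - {0}) \<and> (\<Prod>i<n. \<beta> i) ^ s = 1}"
      using \<beta> s(2) by auto
  next
    fix A assume "A \<in> {mat_diag n \<beta> | \<beta>. (\<forall>i<n. \<beta> i \<in> K - {0}) \<and> (\<Prod>i<n. \<beta> i) ^ s = 1}"
    then obtain \<beta> where \<beta>: "A = mat_diag n \<beta>" "\<forall>i<n. \<beta> i \<in> K - {0}" "(\<Prod>i<n. \<beta> i) ^ s = 1" by blast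
    \<comment> \<open>The powers of a^n exhaust the s-th roots of unity, so the determinant of
      \<open>A\<close> is (a^n)^q for some \<open>q\<close>; removing the scalar a^q, which is a
      power of \<open>h\<close>, leaves determinant 1.\<close>
    have "(\<Prod>i<n. \<beta> i) \<in> range (\<lambda>j. (a ^ n) ^ j)"
      unfolding powers_primitive_root[OF s(1) prim] roots_of_unity_def using \<beta>(3) by simp
    then obtain q where q: "(\<Prod>i<n. \<beta> i) = (a ^ n) ^ q" by blast
    have aq: "(a ^ q) ^ n = (a ^ n) ^ q" "(a ^ n) ^ q \<noteq> 0" using a_K by (simp_all add: power_mult[symmetric] mult.commute)
    have "(\<Prod>i<n. \<beta> i / a ^ q) = 1" using q aq by (simp add: prod_dividef)
    moreover have "\<forall>i<n. \<beta> i / a ^ q \<in> K - {0}" using \<beta>(2) a_K power_K divide_K by simp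
    ultimately have "mat_diag n (\<lambda>i. \<beta> i / a ^ q) \<in> idc H" unfolding idc mat_diag_in_special_torus by blast
    then have "mat_diag n (\<lambda>i. \<beta> i / a ^ q) * h ^\<^sub>m (n * q) \<in> H" by (rule compose)
    then have "A \<in> H" unfolding h_pow_n \<beta>(1) using a_K by simp
    moreover have "A = mat_diag n \<beta> * E n ^\<^sub>m 0" using right_mult_one_mat[OF mat_diag_dim[of n \<beta>]] \<beta>(1) by simp
    ultimately show "A \<in> H \<inter> monomial_matrices K n 0" using \<beta>(2) unfolding monomial_matrices_def by blast
  qed
  have prod: "(\<Prod>i<n. \<gamma> i) = exp (2 * \<i> * of_real pi * of_int k / of_nat (n * s))"
  proof -
    have "a = exp (2 * \<i> * of_real pi * of_int k / of_nat (n * s))"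
      unfolding k cis_conv_exp by (rule arg_cong[of _ _ exp]) simp
    then show ?thesis unfolding prod_\<gamma> .
  qed
  \<comment> \<open>The component has determinant 1, so the determinants on \<open>H\<close> are the
    powers of \<open>det h\<close>.\<close>
  have det_H: "det ` H = range (\<lambda>j. det h ^ j)"
  proof (intro equalityI subsetI)
    fix x assume "x \<in> det ` H"
    then obtain A where A: "A \<in> H" "x = det A" by blast
    then obtain j B where B: "B \<in> idc H" "A = B * h ^\<^sub>m j" using decompose by blast
    then obtain \<alpha> where \<alpha>: "B = mat_diag n \<alpha>" "(\<Prod>i<n. \<alpha> i) = 1" unfolding idc special_torus_def by blast
    have hm: "h \<in> carrier_mat n n" by (simp add: h_def)
    have "x = det B * det h ^ j"
      unfolding A(2) B(2) det_pow_mat[OF hm, symmetric] \<alpha>(1) by (rule det_mult[OF mat_diag_dim pow_carrier_mat[OF hm]])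
    then show "x \<in> range (\<lambda>j. det h ^ j)" using \<alpha> by (simp add: det_mat_diag)
  next
    fix x assume "x \<in> range (\<lambda>j. det h ^ j)"
    then obtain j where "x = det (h ^\<^sub>m j)" using det_pow_mat[of h] by (auto simp: h_def)
    then show "x \<in> det ` H" using GL_subgroup_pow[OF subgroup_H h_H] by blast
  qed
  have det_h: "det h = a * det (E n)" unfolding h_def det_E_diag prod_\<gamma> ..
  have cop: "coprime k (int s)" using gcd1 by (simp add: coprime_iff_gcd_eq_1)
  show thesis
  proof (rule that[OF s(1) H0 prod gcd1 component_group_H(2)[OF ns h_idc] component_group_H(1)[OF ns h_idc]])
    assume n: "n = 2"
    have "det h = - a" using det_h det_E_2[OF n] by simp
    \<comment> \<open>For \<open>n = 2\<close> the sign of \<open>det (E n)\<close> adds half a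
      turn, which with denominator 2s amounts to replacing \<open>k\<close> by
      \<open>k + s\<close>.\<close>
    also have "\<dots> = cis (2 * pi * of_int k / of_nat (n * s) + pi)" unfolding k by (rule minus_cis)
    also have "2 * pi * of_int k / of_nat (n * s) + pi = 2 * pi * of_int (k + int s) / of_nat (n * s)"
      using s(1) n by (simp add: field_simps)
    finally have "det ` H = roots_of_unity (n * s div nat (gcd (k + int s) (int (n * s))))"
      unfolding det_H using powers_of_cis[OF ns, of "k + int s"] by simp
    \<comment> \<open>\<open>k + int s\<close> is coprime to \<open>s\<close> along with
      \<open>k\<close>, so only the factor 2 of the modulus contributes.\<close>
    moreover have "gcd (k + int s) (int (n * s)) = gcd (k + int s) 2"
    proof -
      have "coprime (k + int s) (int s)" using gcd1 by (simp add: coprime_iff_gcd_eq_1)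
      then show ?thesis unfolding n by (simp add: gcd_mult_right_right_cancel)
    qed
    ultimately show "det ` H = roots_of_unity (2 * s div nat (gcd (k + int s) 2))" using n by simp
  next
    assume n: "n > 2"
    then have "odd n" using prime_odd_nat[OF prime_n] by simp
    then have "det h = a" using det_h det_E_odd by simp
    then have "det ` H = range (\<lambda>j. a ^ j)" unfolding det_H by simp
    also have "\<dots> = roots_of_unity (n * s div nat (gcd k (int (n * s))))"
      unfolding k by (rule powers_of_cis[OF ns])
    finally have "det ` H = roots_of_unity (n * s div nat (gcd k (int (n * s))))" .
    moreover have "gcd k (int (n * s)) = gcd k (int n)"
      using cop by (simp add: gcd_mult_right_right_cancel)
    ultimately show "det ` H = roots_of_unity (n * s div nat (gcd k (int n)))" by simp
  qed
qed

end

theorem mainTheorem4: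
  fixes K :: "complex set" and n :: nat and G :: "complex mat set"
  assumes "algebraically_closed_subfield K"
    and "prime n"
    and "algebraic_group K n G"
    and "irreducible_group K n G"
    and "imprimitive_group K n G"
    and "finite (carrier (component_group K n G))"
    and "cyclic_group (component_group K n G)"
  shows "\<exists>P \<in> carrier (GL K n).
    let H = conjugate_group K n P G; H0 = identity_component K n H in
      (H = (\<Union>l<n. monomial_matrices K n l) \<and>
       algebraic_group_iso K n H0 n (torus K n) \<and>
       component_group K n H \<cong> integer_mod_group n \<and>
       det ` H = K - {0})
    \<or>
      (\<exists>s>0. \<exists>\<alpha> (k::int).
         H \<inter> monomial_matrices K n 0 =
           {mat_diag n \<beta> | \<beta>. (\<forall>i<n. \<beta> i \<in> K - {0}) \<and> (\<Prod>i<n. \<beta> i) ^ s = 1} \<and>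
         (\<forall>i<n. \<alpha> i \<in> K - {0}) \<and>
         (\<Prod>i<n. \<alpha> i) = exp (2 * \<i> * of_real pi * of_int k / of_nat (n * s)) \<and>
         gcd k (int s) = 1 \<and>
         E_diag n \<alpha> \<in> H \<and>
         generate (component_group K n H) {H0 #>\<^bsub>GL K n\<^esub> E_diag n \<alpha>} =
           carrier (component_group K n H) \<and>
         H0 = {mat_diag n \<beta> | \<beta>. (\<forall>i<n. \<beta> i \<in> K - {0}) \<and> (\<Prod>i<n. \<beta> i) = 1} \<and>
         algebraic_group_iso K n H0 (n - 1) (torus K (n - 1)) \<and>
         component_group K n H \<cong> integer_mod_group (n * s) \<and>
         (n = 2 \<longrightarrow> det ` H = roots_of_unity (2 * s div nat (gcd (k + int s) 2))) \<and>
         (n > 2 \<longrightarrow> det ` H = roots_of_unity (n * s div nat (gcd k (int n)))))"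
proof -
  have subfield_K: "subfield K class_ring"
    using assms(1) by (simp add: algebraically_closed_subfield_def)
  interpret matrix_group_field K n by (rule matrix_group_field.intro) (rule subfield_K)
  have n0: "n > 0" using assms(2) by (rule prime_gt_0_nat)
  have G: "subgroup G GLK" using assms(3) by (simp add: algebraic_group_def)
  obtain g N where cyc: "cyclic_over G g N"
    using cyclic_component_group_imp[OF G assms(6,7)] .
  obtain P1 where P1: "P1 \<in> carrier GLK"
    "\<And>B. B \<in> cj P1 ` G \<Longrightarrow> \<exists>\<sigma>. \<sigma> permutes {..<n} \<and> (\<forall>i<n. \<forall>j<n. B $$ (i, j) \<noteq> 0 \<longrightarrow> i = \<sigma> j)"
    using imprimitive_imp_monomial[OF assms(2) G assms(4,5)] by blast
  let ?G1 = "cj P1 ` G"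
  have G1: "subgroup ?G1 GLK" by (rule subgroup_cj[OF P1(1) G])
  have Gc: "G \<subseteq> carrier GLK" using subgroup.subset[OF G] .
  have irr1: "irreducible_group K n ?G1" by (rule irreducible_cj[OF P1(1) Gc assms(4)])
  have cyc1: "cyclic_over ?G1 (cj P1 g) N" by (rule cyclic_over_cj[OF P1(1) G cyc])
  have mon: "\<exists>\<sigma>. monomial_matrix \<sigma> B" if "B \<in> ?G1" for B
    using P1(2)[OF that] unfolding monomial_matrix_def .
  have "g \<in> G" using cyc by (simp add: cyclic_over_def)
  then obtain \<sigma> where \<sigma>: "monomial_matrix \<sigma> (cj P1 g)" using mon by blast
  obtain P2 a where P2: "P2 \<in> carrier GLK" "a \<in> K - {0}"
    "cj P2 (cj P1 g) = E_diag n (\<lambda>i. if Suc i = n then a else 1)"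
    "\<And>A. A \<in> idc ?G1 \<Longrightarrow> \<exists>\<alpha>. cj P2 A = mat_diag n \<alpha>"
    using cyclic_normal_form[OF n0 G1 irr1 cyc1 \<sigma> idc_monomial_diagonal[OF G1 mon]] by blast
  \<comment> \<open>\<open>P1\<close> makes the group monomial and \<open>P2\<close> brings its
    generator to normal form.\<close>
  let ?P = "P2 * P1"
  have P: "?P \<in> carrier GLK" by (rule GL_m_closed[OF P2(1) P1(1)])
  have conj: "conjugate_group K n ?P G = cj P2 ` ?G1"
    unfolding conjugate_group_def image_image
    by (intro image_cong refl cj_cj[OF P2(1) P1(1), symmetric]) (use Gc in blast)
  interpret H: cyclic_monomial_group K n "cj P2 ` ?G1" N a
  proof (intro cyclic_monomial_group.intro cyclic_monomial_group_axioms.intro)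
    show "matrix_group_field K" by (rule matrix_group_field_axioms)
    show "algebraic_group K n (cj P2 ` ?G1)"
      by (intro algebraic_group_cj P2(1) P1(1) assms(3))
    show "irreducible_group K n (cj P2 ` ?G1)"
      by (rule irreducible_cj[OF P2(1) subgroup.subset[OF G1] irr1])
    show "cyclic_over (cj P2 ` ?G1) (E_diag n (\<lambda>i. if Suc i = n then a else 1)) N"
      using cyclic_over_cj[OF P2(1) G1 cyc1] unfolding P2(3) .
    show "\<exists>\<alpha>. A = mat_diag n \<alpha>" if "A \<in> idc (cj P2 ` ?G1)" for A
      using that P2(4) unfolding cj_idc_eq[OF P2(1) G1] by blast
  qed (use assms(1,2) P2(2) in auto)
  show ?thesis
    unfolding Let_def
  proof (rule bexI[OF _ P], unfold conj, goal_cases)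
    case 1
    consider "idc (cj P2 ` ?G1) = torus K n" | "idc (cj P2 ` ?G1) = special_torus" by (rule H.idc_cases)
    then show ?case
    proof cases
      case 1
      show ?thesis using H.torus_case[OF 1] by blast
    next
      case 2
      have \<gamma>: "\<forall>i<n. H.\<gamma> i \<in> K - {0}" using P2(2) one_K by (simp add: H.\<gamma>_def)
      have iso: "algebraic_group_iso K n (idc (cj P2 ` ?G1)) (n - 1) (torus K (n - 1))"
        unfolding 2 by (rule special_torus_iso[OF H.n2])
      show ?thesis
      proof (rule H.special_torus_case[OF 2], goal_cases)
        case (1 s k)
        \<comment> \<open>The matrix asked for is \<open>H.h\<close>, so \<open>H.\<gamma>\<close>
          is the witness for the coefficients: 1 everywhere except for \<open>a\<close> in the last
          place.\<close>
        show ?case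
          by (intro disjI2 exI[of _ s] exI[of _ H.\<gamma>] exI[of _ k] conjI impI
              1[unfolded H.h_def] \<gamma> H.h_H[unfolded H.h_def] iso 2[unfolded special_torus_def])
      qed
    qed
  qed
qed

end
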